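(* Let $G=(V,E)$ be a graph with $|E|\geq 1$, which has no isolated vertices. Then the following statements are equivalent: (a) $\mathbb{K}[G]$ is a complete intersection; (b) $G$ is (isomorphic to) one of the following graphs: $K_2$, $K_3$, $P_3$, $2K_2$, $C_4$, $K_4\setminus e$, $K_4$.
   Context: $\mathbb{K}$ is a field. All graphs are finite and simple with non-empty vertex set. $K_n$ is the complete graph on $n$ vertices, $P_n$ the path on $n$ vertices (of length $n-1$), $C_n$ the cycle on $n$ vertices, $2K_2$ the disjoint union of two copies of $K_2$, and $K_4\setminus e$ the graph obtained from $K_4$ by deleting one edge. For a graph $G=(V,E)$ let $S_G=\mathbb{K}[q_{A|B}]$ be the polynomial ring with one variable for each unordered partition $A|B$ of $V$ (i.e. $A\cup B=V$, $A\cap B=\emptyset$, empty parts allowed), standard graded, and $R_G=\mathbb{K}[s_{ij},t_{ij}:\{i,j\}\in E]$. Let $\mathrm{Cut}(A|B)\subseteq E$ be the set of edges with one endpoint in $A$ and the other in $B$. Let $\phi_G\colon S_G\to R_G$ be the $\mathbb{K}$-algebra homomorphism $q_{A|B}\mapsto \prod_{\{i,j\}\in \mathrm{Cut}(A|B)}s_{ij}\prod_{\{i,j\}\in E\setminus \mathrm{Cut}(A|B)}t_{ij}$. The cut ideal is $I_G=\ker\phi_G$ and the cut algebra is $\mathbb{K}[G]\cong S_G/I_G$, the image of $\phi_G$. *)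

theory Defs
  imports "HOL-Algebra.RingHom" "HOL-Library.Poly_Mapping"
begin

subsection \<open>Finite simple graphs\<close>

record 'v ugraph =
  verts :: "'v set"
  edges :: "'v set set"

definition simple_graph :: "'v ugraph \<Rightarrow> bool" where
  "simple_graph G \<longleftrightarrow> finite (verts G) \<and> verts G \<noteq> {} \<and>
     (\<forall>e\<in>edges G. e \<subseteq> verts G \<and> card e = 2)"

definition isolated_vertex :: "'v ugraph \<Rightarrow> 'v \<Rightarrow> bool" where
  "isolated_vertex G v \<longleftrightarrow> v \<in> verts G \<and> (\<forall>e\<in>edges G. v \<notin> e)"

definition graph_iso :: "'v ugraph \<Rightarrow> 'w ugraph \<Rightarrow> bool" where
  "graph_iso G H \<longleftrightarrow> (\<exists>f. bij_betw f (verts G) (verts H) \<and>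
     (\<forall>i\<in>verts G. \<forall>j\<in>verts G. {i, j} \<in> edges G \<longleftrightarrow> {f i, f j} \<in> edges H))"

definition complete_graph :: "nat \<Rightarrow> nat ugraph" where
  "complete_graph n = \<lparr>verts = {..<n}, edges = {{i, j} | i j. i < n \<and> j < n \<and> i \<noteq> j}\<rparr>"

definition path_graph :: "nat \<Rightarrow> nat ugraph" where
  "path_graph n = \<lparr>verts = {..<n}, edges = {{i, Suc i} | i. Suc i < n}\<rparr>"

text \<open>Only meaningful for \<open>n \<ge> 3\<close>.\<close>
definition cycle_graph :: "nat \<Rightarrow> nat ugraph" where
  "cycle_graph n = \<lparr>verts = {..<n}, edges = {{i, Suc i mod n} | i. i < n}\<rparr>"

definition disjoint_union_graph :: "'v ugraph \<Rightarrow> 'w ugraph \<Rightarrow> ('v + 'w) ugraph" where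
  "disjoint_union_graph G H =
     \<lparr>verts = verts G <+> verts H,
      edges = (\<lambda>e. Inl ` e) ` edges G \<union> (\<lambda>e. Inr ` e) ` edges H\<rparr>"

definition delete_edge :: "'v ugraph \<Rightarrow> 'v set \<Rightarrow> 'v ugraph" where
  "delete_edge G e = \<lparr>verts = verts G, edges = edges G - {e}\<rparr>"


subsection \<open>Polynomial rings\<close>

text \<open>
  A polynomial is a finitely supported map from monomials to coefficients, a monomial a finitely
  supported map from variables to exponents. The ring structure on the type is the convolution
  product from \<^theory>\<open>HOL-Library.Poly_Mapping\<close>.
\<close>
type_synonym ('x, 'k) mpolynomial = "('x \<Rightarrow>\<^sub>0 nat) \<Rightarrow>\<^sub>0 'k"

definition mp_const :: "'k \<Rightarrow> ('x, 'k::comm_ring_1) mpolynomial" where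
  "mp_const c = Poly_Mapping.single 0 c"

definition mp_var :: "'x \<Rightarrow> ('x, 'k::comm_ring_1) mpolynomial" where
  "mp_var x = Poly_Mapping.single (Poly_Mapping.single x 1) 1"

text \<open>The polynomial ring over the coefficient type in the variables from \<open>X\<close>.\<close>
definition mp_ring :: "'x set \<Rightarrow> ('x, 'k::comm_ring_1) mpolynomial ring" where
  "mp_ring X =
     \<lparr>carrier = {p. \<forall>m\<in>Poly_Mapping.keys p. Poly_Mapping.keys m \<subseteq> X},
      mult = (*), one = 1, zero = 0, add = (+)\<rparr>"

text \<open>The algebra homomorphism that sends each variable \<open>x\<close> to \<open>h x\<close>.\<close>
definition mp_subst ::
  "('x \<Rightarrow> ('y, 'k::comm_ring_1) mpolynomial) \<Rightarrow> ('x, 'k) mpolynomial \<Rightarrow> ('y, 'k) mpolynomial" where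
  "mp_subst h p = (\<Sum>m\<in>Poly_Mapping.keys p. mp_const (Poly_Mapping.lookup p m) *
     (\<Prod>x\<in>Poly_Mapping.keys m. h x ^ Poly_Mapping.lookup m x))"

text \<open>Homogeneity for the standard grading; the zero polynomial is homogeneous.\<close>
definition mp_homogeneous :: "('x, 'k::comm_ring_1) mpolynomial \<Rightarrow> bool" where
  "mp_homogeneous p \<longleftrightarrow> (\<exists>d. \<forall>m\<in>Poly_Mapping.keys p.
     (\<Sum>x\<in>Poly_Mapping.keys m. Poly_Mapping.lookup m x) = d)"

lemma mp_ring_simps [simp]:
  "p \<in> carrier (mp_ring X) \<longleftrightarrow> (\<forall>m\<in>Poly_Mapping.keys p. Poly_Mapping.keys m \<subseteq> X)"
  "p \<otimes>\<^bsub>mp_ring X\<^esub> q = p * q" "p \<oplus>\<^bsub>mp_ring X\<^esub> q = p + q"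
  "\<one>\<^bsub>mp_ring X\<^esub> = 1" "\<zero>\<^bsub>mp_ring X\<^esub> = 0"
  by (simp_all add: mp_ring_def)

lemma mp_ring_cring: "cring (mp_ring X :: ('x, 'k::comm_ring_1) mpolynomial ring)"
proof (rule cringI)
  show "abelian_group (mp_ring X :: ('x, 'k) mpolynomial ring)"
  proof (rule abelian_groupI)
    fix p q :: "('x, 'k) mpolynomial"
    assume "p \<in> carrier (mp_ring X)" "q \<in> carrier (mp_ring X)"
    then show "p \<oplus>\<^bsub>mp_ring X\<^esub> q \<in> carrier (mp_ring X)"
      using Poly_Mapping.keys_add[of p q] by auto
  next
    fix p :: "('x, 'k) mpolynomial"
    assume p: "p \<in> carrier (mp_ring X)"
    have "Poly_Mapping.keys (- p) = Poly_Mapping.keys p"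
      by (auto simp: in_keys_iff)
    with p show "\<exists>q\<in>carrier (mp_ring X). q \<oplus>\<^bsub>mp_ring X\<^esub> p = \<zero>\<^bsub>mp_ring X\<^esub>"
      by (intro bexI[of _ "- p"]) auto
  qed (auto simp: algebra_simps)
  show "Group.comm_monoid (mp_ring X :: ('x, 'k) mpolynomial ring)"
  proof (rule comm_monoidI)
    fix p q :: "('x, 'k) mpolynomial"
    assume pq: "p \<in> carrier (mp_ring X)" "q \<in> carrier (mp_ring X)"
    have "Poly_Mapping.keys m \<subseteq> X" if "m \<in> Poly_Mapping.keys (p * q)" for m
    proof -
      from that Poly_Mapping.keys_mult[of p q] obtain a b where
        "m = a + b" "a \<in> Poly_Mapping.keys p" "b \<in> Poly_Mapping.keys q"
        by blast
      with pq Poly_Mapping.keys_add[of a b] show ?thesis by fastforce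
    qed
    then show "p \<otimes>\<^bsub>mp_ring X\<^esub> q \<in> carrier (mp_ring X)" by simp
  qed (auto simp: algebra_simps)
qed (auto simp: algebra_simps)


subsection \<open>Complete intersections\<close>

definition regular_sequence :: "('a, 'b) ring_scheme \<Rightarrow> 'a list \<Rightarrow> bool" where
  "regular_sequence R fs \<longleftrightarrow>
     set fs \<subseteq> carrier R \<and>
     (\<forall>i<length fs. \<forall>g\<in>carrier R.
        (fs ! i) \<otimes>\<^bsub>R\<^esub> g \<in> Idl\<^bsub>R\<^esub> (set (take i fs)) \<longrightarrow> g \<in> Idl\<^bsub>R\<^esub> (set (take i fs))) \<and>
     Idl\<^bsub>R\<^esub> (set fs) \<noteq> carrier R"

text \<open>
  \<open>complete_intersection X I\<close>: the standard graded algebra \<open>mp_ring X Quot I\<close> is a complete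
  intersection, that is, \<open>I\<close> is generated by a regular sequence of homogeneous polynomials. The
  sequence may be empty, so a polynomial ring is a complete intersection.
\<close>
definition complete_intersection :: "'x set \<Rightarrow> ('x, 'k::field) mpolynomial set \<Rightarrow> bool" where
  "complete_intersection X I \<longleftrightarrow>
     (\<exists>fs. (\<forall>f\<in>set fs. mp_homogeneous f) \<and> regular_sequence (mp_ring X) fs \<and>
           I = Idl\<^bsub>mp_ring X\<^esub> (set fs))"


subsection \<open>Cut ideals\<close>

text \<open>The unordered partition \<open>A|B\<close> is the set \<open>{A, B}\<close>; it indexes the variable \<open>q\<^sub>A\<^sub>|\<^sub>B\<close>.\<close>
definition partitions :: "'v ugraph \<Rightarrow> 'v set set set" where
  "partitions G = {{A, B} | A B. A \<union> B = verts G \<and> A \<inter> B = {}}"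

definition Cut :: "'v ugraph \<Rightarrow> 'v set set \<Rightarrow> 'v set set" where
  "Cut G P = {e \<in> edges G. \<exists>A B i j. P = {A, B} \<and> i \<in> A \<and> j \<in> B \<and> e = {i, j}}"

datatype 'v edge_var = S_var "'v set" | T_var "'v set"

abbreviation cut_source_ring :: "'v ugraph \<Rightarrow> ('v set set, 'k::field) mpolynomial ring" where
  "cut_source_ring G \<equiv> mp_ring (partitions G)"

abbreviation cut_target_ring :: "'v ugraph \<Rightarrow> ('v edge_var, 'k::field) mpolynomial ring" where
  "cut_target_ring G \<equiv> mp_ring (S_var ` edges G \<union> T_var ` edges G)"

definition cut_map ::
  "'v ugraph \<Rightarrow> ('v set set, 'k::field) mpolynomial \<Rightarrow> ('v edge_var, 'k) mpolynomial" where
  "cut_map G = mp_subst (\<lambda>P. (\<Prod>e\<in>Cut G P. mp_var (S_var e)) *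
                              (\<Prod>e\<in>edges G - Cut G P. mp_var (T_var e)))"

text \<open>The cut algebra of \<open>G\<close> is \<open>cut_source_ring G Quot cut_ideal G\<close>.\<close>
definition cut_ideal :: "'v ugraph \<Rightarrow> ('v set set, 'k::field) mpolynomial set" where
  "cut_ideal G = a_kernel (cut_source_ring G) (cut_target_ring G) (cut_map G)"

end

theory Submission
  imports Defs "HOL-Library.Multiset"
begin

text \<open>
  For the listed graphs the cut ideal is generated by binomials \<open>u\<^sub>i - v\<^sub>i\<close> in which the variables of
  \<open>u\<^sub>i\<close> occur neither in \<open>v\<^sub>i\<close> nor in later binomials; rewriting each \<open>u\<^sub>i\<close> to \<open>v\<^sub>i\<close> is a normal form
  modulo the ideal that is linear over the remaining variables, which makes the sequence regular.

  Conversely, let \<open>I\<^sub>G\<close> be generated by a regular sequence of length \<open>r\<close>. Monomials in the sequence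
  multiplied by monomials that stay independent modulo \<open>I\<^sub>G\<close> are linearly independent, so counting
  gives \<open>r + |E| + 1 \<le> N\<close> for the number \<open>N\<close> of variables. On the other hand \<open>r\<close> is at least the
  number of minimal generators. Write \<open>c\<close> for the number of cuts. Every cut that is a disjoint union
  of two nonempty cuts contributes at least \<open>c/4\<close> quadratic generators, and every partition of the
  vertices into four connected, pairwise adjacent classes contributes \<open>c/8\<close> quartic ones. If \<open>x\<close> and
  \<open>y\<close> count such cuts and partitions, then \<open>2 x + y \<ge> 8\<close> is impossible. A connected graph with at
  least five vertices contracts to one with exactly five, where \<open>2 x + y \<ge> 8\<close> always holds;
  disconnected graphs and graphs with four vertices have enough decomposable cuts unless listed.
\<close>

text \<open>Why \<open>2 x + y >= 8\<close> is impossible: partitions with equal cuts give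
  \<open>N - c\<close> linear generators, so \<open>r\<close> is at least
  \<open>N - c + (2 x + y) c / 8\<close>. It is at most \<open>N - |E| - 1\<close>, and
  \<open>N\<close> cancels. The fractions come from the cut space, a group under symmetric
  difference. A decomposable cut and the empty cut form a subgroup of order two; the three balanced
  cuts of a partition into four classes and the empty cut form a Klein four-group. Each coset is a
  monomial of which no proper factor can be exchanged for another with the same image. Switching by
  a cut permutes the cosets, so there are \<open>c/2\<close> or \<open>c/4\<close> such monomials.
  Each has a partner with the same image, hence at least half of them give generators that are
  independent modulo the irrelevant ideal times the cut ideal. A coset determines its subgroup, so
  the contributions add up. For the dimension a lower bound is enough, obtained by comparing growth
  rates of boxes of exponents. Five classes suffice, but only just: the complete graph on five
  vertices minus an edge reaches exactly \<open>8\<close>, while \<open>K_4\<close> has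
  \<open>x = 0\<close> and \<open>y = 1\<close>.\<close>

abbreviation "keys \<equiv> Poly_Mapping.keys"
abbreviation "lookup \<equiv> Poly_Mapping.lookup"
abbreviation "single \<equiv> Poly_Mapping.single"

subsection \<open>Linear maps given on monomials\<close>

text \<open>\<open>lin\<close> covers both the cut map and the passage to normal forms, since both
  send monomials to monomials; \<open>pair\<close> provides the functionals by which minimal
  generators are told apart.\<close>

definition pair :: "('m \<Rightarrow> 'k) \<Rightarrow> ('m \<Rightarrow>\<^sub>0 'k::comm_ring_1) \<Rightarrow> 'k" where
  "pair w p = (\<Sum>m\<in>keys p. lookup p m * w m)"

definition lin :: "('m \<Rightarrow> 'n) \<Rightarrow> ('m \<Rightarrow>\<^sub>0 'k::comm_ring_1) \<Rightarrow> ('n \<Rightarrow>\<^sub>0 'k)" where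
  "lin f p = (\<Sum>m\<in>keys p. single (f m) (lookup p m))"

lemma pair_superset:
  assumes "finite M" "keys p \<subseteq> M"
  shows "pair w p = (\<Sum>m\<in>M. lookup p m * w m)"
  unfolding pair_def using assms by (intro sum.mono_neutral_left) (auto simp: in_keys_iff)

lemma lin_superset:
  assumes "finite M" "keys p \<subseteq> M"
  shows "lin f p = (\<Sum>m\<in>M. single (f m) (lookup p m))"
  unfolding lin_def using assms by (intro sum.mono_neutral_left) (auto simp: in_keys_iff)

lemma pair_zero [simp]: "pair w 0 = 0"
  by (simp add: pair_def)

lemma lin_zero [simp]: "lin f 0 = 0"
  by (simp add: lin_def)

lemma pair_add: "pair w (p + q) = pair w p + pair w q"
  using Poly_Mapping.keys_add[of p q]
  by (simp add: pair_superset[of "keys p \<union> keys q"] lookup_add algebra_simps sum.distrib)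

lemma lin_add: "lin f (p + q) = lin f p + lin f q"
  using Poly_Mapping.keys_add[of p q]
  by (simp add: lin_superset[of "keys p \<union> keys q"] lookup_add single_add sum.distrib)

lemma pair_single [simp]: "pair w (single m c) = c * w m"
  by (simp add: pair_superset[of "{m}"])

lemma lin_single [simp]: "lin f (single m c) = single (f m) c"
  by (simp add: lin_superset[of "{m}"])

lemma keys_uminus' [simp]: "keys (- p) = keys (p :: 'm \<Rightarrow>\<^sub>0 'k::ab_group_add)"
  by (auto simp: in_keys_iff)

declare mp_ring_simps(1) [simp del]

lemma pair_uminus: "pair w (- p) = - pair w p"
  by (simp add: pair_def sum_negf)

lemma lin_uminus: "lin f (- p) = - lin f p"
  by (simp add: lin_def sum_negf single_uminus)

lemma pair_diff: "pair w (p - q) = pair w p - pair w q"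
  using pair_add[of w p "- q"] by (simp add: pair_uminus)

lemma lin_diff: "lin f (p - q) = lin f p - lin f q"
  using lin_add[of f p "- q"] by (simp add: lin_uminus)

lemma pair_sum: "pair w (sum p A) = (\<Sum>a\<in>A. pair w (p a))"
  by (induction A rule: infinite_finite_induct) (simp_all add: pair_add)

lemma lin_sum: "lin f (sum p A) = (\<Sum>a\<in>A. lin f (p a))"
  by (induction A rule: infinite_finite_induct) (simp_all add: lin_add)

lemma poly_mapping_expand: "p = (\<Sum>m\<in>keys p. single m (lookup p m))"
proof (rule poly_mapping_eqI)
  fix k
  have "(\<Sum>m\<in>keys p. lookup (single m (lookup p m)) k) = (\<Sum>m\<in>keys p. if m = k then lookup p k else 0)"
    by (rule sum.cong) (auto simp: lookup_single when_def)
  also have "\<dots> = lookup p k"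
    by (simp add: in_keys_iff)
  finally show "lookup p k = lookup (\<Sum>m\<in>keys p. single m (lookup p m)) k"
    by (simp add: lookup_sum)
qed

lemma lin_id [simp]: "lin (\<lambda>m. m) p = p"
  unfolding lin_def using poly_mapping_expand[of p] by simp

lemma lin_lin: "lin f (lin g p) = lin (\<lambda>m. f (g m)) p"
  by (simp add: lin_def[of g] lin_sum) (simp add: lin_def)

lemma pair_lin: "pair w (lin g p) = pair (\<lambda>m. w (g m)) p"
  by (simp add: lin_def[of g] pair_sum) (simp add: pair_def)

lemma pair_cong: "(\<And>m. m \<in> keys p \<Longrightarrow> w m = w' m) \<Longrightarrow> pair w p = pair w' p"
  by (simp add: pair_def)

lemma single_times_expand:
  "single m c * p = (\<Sum>u\<in>keys p. single (m + u) (c * lookup p u))"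
proof -
  have "single m c * p = single m c * (\<Sum>u\<in>keys p. single u (lookup p u))"
    using poly_mapping_expand[of p] by simp
  then show ?thesis by (simp add: sum_distrib_left mult_single)
qed

lemma pair_single_times: "pair w (single m c * p) = c * pair (\<lambda>u. w (m + u)) p"
  by (simp add: single_times_expand pair_sum) (simp add: pair_def sum_distrib_left ac_simps)

text \<open>Three functions, because normal forms are additive only in part: there \<open>g\<close>
  is the identity and \<open>h = f\<close>.\<close>

lemma lin_single_times:
  assumes "\<And>u. u \<in> keys p \<Longrightarrow> f (m + u) = g m + h u"
  shows "lin f (single m c * p) = single (g m) c * lin h p"
proof -
  have "lin f (single m c * p) = (\<Sum>u\<in>keys p. single (f (m + u)) (c * lookup p u))"
    by (simp add: single_times_expand lin_sum)
  also have "\<dots> = (\<Sum>u\<in>keys p. single (g m) c * single (h u) (lookup p u))"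
    using assms by (intro sum.cong) (simp_all add: mult_single)
  finally show ?thesis by (simp add: lin_def[of h] sum_distrib_left)
qed

lemma lin_single_times':
  "lin f (single m c * p) = single 0 c * lin (\<lambda>u. f (m + u)) p"
  by (rule lin_single_times) simp

lemma keys_lin: "keys (lin f p) \<subseteq> f ` keys p"
  unfolding lin_def using keys_sum[of "\<lambda>m. single (f m) (lookup p m)" "keys p"]
  by (auto split: if_splits)

lemma lin_eq_zero_inj:
  assumes "lin f p = 0" "inj_on f (keys p)"
  shows "p = 0"
proof (rule ccontr)
  assume "p \<noteq> 0"
  then obtain k where k: "k \<in> keys p"
    by (metis poly_mapping_eqI in_keys_iff lookup_zero)
  have "lookup (lin f p) (f k) = (\<Sum>m\<in>keys p. if m = k then lookup p k else 0)"
    unfolding lin_def lookup_sum using assms(2) k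
    by (intro sum.cong) (auto simp: lookup_single when_def inj_on_def)
  with k assms(1) show False by (simp add: in_keys_iff)
qed

text \<open>No term order is used. The support of \<open>g\<close> shifted by \<open>u\<close>
  equals the support shifted by \<open>v\<close>. Choose a variable with different exponents in
  \<open>u\<close> and \<open>v\<close> and sum its exponents over both sets: the totals differ by
  \<open>card (keys g)\<close> times the difference of the two exponents, so the support is
  empty.\<close>

lemma shift_eq_imp_zero:
  fixes g :: "('x \<Rightarrow>\<^sub>0 nat) \<Rightarrow>\<^sub>0 'k::comm_ring_1"
  assumes "u \<noteq> v" "(single u 1 - single v 1) * g = 0"
  shows "g = 0"
proof -
  have k: "keys (single w 1 * g) = (\<lambda>m. w + m) ` keys g" for w
  proof -
    have 1: "lookup (single w 1 * g) (w + m) = lookup g m" for m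
    proof -
      have "lookup (single w 1 * g) (w + m) = (\<Sum>u\<in>keys g. if u = m then lookup g m else 0)"
        by (auto simp: single_times_expand lookup_sum lookup_single when_def intro!: sum.cong)
      then show ?thesis by (simp add: in_keys_iff)
    qed
    have "keys (single w 1 * g) \<subseteq> (\<lambda>m. w + m) ` keys g"
      using Poly_Mapping.keys_mult[of "single w 1" g] by (auto split: if_splits)
    with 1 show ?thesis by (auto simp: in_keys_iff)
  qed
  have "single u 1 * g = single v 1 * g"
    using assms(2) by (simp add: left_diff_distrib)
  then have e: "(\<lambda>m. u + m) ` keys g = (\<lambda>m. v + m) ` keys g"
    using k by metis
  obtain x where x: "lookup u x \<noteq> lookup v x"
    using assms(1) poly_mapping_eqI by metis
  have s: "(\<Sum>n\<in>(\<lambda>m. w + m) ` keys g. lookup n x) = card (keys g) * lookup w x + (\<Sum>m\<in>keys g. lookup m x)"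
    for w by (subst sum.reindex) (auto simp: inj_on_def lookup_add sum.distrib)
  have "card (keys g) * lookup u x = card (keys g) * lookup v x"
    using s[of u] s[of v] unfolding e by linarith
  then have "keys g = {}" using x by simp
  then show "g = 0" by (metis poly_mapping_expand sum.empty)
qed


subsection \<open>Ideals of polynomial rings\<close>

lemma mp_ring_ring: "ring (mp_ring X)"
  using mp_ring_cring cring.axioms(1) by blast

lemma mp_ring_a_inv:
  assumes "p \<in> carrier (mp_ring X)" shows "\<ominus>\<^bsub>mp_ring X\<^esub> p = - p"
proof -
  interpret cring "mp_ring X" by (rule mp_ring_cring)
  show ?thesis using assms by (intro minus_equality) (auto simp: mp_ring_simps(1))
qed

lemma mp_ring_closed:
  fixes p q :: "('x, 'k::comm_ring_1) mpolynomial"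
  assumes "p \<in> carrier (mp_ring X)" "q \<in> carrier (mp_ring X)"
  shows "p + q \<in> carrier (mp_ring X)" "p * q \<in> carrier (mp_ring X)"
    "- p \<in> carrier (mp_ring X)" "p - q \<in> carrier (mp_ring X)"
proof -
  interpret cring "mp_ring X" by (rule mp_ring_cring)
  show s: "p + q \<in> carrier (mp_ring X)" "p * q \<in> carrier (mp_ring X)"
    using a_closed[OF assms] m_closed[OF assms] by (simp_all only: mp_ring_simps)
  have m: "- r \<in> carrier (mp_ring X)" if "r \<in> carrier (mp_ring X)" for r :: "('x, 'k) mpolynomial"
    using that by (simp add: mp_ring_simps(1))
  show "- p \<in> carrier (mp_ring X)" by (rule m) fact
  from a_closed[OF assms(1) m[OF assms(2)]] show "p - q \<in> carrier (mp_ring X)"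
    by (simp only: mp_ring_simps) simp
qed

lemma mp_ring_zero_one [simp]: "0 \<in> carrier (mp_ring X)" "1 \<in> carrier (mp_ring X)"
  by (simp_all add: mp_ring_simps(1))

lemma mp_ring_sum_closed:
  assumes "\<And>a. a \<in> A \<Longrightarrow> f a \<in> carrier (mp_ring X)"
  shows "sum f A \<in> carrier (mp_ring X)"
  using assms
proof (induction A rule: infinite_finite_induct)
  case (insert x F)
  then show ?case using mp_ring_closed(1)[of "f x" X "sum f F"] by (simp del: mp_ring_simps)
qed auto

lemma mp_ring_single: "keys m \<subseteq> X \<Longrightarrow> single m c \<in> carrier (mp_ring X)"
  by (simp add: mp_ring_simps(1))

lemma mp_idealI:
  assumes "J \<subseteq> carrier (mp_ring X)" "0 \<in> J" "\<And>p q. p \<in> J \<Longrightarrow> q \<in> J \<Longrightarrow> p + q \<in> J"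
    and "\<And>p h. p \<in> J \<Longrightarrow> h \<in> carrier (mp_ring X) \<Longrightarrow> h * p \<in> J"
  shows "ideal J (mp_ring X)"
proof (rule idealI)
  show "ring (mp_ring X)" by (rule mp_ring_ring)
  interpret cring "mp_ring X" by (rule mp_ring_cring)
  show "subgroup J (add_monoid (mp_ring X))"
  proof (rule add.subgroupI)
    show "\<ominus>\<^bsub>mp_ring X\<^esub> p \<in> J" if "p \<in> J" for p
    proof -
      have "p \<in> carrier (mp_ring X)" using that assms(1) by blast
      then have "\<ominus>\<^bsub>mp_ring X\<^esub> p = single 0 (-1) * p"
        by (subst mp_ring_a_inv) (simp_all add: single_uminus)
      also have "\<dots> \<in> J" by (rule assms(4)[OF that]) (rule mp_ring_single, simp)
      finally show ?thesis .
    qed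
  next
    show "J \<noteq> {}" using assms(2) by blast
  next
    show "p \<oplus>\<^bsub>mp_ring X\<^esub> q \<in> J" if "p \<in> J" "q \<in> J" for p q
      using assms(3)[OF that] by (simp only: mp_ring_simps)
  qed fact
  show "x \<otimes>\<^bsub>mp_ring X\<^esub> a \<in> J" "a \<otimes>\<^bsub>mp_ring X\<^esub> x \<in> J"
    if "a \<in> J" "x \<in> carrier (mp_ring X)" for a x
    using assms(4)[OF that] by (simp_all only: mp_ring_simps mult.commute)
qed

lemma mp_idealD:
  assumes "ideal J (mp_ring X)"
  shows "J \<subseteq> carrier (mp_ring X)" "0 \<in> J" "\<And>p q. p \<in> J \<Longrightarrow> q \<in> J \<Longrightarrow> p + q \<in> J"
    and "\<And>p q. p \<in> J \<Longrightarrow> q \<in> J \<Longrightarrow> p - q \<in> J"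
    and "\<And>p h. p \<in> J \<Longrightarrow> h \<in> carrier (mp_ring X) \<Longrightarrow> h * p \<in> J"
    and "\<And>A f. (\<And>a. a \<in> A \<Longrightarrow> f a \<in> J) \<Longrightarrow> sum f A \<in> J"
proof -
  interpret ideal J "mp_ring X" by fact
  show s: "J \<subseteq> carrier (mp_ring X)" and z: "0 \<in> J"
    using a_subset additive_subgroup.zero_closed[OF additive_subgroup_axioms] by (simp_all only: mp_ring_simps)
  show a: "p + q \<in> J" if "p \<in> J" "q \<in> J" for p q
    using additive_subgroup.a_closed[OF additive_subgroup_axioms that] by (simp only: mp_ring_simps)
  show i: "h * p \<in> J" if "p \<in> J" "h \<in> carrier (mp_ring X)" for p h
    using I_l_closed[OF that] by (simp only: mp_ring_simps)
  show "p - q \<in> J" if "p \<in> J" "q \<in> J" for p q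
  proof -
    have "single 0 (-1) * q \<in> J" by (rule i[OF that(2)]) (rule mp_ring_single, simp)
    then have "- q \<in> J" by (simp add: single_uminus)
    from a[OF that(1) this] show ?thesis by simp
  qed
  show "sum f A \<in> J" if "\<And>a. a \<in> A \<Longrightarrow> f a \<in> J" for A f
    using that by (induction A rule: infinite_finite_induct) (use a z in auto)
qed

lemma mp_genideal:
  assumes "F \<subseteq> carrier (mp_ring X)"
  shows "ideal (Idl\<^bsub>mp_ring X\<^esub> F) (mp_ring X)" "F \<subseteq> Idl\<^bsub>mp_ring X\<^esub> F"
    and "\<And>J. ideal J (mp_ring X) \<Longrightarrow> F \<subseteq> J \<Longrightarrow> Idl\<^bsub>mp_ring X\<^esub> F \<subseteq> J"
proof -
  interpret cring "mp_ring X" by (rule mp_ring_cring)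
  show "ideal (Idl\<^bsub>mp_ring X\<^esub> F) (mp_ring X)" "F \<subseteq> Idl\<^bsub>mp_ring X\<^esub> F"
    "\<And>J. ideal J (mp_ring X) \<Longrightarrow> F \<subseteq> J \<Longrightarrow> Idl\<^bsub>mp_ring X\<^esub> F \<subseteq> J"
    by (fact genideal_ideal[OF assms], fact genideal_self[OF assms], fact genideal_minimal)
qed

lemma mp_genideal_empty: "Idl\<^bsub>mp_ring X\<^esub> {} = {0}"
proof
  have "ideal {0} (mp_ring X)" by (rule mp_idealI) auto
  then show "Idl\<^bsub>mp_ring X\<^esub> {} \<subseteq> {0}" by (intro mp_genideal(3)) auto
  show "{0} \<subseteq> Idl\<^bsub>mp_ring X\<^esub> {}"
    using mp_idealD(2)[OF mp_genideal(1)[of "{}"]] by blast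
qed

text \<open>Inductions along a list of generators rest on this form, in which the new generator
  enters through a single multiple.\<close>

lemma mp_genideal_insert:
  fixes f :: "('x, 'k::comm_ring_1) mpolynomial"
  assumes "F \<subseteq> carrier (mp_ring X)" "f \<in> carrier (mp_ring X)"
  shows "Idl\<^bsub>mp_ring X\<^esub> (insert f F) = {p + f * h | p h. p \<in> Idl\<^bsub>mp_ring X\<^esub> F \<and> h \<in> carrier (mp_ring X)}"
    (is "?L = ?R")
proof
  note I = mp_idealD[OF mp_genideal(1)[OF assms(1)]]
  have sub: "insert f F \<subseteq> carrier (mp_ring X)" using assms by blast
  note L = mp_idealD[OF mp_genideal(1)[OF sub]]
  have L7: "f \<in> ?L" "F \<subseteq> ?L" using mp_genideal(2)[OF sub] by blast+
  have z: "(0 :: ('x, 'k) mpolynomial) \<in> carrier (mp_ring X)" "(1 :: ('x, 'k) mpolynomial) \<in> carrier (mp_ring X)"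
    by auto
  have "ideal ?R (mp_ring X)"
  proof (rule mp_idealI)
    show "?R \<subseteq> carrier (mp_ring X)"
      using I(1) assms(2) by (auto simp del: mp_ring_simps intro!: mp_ring_closed(1,2))
    have "0 + f * 0 \<in> ?R" using I(2) z(1) by blast
    then show "0 \<in> ?R" by simp
  next
    fix p q assume "p \<in> ?R" "q \<in> ?R"
    then obtain a b h k where *: "p = a + f * h" "q = b + f * k" "a \<in> Idl\<^bsub>mp_ring X\<^esub> F"
      "b \<in> Idl\<^bsub>mp_ring X\<^esub> F" "h \<in> carrier (mp_ring X)" "k \<in> carrier (mp_ring X)" by blast
    then have "p + q = (a + b) + f * (h + k)" by (simp add: algebra_simps)
    then show "p + q \<in> ?R" using I(3) * mp_ring_closed(1) by blast
  next
    fix p q :: "('x, 'k) mpolynomial" assume p: "p \<in> ?R" and q: "q \<in> carrier (mp_ring X)"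
    from p obtain a h where *: "p = a + f * h" "a \<in> Idl\<^bsub>mp_ring X\<^esub> F"
      "h \<in> carrier (mp_ring X)" by blast
    then have "q * p = q * a + f * (q * h)" by (simp add: algebra_simps)
    then show "q * p \<in> ?R" using I(5) * mp_ring_closed(2) q by blast
  qed
  moreover have "insert f F \<subseteq> ?R"
  proof
    fix g assume g: "g \<in> insert f F"
    show "g \<in> ?R"
    proof (cases "g = f")
      case True
      then have "g = 0 + f * 1" by simp
      then show ?thesis using I(2) z(2) by blast
    next
      case False
      with g have "g \<in> Idl\<^bsub>mp_ring X\<^esub> F" using mp_genideal(2)[OF assms(1)] by blast
      moreover have "g = g + f * 0" by simp
      ultimately show ?thesis using z(1) by blast
    qed
  qed
  ultimately show "?L \<subseteq> ?R" by (intro mp_genideal(3)[OF sub])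
  have "Idl\<^bsub>mp_ring X\<^esub> F \<subseteq> ?L"
    by (rule mp_genideal(3)[OF assms(1) mp_genideal(1)[OF sub] L7(2)])
  moreover have "f * h \<in> ?L" if "h \<in> carrier (mp_ring X)" for h
  proof -
    have "h * f \<in> ?L" by (rule L(5)[OF L7(1) that])
    then show ?thesis by (simp add: mult.commute)
  qed
  ultimately show "?R \<subseteq> ?L" using L(3) by blast
qed

subsection \<open>Regular sequences of binomials\<close>

definition mon_dvd :: "('x \<Rightarrow>\<^sub>0 nat) \<Rightarrow> ('x \<Rightarrow>\<^sub>0 nat) \<Rightarrow> bool" where
  "mon_dvd u m \<longleftrightarrow> (\<forall>x. lookup u x \<le> lookup m x)"

lemma mon_dvdE:
  assumes "mon_dvd u m" obtains c where "m = u + c"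
proof
  show "m = u + (m - u)"
    using assms by (intro poly_mapping_eqI) (simp add: lookup_add lookup_minus mon_dvd_def)
qed

text \<open>The guard \<open>keys u \<inter> keys v = {}\<close> makes the rewriting of \<open>u\<close> to \<open>v\<close> terminate.\<close>
function nf :: "('x \<Rightarrow>\<^sub>0 nat) \<Rightarrow> ('x \<Rightarrow>\<^sub>0 nat) \<Rightarrow> ('x \<Rightarrow>\<^sub>0 nat) \<Rightarrow> ('x \<Rightarrow>\<^sub>0 nat)" where
  "nf u v m = (if u \<noteq> 0 \<and> keys u \<inter> keys v = {} \<and> mon_dvd u m then nf u v ((m - u) + v) else m)"
  by auto
termination
proof (relation "measure (\<lambda>(u, v, m). \<Sum>x\<in>keys u. lookup m x)")
  fix u v m :: "'x \<Rightarrow>\<^sub>0 nat"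
  assume a: "u \<noteq> 0 \<and> keys u \<inter> keys v = {} \<and> mon_dvd u m"
  then obtain c where c: "m = u + c" by (blast elim: mon_dvdE)
  obtain y where y: "y \<in> keys u" using a by (metis poly_mapping_eqI in_keys_iff lookup_zero)
  have z: "lookup v x = 0" if "x \<in> keys u" for x using that a by (auto simp: in_keys_iff)
  have "(\<Sum>x\<in>keys u. lookup (m - u + v) x) < (\<Sum>x\<in>keys u. lookup m x)"
  proof (rule sum_strict_mono_ex1)
    show "\<exists>x\<in>keys u. lookup (m - u + v) x < lookup m x"
      using y z by (intro bexI[of _ y]) (auto simp: c lookup_add in_keys_iff)
  qed (auto simp: c lookup_add z)
  then show "((u, v, m - u + v), (u, v, m)) \<in> measure (\<lambda>(u, v, m). \<Sum>x\<in>keys u. lookup m x)"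
    by simp
qed auto

declare nf.simps [simp del]

context
  fixes u v :: "'x \<Rightarrow>\<^sub>0 nat"
  assumes u: "u \<noteq> 0" and uv: "keys u \<inter> keys v = {}"
begin

lemma nf_dvd: "nf u v (u + c) = nf u v (c + v)"
  using u uv by (subst nf.simps) (auto simp: mon_dvd_def lookup_add)

lemma nf_not_dvd: "\<not> mon_dvd u m \<Longrightarrow> nf u v m = m"
  by (subst nf.simps) simp

lemma nf_induct [case_names dvd not_dvd]:
  assumes dvd: "\<And>c. P (c + v) \<Longrightarrow> P (u + c)" and not_dvd: "\<And>m. \<not> mon_dvd u m \<Longrightarrow> P m"
  shows "P m"
proof -
  have "u' = u \<Longrightarrow> v' = v \<Longrightarrow> P m" for u' v'
  proof (induction u' v' m rule: nf.induct)
    case (1 u' v' m)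
    show ?case
    proof (cases "mon_dvd u m")
      case True
      then obtain c where "m = u + c" by (blast elim: mon_dvdE)
      with 1 True u uv dvd[of c] show ?thesis by simp
    qed (rule not_dvd)
  qed
  then show ?thesis by blast
qed

lemma mon_dvd_disjoint_add:
  assumes "keys a \<inter> keys b = {}" shows "mon_dvd a (b + c) \<longleftrightarrow> mon_dvd a c"
proof -
  have "lookup a x = 0 \<or> lookup b x = 0" for x using assms by (auto simp: in_keys_iff)
  then show ?thesis unfolding mon_dvd_def lookup_add by (metis add_0 le0)
qed

lemma nf_normal: "\<not> mon_dvd u (nf u v m)"
  by (induction m rule: nf_induct) (simp_all add: nf_dvd nf_not_dvd)

text \<open>A factor free of the variables of \<open>u\<close> never affects divisibility by
  \<open>u\<close>, so rewriting passes it by.\<close>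

lemma nf_add:
  assumes "keys w \<inter> keys u = {}" shows "nf u v (w + m) = w + nf u v m"
proof (induction m rule: nf_induct)
  case (dvd c)
  have "nf u v (w + (u + c)) = nf u v (u + (w + c))" by (simp add: ac_simps)
  also have "\<dots> = nf u v (w + (c + v))" unfolding nf_dvd by (simp add: ac_simps)
  finally show ?case using dvd by (simp add: nf_dvd)
next
  case (not_dvd m)
  then show ?case using mon_dvd_disjoint_add[of u w m] assms by (simp add: nf_not_dvd Int_commute)
qed

text \<open>Rewriting introduces only variables of \<open>v\<close>, and none of them occurs in
  \<open>a\<close>, so divisibility by \<open>a\<close> cannot be created. Earlier left-hand sides
  therefore stay absent when a later binomial is reduced.\<close>

lemma nf_not_mon_dvd:
  assumes "keys a \<inter> keys v = {}" "\<not> mon_dvd a m" shows "\<not> mon_dvd a (nf u v m)"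
  using assms(2)
proof (induction m rule: nf_induct)
  case (dvd c)
  have "\<not> mon_dvd a c" using dvd(2) by (auto simp: mon_dvd_def lookup_add intro: trans_le_add2)
  then have "\<not> mon_dvd a (c + v)" using mon_dvd_disjoint_add[OF assms(1)] by (simp add: add.commute)
  with dvd(1) show ?case by (simp add: nf_dvd)
qed (simp add: nf_not_dvd)

lemma nf_keys:
  assumes "keys v \<subseteq> X" "keys m \<subseteq> X" shows "keys (nf u v m) \<subseteq> X"
  using assms(2)
proof (induction m rule: nf_induct)
  case (dvd c)
  have "keys c \<subseteq> X" using dvd(2) by (auto simp: in_keys_iff lookup_add subset_iff)
  then have "keys (c + v) \<subseteq> X" using assms(1) Poly_Mapping.keys_add[of c v] by blast
  with dvd(1) show ?case by (simp add: nf_dvd)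
qed (simp add: nf_not_dvd)

lemma nf_weight:
  assumes "\<And>a b. f (a + b) = f a + f b" "f u = f v" shows "f (nf u v m) = f m"
proof (induction m rule: nf_induct)
  case (dvd c)
  then have "f (nf u v (u + c)) = f (c + v)" by (simp only: nf_dvd)
  then show ?case by (simp add: assms add.commute)
qed (simp add: nf_not_dvd)

lemma nf_zero: "nf u v 0 = 0"
proof -
  obtain y where "y \<in> keys u" using u by (metis poly_mapping_eqI in_keys_iff lookup_zero)
  then show ?thesis by (intro nf_not_dvd) (auto simp: mon_dvd_def in_keys_iff)
qed

text \<open>Each rewriting step changes the monomial by a monomial multiple of the binomial;
  \<open>h\<close> adds up the factors.\<close>

lemma nf_congruent:
  assumes "keys u \<subseteq> X" "keys v \<subseteq> X" "keys m \<subseteq> X"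
  shows "\<exists>h\<in>carrier (mp_ring X). single m (1 :: 'k::comm_ring_1) - single (nf u v m) 1 = (single u 1 - single v 1) * h"
  using assms(3)
proof (induction m rule: nf_induct)
  case (dvd c)
  have c: "keys c \<subseteq> X" using dvd(2) by (auto simp: in_keys_iff lookup_add subset_iff)
  then have "keys (c + v) \<subseteq> X" using assms(2) Poly_Mapping.keys_add[of c v] by blast
  from dvd(1)[OF this] obtain h where h: "h \<in> carrier (mp_ring X)"
    "single (c + v) (1 :: 'k) - single (nf u v (c + v)) 1 = (single u 1 - single v 1) * h" by blast
  have "single (u + c) (1 :: 'k) - single (nf u v (u + c)) 1
      = (single u 1 - single v 1) * single c 1 + (single (c + v) 1 - single (nf u v (c + v)) 1)"
    by (simp add: nf_dvd mult_single left_diff_distrib) (simp add: add.commute)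
  also have "\<dots> = (single u 1 - single v 1) * (single c 1 + h)"
    by (simp add: h(2) algebra_simps)
  finally show ?case using mp_ring_closed(1)[OF mp_ring_single[OF c] h(1)] by blast
qed (auto simp: nf_not_dvd intro!: bexI[of _ 0])

end

text \<open>\<open>U\<close> collects the variables of the left-hand sides reduced so far. The last
  two conditions make \<open>lin F\<close> a projection of the ring with kernel \<open>J\<close>.
  Additivity over monomials free of \<open>U\<close> says that it is linear over the remaining
  variables, in which the next binomial is written.\<close>

definition normal_form ::
  "'x set \<Rightarrow> ('x, 'k::comm_ring_1) mpolynomial set \<Rightarrow> 'x set \<Rightarrow> (('x \<Rightarrow>\<^sub>0 nat) \<Rightarrow> ('x \<Rightarrow>\<^sub>0 nat)) \<Rightarrow> bool" where
  "normal_form X J U F \<longleftrightarrow>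
     (\<forall>m. keys m \<subseteq> X \<longrightarrow> keys (F m) \<subseteq> X) \<and> F 0 = 0 \<and>
     (\<forall>w m. keys w \<inter> U = {} \<longrightarrow> F (w + m) = w + F m) \<and>
     (\<forall>p\<in>J. lin F p = 0) \<and> (\<forall>p\<in>carrier (mp_ring X). p - lin F p \<in> J)"

lemma normal_formD:
  assumes "normal_form X J U F"
  shows "keys m \<subseteq> X \<Longrightarrow> keys (F m) \<subseteq> X" "F 0 = 0"
    and "keys w \<inter> U = {} \<Longrightarrow> F (w + m) = w + F m"
    and "p \<in> J \<Longrightarrow> lin F p = 0" "p \<in> carrier (mp_ring X) \<Longrightarrow> p - lin F p \<in> J"
  using assms unfolding normal_form_def by blast+

lemma normal_form_carrier:
  assumes "normal_form X J U F" "p \<in> carrier (mp_ring X)"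
  shows "lin F p \<in> carrier (mp_ring X)"
  using assms keys_lin[of F p] unfolding normal_form_def mp_ring_simps(1) by blast

lemma normal_form_mem:
  assumes "normal_form X J U F" "p \<in> carrier (mp_ring X)"
  shows "p \<in> J \<longleftrightarrow> lin F p = 0"
  using normal_formD(4,5)[OF assms(1), of p] assms(2) by auto

lemma normal_form_binomial_times:
  assumes "normal_form X J U F" "keys u \<inter> U = {}" "keys v \<inter> U = {}"
  shows "lin F ((single u 1 - single v 1) * g) = (single u 1 - single v 1) * lin F g"
  using normal_formD(3)[OF assms(1)] assms(2,3)
  by (simp add: left_diff_distrib lin_diff lin_single_times[where g = "\<lambda>m. m" and h = F])

lemma binomial_carrier:
  assumes "keys u \<subseteq> X" "keys v \<subseteq> X"
  shows "single u 1 - single v 1 \<in> carrier (mp_ring X)"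
  by (intro mp_ring_closed(4) mp_ring_single assms)

text \<open>Multiplication by the next binomial commutes with taking normal forms, and in the
  polynomial ring the binomial is not a zero divisor.\<close>

lemma normal_form_regular:
  assumes nf: "normal_form X J U F" and "keys u \<inter> U = {}" "keys v \<inter> U = {}"
    and k: "keys u \<subseteq> X" "keys v \<subseteq> X" and "u \<noteq> v"
    and g: "g \<in> carrier (mp_ring X)" "(single u 1 - single v 1) * g \<in> J"
  shows "g \<in> J"
proof -
  have "(single u 1 - single v 1) * lin F g = 0"
    using normal_formD(4)[OF nf g(2)] normal_form_binomial_times[OF nf assms(2,3)] by metis
  then have "lin F g = 0" using \<open>u \<noteq> v\<close> by (rule shift_eq_imp_zero[rotated])
  then show ?thesis using normal_form_mem[OF nf g(1)] by simp
qed

text \<open>\<open>F\<close> kills the old ideal and carries multiples of the binomial to multiples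
  of it, which the subsequent rewriting kills. Conversely, \<open>p\<close> differs from its new
  normal form by an element of the old ideal plus a multiple of the binomial.\<close>

lemma normal_form_step:
  fixes Fs :: "('x, 'k::comm_ring_1) mpolynomial set"
  assumes nf: "normal_form X (Idl\<^bsub>mp_ring X\<^esub> Fs) U F" and Fs: "Fs \<subseteq> carrier (mp_ring X)"
    and U: "keys u \<inter> U = {}" "keys v \<inter> U = {}"
    and k: "keys u \<subseteq> X" "keys v \<subseteq> X" and u: "u \<noteq> 0" "keys u \<inter> keys v = {}"
  shows "normal_form X (Idl\<^bsub>mp_ring X\<^esub> (insert (single u 1 - single v 1) Fs)) (U \<union> keys u)
    (\<lambda>m. nf u v (F m))"
proof -
  let ?b = "single u 1 - single v 1 :: ('x, 'k) mpolynomial"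
  note ins = mp_genideal_insert[OF Fs binomial_carrier[OF k]]
  have sub: "insert ?b Fs \<subseteq> carrier (mp_ring X)" using Fs binomial_carrier[OF k] by blast
  note J = mp_idealD[OF mp_genideal(1)[OF Fs]]
  note J' = mp_idealD[OF mp_genideal(1)[OF sub]]
  have b_mem: "?b * h \<in> Idl\<^bsub>mp_ring X\<^esub> (insert ?b Fs)" if "h \<in> carrier (mp_ring X)" for h
  proof -
    have "0 + ?b * h \<in> Idl\<^bsub>mp_ring X\<^esub> (insert ?b Fs)" unfolding ins using J(2) that by blast
    then show ?thesis by simp
  qed
  have J_sub: "p \<in> Idl\<^bsub>mp_ring X\<^esub> (insert ?b Fs)" if "p \<in> Idl\<^bsub>mp_ring X\<^esub> Fs" for p
  proof -
    have "p + ?b * 0 \<in> Idl\<^bsub>mp_ring X\<^esub> (insert ?b Fs)" unfolding ins using that mp_ring_zero_one(1)[of X] by blast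
    then show ?thesis by simp
  qed
  have 4: "lin (\<lambda>m. nf u v (F m)) p = 0" if p: "p \<in> Idl\<^bsub>mp_ring X\<^esub> (insert ?b Fs)" for p
  proof -
    obtain q h where q: "p = q + ?b * h" "q \<in> Idl\<^bsub>mp_ring X\<^esub> Fs" using p unfolding ins by blast
    have "lin (nf u v) (?b * g) = 0" for g :: "('x, 'k) mpolynomial"
    proof -
      have "lin (nf u v) (single u 1 * g) = lin (nf u v) (single v 1 * g)"
        by (simp add: lin_single_times' nf_dvd[OF u]) (simp add: add.commute)
      then show ?thesis by (simp add: left_diff_distrib lin_diff)
    qed
    then show ?thesis
      using normal_formD(4)[OF nf q(2)] normal_form_binomial_times[OF nf U, of h]
      by (simp add: q(1) lin_lin[symmetric] lin_add)
  qed
  have 5: "p - lin (\<lambda>m. nf u v (F m)) p \<in> Idl\<^bsub>mp_ring X\<^esub> (insert ?b Fs)"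
    if p: "p \<in> carrier (mp_ring X)" for p
  proof -
    let ?q = "lin F p"
    have q: "?q \<in> carrier (mp_ring X)" by (rule normal_form_carrier[OF nf p])
    have "single m c - single (nf u v m) c \<in> Idl\<^bsub>mp_ring X\<^esub> (insert ?b Fs)" if m: "keys m \<subseteq> X" for m c
    proof -
      obtain h where h: "h \<in> carrier (mp_ring X)" "single m (1 :: 'k) - single (nf u v m) 1 = ?b * h"
        using nf_congruent[OF u k m] by blast
      have "single 0 c * (single m 1 - single (nf u v m) 1) \<in> Idl\<^bsub>mp_ring X\<^esub> (insert ?b Fs)"
        unfolding h(2) by (intro J'(5) b_mem h(1) mp_ring_single) simp
      then show ?thesis by (simp add: right_diff_distrib mult_single)
    qed
    then have "(\<Sum>m\<in>keys ?q. single m (lookup ?q m) - single (nf u v m) (lookup ?q m))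
        \<in> Idl\<^bsub>mp_ring X\<^esub> (insert ?b Fs)"
      using q by (intro J'(6)) (simp add: mp_ring_simps(1))
    then have "?q - lin (nf u v) ?q \<in> Idl\<^bsub>mp_ring X\<^esub> (insert ?b Fs)"
      unfolding sum_subtractf lin_def[of "nf u v" ?q, symmetric] poly_mapping_expand[of ?q, symmetric] .
    from J'(3)[OF J_sub[OF normal_formD(5)[OF nf p]] this]
    show ?thesis by (simp add: lin_lin)
  qed
  show ?thesis
    unfolding normal_form_def
  proof (intro conjI allI impI ballI)
    show "keys (nf u v (F m)) \<subseteq> X" if "keys m \<subseteq> X" for m
      by (rule nf_keys[OF u k(2) normal_formD(1)[OF nf that]])
    show "nf u v (F 0) = 0" using normal_formD(2)[OF nf] nf_zero[OF u] by simp
    show "nf u v (F (w + m)) = w + nf u v (F m)" if "keys w \<inter> (U \<union> keys u) = {}" for w m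
    proof -
      have "keys w \<inter> U = {}" "keys w \<inter> keys u = {}" using that by blast+
      then show ?thesis by (simp add: normal_formD(3)[OF nf] nf_add[OF u])
    qed
  qed (fact 4 5)+
qed

section \<open>Triangular systems of binomials\<close>

definition binomials :: "(('x \<Rightarrow>\<^sub>0 nat) \<times> ('x \<Rightarrow>\<^sub>0 nat)) list \<Rightarrow> ('x, 'k::comm_ring_1) mpolynomial list" where
  "binomials bs = map (\<lambda>(u, v). single u 1 - single v 1) bs"

definition triangular :: "'x set \<Rightarrow> (('x \<Rightarrow>\<^sub>0 nat) \<times> ('x \<Rightarrow>\<^sub>0 nat)) list \<Rightarrow> bool" where
  "triangular X bs \<longleftrightarrow>
     (\<forall>(u, v)\<in>set bs. u \<noteq> 0 \<and> keys u \<subseteq> X \<and> keys v \<subseteq> X \<and> keys u \<inter> keys v = {}) \<and>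
     sorted_wrt (\<lambda>(u, v) (u', v'). keys u \<inter> (keys u' \<union> keys v') = {}) bs"

lemma triangular_append:
  "triangular X (bs @ [(u, v)]) \<longleftrightarrow> triangular X bs \<and> u \<noteq> 0 \<and> keys u \<subseteq> X \<and> keys v \<subseteq> X \<and>
     keys u \<inter> keys v = {} \<and> (\<forall>(u', v')\<in>set bs. keys u' \<inter> (keys u \<union> keys v) = {})"
  by (auto simp: triangular_def sorted_wrt_append)

lemma binomials_append: "binomials (bs @ [(u, v)]) = binomials bs @ [single u 1 - single v 1]"
  by (simp add: binomials_def)

lemma triangular_carrier:
  "triangular X bs \<Longrightarrow> set (binomials bs) \<subseteq> carrier (mp_ring X)"
  using binomial_carrier by (fastforce simp: triangular_def binomials_def)

text \<open>The binomials are reduced in the order of the list. Later ones contain no variable of an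
  earlier left-hand side, so reducing them makes none of these reappear. The last clause,
  preservation of additive invariants that agree on \<open>u\<close> and \<open>v\<close>, is meant
  for the cut weight.\<close>

lemma triangular_normal_form:
  fixes bs :: "(('x \<Rightarrow>\<^sub>0 nat) \<times> ('x \<Rightarrow>\<^sub>0 nat)) list" and bin :: "_ \<Rightarrow> ('x, 'k::comm_ring_1) mpolynomial list"
  defines "bin \<equiv> binomials"
  assumes "triangular X bs"
  shows "\<exists>F. normal_form X (Idl\<^bsub>mp_ring X\<^esub> (set (bin bs))) (\<Union>(u, v)\<in>set bs. keys u) F \<and>
    (\<forall>(u, v)\<in>set bs. \<forall>m. \<not> mon_dvd u (F m)) \<and>
    (\<forall>f :: _ \<Rightarrow> 'b::cancel_comm_monoid_add. (\<forall>a b. f (a + b) = f a + f b) \<longrightarrow>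
      (\<forall>(u, v)\<in>set bs. f u = f v) \<longrightarrow> (\<forall>m. f (F m) = f m))"
  using assms(2)
proof (induction bs rule: rev_induct)
  case Nil
  have "normal_form X {0 :: ('x, 'k) mpolynomial} {} (\<lambda>m. m)"
    by (simp add: normal_form_def)
  then show ?case by (auto simp: bin_def binomials_def mp_genideal_empty)
next
  case (snoc b bs)
  obtain u v where b: "b = (u, v)" by force
  note t = snoc.prems[unfolded b triangular_append]
  from snoc.IH[OF conjunct1[OF t]] obtain F where
    F: "normal_form X (Idl\<^bsub>mp_ring X\<^esub> (set (bin bs))) (\<Union>(u, v)\<in>set bs. keys u) F"
    and n: "\<forall>(u, v)\<in>set bs. \<forall>m. \<not> mon_dvd u (F m)"
    and w: "\<forall>f :: _ \<Rightarrow> 'b. (\<forall>a b. f (a + b) = f a + f b) \<longrightarrow>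
      (\<forall>(u, v)\<in>set bs. f u = f v) \<longrightarrow> (\<forall>m. f (F m) = f m)"
    by (elim exE conjE)
  have u: "u \<noteq> 0" "keys u \<inter> keys v = {}" using t by simp_all
  have d: "keys u' \<inter> keys u = {}" "keys u' \<inter> keys v = {}" if "(u', v') \<in> set bs" for u' v'
    using t that by blast+
  have "normal_form X (Idl\<^bsub>mp_ring X\<^esub> (insert (single u 1 - single v 1) (set (bin bs))))
      ((\<Union>(u, v)\<in>set bs. keys u) \<union> keys u) (\<lambda>m. nf u v (F m))"
  proof (rule normal_form_step[OF F])
    show "set (bin bs) \<subseteq> carrier (mp_ring X)"
      unfolding bin_def by (rule triangular_carrier[OF conjunct1[OF t]])
    show "keys u \<inter> (\<Union>(u, v)\<in>set bs. keys u) = {}" "keys v \<inter> (\<Union>(u, v)\<in>set bs. keys u) = {}"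
      using d by fast+
  qed (use t in simp_all)
  then have "normal_form X (Idl\<^bsub>mp_ring X\<^esub> (set (bin (bs @ [b]))))
      (\<Union>(u, v)\<in>set (bs @ [b]). keys u) (\<lambda>m. nf u v (F m))"
    by (simp add: b bin_def binomials_append Un_commute)
  moreover have "\<forall>(u', v')\<in>set (bs @ [b]). \<forall>m. \<not> mon_dvd u' (nf u v (F m))"
  proof -
    have "\<not> mon_dvd u' (nf u v (F m))" if "(u', v') \<in> set bs" for u' v' m
      using that n by (intro nf_not_mon_dvd[OF u] d(2)) fast+
    then show ?thesis using nf_normal[OF u] unfolding b by simp blast
  qed
  moreover have "\<forall>f :: _ \<Rightarrow> 'b. (\<forall>a b. f (a + b) = f a + f b) \<longrightarrow>
      (\<forall>(u, v)\<in>set (bs @ [b]). f u = f v) \<longrightarrow> (\<forall>m. f (nf u v (F m)) = f m)"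
  proof (intro allI impI)
    fix f :: "_ \<Rightarrow> 'b" and m
    assume f: "\<forall>a b. f (a + b) = f a + f b" "\<forall>(u, v)\<in>set (bs @ [b]). f u = f v"
    then have "f u = f v" "f (F m) = f m" using w by (simp_all add: b)
    then show "f (nf u v (F m)) = f m" using nf_weight[OF u, of f] f(1) by simp
  qed
  ultimately show ?case by blast
qed

text \<open>Reduces the description of a toric ideal to a statement on exponents. Normal forms
  preserve \<open>\<mu>\<close>. If \<open>\<mu>\<close> separates the irreducible monomials,
  nothing can cancel in the image of the normal form of an element of \<open>I\<close>, so this
  normal form is zero.\<close>

lemma triangular_complete_intersection:
  fixes I :: "('x, 'k::field) mpolynomial set" and \<mu> :: "('x \<Rightarrow>\<^sub>0 nat) \<Rightarrow> 'b::cancel_comm_monoid_add"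
  assumes t: "triangular X bs"
    and hom: "\<And>u v. (u, v) \<in> set bs \<Longrightarrow> mp_homogeneous (single u (1 :: 'k) - single v 1)"
    and I: "I = {p \<in> carrier (mp_ring X). lin \<mu> p = 0}"
    and add: "\<And>a b. \<mu> (a + b) = \<mu> a + \<mu> b" and eq: "\<And>u v. (u, v) \<in> set bs \<Longrightarrow> \<mu> u = \<mu> v"
    and inj: "\<And>m m'. keys m \<subseteq> X \<Longrightarrow> keys m' \<subseteq> X \<Longrightarrow> (\<And>u v. (u, v) \<in> set bs \<Longrightarrow> \<not> mon_dvd u m) \<Longrightarrow>
      (\<And>u v. (u, v) \<in> set bs \<Longrightarrow> \<not> mon_dvd u m') \<Longrightarrow> \<mu> m = \<mu> m' \<Longrightarrow> m = m'"
  shows "complete_intersection X I"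
proof -
  let ?fs = "binomials bs :: ('x, 'k) mpolynomial list"
  let ?J = "Idl\<^bsub>mp_ring X\<^esub> (set ?fs)"
  note c = triangular_carrier[OF t, where ?'b = 'k]
  obtain F where F: "normal_form X ?J (\<Union>(u, v)\<in>set bs. keys u) F"
    and n: "\<forall>(u, v)\<in>set bs. \<forall>m. \<not> mon_dvd u (F m)" and w: "\<And>m. \<mu> (F m) = \<mu> m"
    using triangular_normal_form[OF t, where ?'b = 'b and ?'k = 'k] add eq by blast
  have lin_F: "lin \<mu> (lin F p) = lin \<mu> p" for p :: "('x, 'k) mpolynomial"
    by (simp add: lin_lin w)
  have "I = ?J"
  proof (intro Set.set_eqI iffI)
    fix p assume "p \<in> I"
    then have p: "p \<in> carrier (mp_ring X)" "lin \<mu> (lin F p) = 0" by (auto simp: I lin_F)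
    have "inj_on \<mu> (keys (lin F p))"
    proof (rule inj_onI)
      fix a b assume ab: "a \<in> keys (lin F p)" "b \<in> keys (lin F p)" "\<mu> a = \<mu> b"
      have "x \<in> range F \<and> keys x \<subseteq> X" if "x \<in> keys (lin F p)" for x
        using that keys_lin[of F p] normal_form_carrier[OF F p(1)] by (auto simp: mp_ring_simps(1))
      with ab n show "a = b" by (intro inj) (blast+)
    qed
    with p(2) have "lin F p = 0" by (rule lin_eq_zero_inj)
    then show "p \<in> ?J" using normal_form_mem[OF F p(1)] by simp
  next
    fix p assume p: "p \<in> ?J"
    then have "lin F p = 0" by (rule normal_formD(4)[OF F])
    then have "lin \<mu> p = 0" using lin_F[of p] by simp
    then show "p \<in> I" using p mp_idealD(1)[OF mp_genideal(1)[OF c]] by (auto simp: I)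
  qed
  moreover have "regular_sequence (mp_ring X) ?fs"
    unfolding regular_sequence_def
  proof (intro conjI allI impI ballI)
    fix i g assume i: "i < length ?fs" and g: "g \<in> carrier (mp_ring X)"
      "(?fs ! i) \<otimes>\<^bsub>mp_ring X\<^esub> g \<in> Idl\<^bsub>mp_ring X\<^esub> (set (take i ?fs))"
    obtain u v where uv: "bs ! i = (u, v)" by force
    have i': "i < length bs" using i by (simp add: binomials_def)
    \<comment> \<open>A prefix of a triangular system is triangular, so the ideal of the earlier
      binomials has a normal form of its own.\<close>
    have "bs = (take i bs @ [(u, v)]) @ drop (Suc i) bs" using id_take_nth_drop[OF i'] uv by simp
    then have "triangular X (take i bs @ [(u, v)])"
      using t by (metis (no_types, lifting) triangular_def sorted_wrt_append UnCI set_append)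
    note t' = this[unfolded triangular_append]
    have tk: "take i ?fs = binomials (take i bs)" by (simp add: binomials_def take_map)
    obtain F' where F': "normal_form X (Idl\<^bsub>mp_ring X\<^esub> (set (take i ?fs))) (\<Union>(u, v)\<in>set (take i bs). keys u) F'"
      using triangular_normal_form[of X "take i bs", where ?'b = 'b and ?'k = 'k] t' unfolding tk by blast
    show "g \<in> Idl\<^bsub>mp_ring X\<^esub> (set (take i ?fs))"
    proof (rule normal_form_regular[OF F' _ _ _ _ _ g(1)])
      show "(single u 1 - single v 1) * g \<in> Idl\<^bsub>mp_ring X\<^esub> (set (take i ?fs))"
        using g(2) i' uv by (simp add: binomials_def)
      show "u \<noteq> v" using t' by (metis Int_absorb poly_mapping_eqI in_keys_iff empty_iff lookup_zero)
    qed (use t' in fastforce)+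
  next
    \<comment> \<open>The constant monomial is its own normal form, so the ideal is proper.\<close>
    have "lin F 1 \<noteq> (0 :: ('x, 'k) mpolynomial)"
      using lin_single[of F 0 "1 :: 'k"] by (simp add: normal_formD(2)[OF F])
    then have "1 \<notin> ?J" using normal_formD(4)[OF F] by blast
    then show "?J \<noteq> carrier (mp_ring X)" using mp_ring_zero_one(2) by metis
  qed fact
  moreover have "\<forall>f\<in>set ?fs. mp_homogeneous f"
    using hom by (auto simp: binomials_def)
  ultimately show ?thesis unfolding complete_intersection_def by blast
qed

subsection \<open>Bounds for the number of generators of a complete intersection\<close>

lemma homogeneous_system_nontrivial:
  fixes M :: "'a \<Rightarrow> 'b \<Rightarrow> 'k::field"
  assumes "finite B" "finite A" "card B < card A"
  shows "\<exists>c. (\<exists>a\<in>A. c a \<noteq> 0) \<and> (\<forall>b\<in>B. (\<Sum>a\<in>A. c a * M a b) = 0)"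
  using assms
proof (induction B arbitrary: A M rule: finite_induct)
  case empty
  then have "A \<noteq> {}" by auto
  then show ?case by (intro exI[of _ "\<lambda>_. 1"]) auto
next
  case (insert b B)
  show ?case
  proof (cases "\<forall>a\<in>A. M a b = 0")
    case True
    have "card B < card A" using insert by simp
    then obtain c where c: "\<exists>a\<in>A. c a \<noteq> 0" "\<forall>b\<in>B. (\<Sum>a\<in>A. c a * M a b) = 0"
      using insert.IH[of A M] insert.prems(1) by blast
    with True show ?thesis by (intro exI[of _ c]) auto
  next
    case False
    then obtain q where q: "q \<in> A" "M q b \<noteq> 0" by blast
    \<comment> \<open>Gaussian elimination: equation \<open>b\<close> is solved for the unknown
      \<open>q\<close> and substituted into the other equations.\<close>
    define M' where "M' a b' = M a b' - M a b / M q b * M q b'" for a b'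
    have "card B < card (A - {q})" using insert q by (simp add: card_Diff_singleton)
    then obtain c where c: "\<exists>a\<in>A - {q}. c a \<noteq> 0" "\<forall>b\<in>B. (\<Sum>a\<in>A - {q}. c a * M' a b) = 0"
      using insert.IH[of "A - {q}" M'] insert.prems(1) by blast
    define s where "s = (\<Sum>a\<in>A - {q}. c a * M a b)"
    define c' where "c' = c(q := - s / M q b)"
    have eq: "(\<Sum>a\<in>A. c' a * M a b') = - s / M q b * M q b' + (\<Sum>a\<in>A - {q}. c a * M a b')" for b'
    proof -
      have "(\<Sum>a\<in>A. c' a * M a b') = c' q * M q b' + (\<Sum>a\<in>A - {q}. c' a * M a b')"
        using q(1) insert.prems(1) by (rule sum.remove[rotated])
      also have "(\<Sum>a\<in>A - {q}. c' a * M a b') = (\<Sum>a\<in>A - {q}. c a * M a b')"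
        by (rule sum.cong) (auto simp: c'_def)
      finally show ?thesis by (simp add: c'_def)
    qed
    have "(\<Sum>a\<in>A. c' a * M a b) = 0" using q(2) by (simp add: eq s_def)
    moreover have "(\<Sum>a\<in>A. c' a * M a b') = 0" if "b' \<in> B" for b'
    proof -
      have "0 = (\<Sum>a\<in>A - {q}. c a * M' a b')" using c(2) that by simp
      also have "\<dots> = (\<Sum>a\<in>A - {q}. c a * M a b') - (\<Sum>a\<in>A - {q}. c a * M a b) / M q b * M q b'"
        by (simp add: M'_def sum_subtractf algebra_simps sum_distrib_left sum_divide_distrib)
      finally show ?thesis by (simp add: eq s_def)
    qed
    moreover have "\<exists>a\<in>A. c' a \<noteq> 0" using c(1) by (auto simp: c'_def)
    ultimately show ?thesis by (intro exI[of _ c']) auto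
  qed
qed

text \<open>Each exponent is bounded separately, rather than the total degree, so that the number of
  monomials is bounded by a pure power; only its growth in \<open>D\<close> matters.\<close>

definition mons :: "'x set \<Rightarrow> nat \<Rightarrow> ('x \<Rightarrow>\<^sub>0 nat) set" where
  "mons X D = {m. keys m \<subseteq> X \<and> (\<forall>x. lookup m x \<le> D)}"

definition bounded_polys :: "'x set \<Rightarrow> nat \<Rightarrow> ('x, 'k::comm_ring_1) mpolynomial set" where
  "bounded_polys X D = {p. keys p \<subseteq> mons X D}"

lemma card_mons:
  assumes "finite X"
  shows "finite (mons X D)" "card (mons X D) \<le> (D + 1) ^ card X"
proof -
  let ?h = "\<lambda>m. restrict (lookup m) X"
  have inj: "inj_on ?h (mons X D)"
  proof (rule inj_onI, rule poly_mapping_eqI)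
    fix m m' :: "'a \<Rightarrow>\<^sub>0 nat" and x
    assume m: "m \<in> mons X D" "m' \<in> mons X D" "?h m = ?h m'"
    show "lookup m x = lookup m' x"
    proof (cases "x \<in> X")
      case True
      then show ?thesis using fun_cong[OF m(3), of x] by simp
    next
      case False
      with m(1,2) have "x \<notin> keys m" "x \<notin> keys m'" by (auto simp: mons_def)
      then show ?thesis by (simp add: in_keys_iff)
    qed
  qed
  have im: "?h ` mons X D \<subseteq> PiE X (\<lambda>_. {..D})" by (auto simp: mons_def)
  have fin: "finite (PiE X (\<lambda>_. {..D}))" using assms by (intro finite_PiE) auto
  show "finite (mons X D)" using finite_imageD[OF finite_subset[OF im fin] inj] .
  have "card (mons X D) \<le> card (PiE X (\<lambda>_. {..D}))"
    using card_inj_on_le[OF inj im fin] .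
  then show "card (mons X D) \<le> (D + 1) ^ card X" using assms by (simp add: card_PiE)
qed

lemma bounded_polys_mult:
  assumes "p \<in> bounded_polys X D" "q \<in> bounded_polys X D'"
  shows "p * q \<in> bounded_polys X (D + D')"
proof -
  have "a + b \<in> mons X (D + D')" if "a \<in> mons X D" "b \<in> mons X D'" for a b
    using that Poly_Mapping.keys_add[of a b] by (auto simp: mons_def lookup_add intro!: add_mono)
  then show ?thesis
    using assms Poly_Mapping.keys_mult[of p q] by (fastforce simp: bounded_polys_def)
qed

lemma bounded_polys_one: "1 \<in> bounded_polys X D"
  by (auto simp: bounded_polys_def mons_def)

lemma bounded_polys_mono: "D \<le> D' \<Longrightarrow> bounded_polys X D \<subseteq> bounded_polys X D'"
proof -
  assume "D \<le> D'"
  then have "mons X D \<subseteq> mons X D'" by (auto simp: mons_def intro: order_trans)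
  then show ?thesis unfolding bounded_polys_def by blast
qed

lemma bounded_polys_power:
  assumes "p \<in> bounded_polys X D" shows "p ^ b \<in> bounded_polys X (b * D)"
proof (induction b)
  case (Suc b)
  then show ?case using bounded_polys_mult[OF assms Suc.IH] by simp
qed (simp add: bounded_polys_one)

lemma bounded_polys_carrier: "bounded_polys X D \<subseteq> carrier (mp_ring X)"
proof
  fix p :: "('a, 'b) mpolynomial" assume p: "p \<in> bounded_polys X D"
  have "keys m \<subseteq> X" if "m \<in> keys p" for m
    using p that unfolding bounded_polys_def mons_def by blast
  then show "p \<in> carrier (mp_ring X)" unfolding mp_ring_simps(1) by blast
qed

lemma ex_bounded_polys:
  assumes "finite F" "F \<subseteq> carrier (mp_ring X)"
  shows "\<exists>D. F \<subseteq> bounded_polys X D"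
  using assms
proof (induction F rule: finite_induct)
  case (insert p F)
  then obtain D where D: "F \<subseteq> bounded_polys X D" by auto
  let ?S = "\<Union>m\<in>keys p. lookup m ` keys m"
  define d where "d = Max (insert 0 ?S)"
  have "lookup m x \<le> d" if "m \<in> keys p" for m x
  proof (cases "x \<in> keys m")
    case True
    then show ?thesis unfolding d_def using that by (intro Max_ge) auto
  qed (simp add: in_keys_iff)
  then have "p \<in> bounded_polys X d"
    using insert.prems by (auto simp: bounded_polys_def mons_def mp_ring_simps(1))
  then have "insert p F \<subseteq> bounded_polys X (max d D)"
    using D bounded_polys_mono[of d "max d D" X] bounded_polys_mono[of D "max d D" X] by auto
  then show ?case ..
qed simp

section \<open>Independent families modulo an ideal and the length of a regular sequence\<close>

definition independent_mod ::
  "'a set \<Rightarrow> ('a \<Rightarrow> ('x, 'k::comm_ring_1) mpolynomial) \<Rightarrow> ('x, 'k) mpolynomial set \<Rightarrow> bool" where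
  "independent_mod A w J \<longleftrightarrow>
     (\<forall>c. (\<Sum>a\<in>A. single 0 (c a) * w a) \<in> J \<longrightarrow> (\<forall>a\<in>A. c a = 0))"

lemma independent_modD:
  "independent_mod A w J \<Longrightarrow> (\<Sum>a\<in>A. single 0 (c a) * w a) \<in> J \<Longrightarrow> a \<in> A \<Longrightarrow> c a = 0"
  unfolding independent_mod_def by blast

text \<open>Expansions in powers of a regular element are unique: the coefficients at
  \<open>f ^ 0\<close> vanish by independence modulo the ideal enlarged by \<open>f\<close>, then
  one factor \<open>f\<close> is cancelled and the argument repeats.\<close>

lemma independent_mod_regular_step:
  fixes f :: "('x, 'k::comm_ring_1) mpolynomial"
  assumes Fs: "Fs \<subseteq> carrier (mp_ring X)" and f: "f \<in> carrier (mp_ring X)"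
    and reg: "\<And>g. g \<in> carrier (mp_ring X) \<Longrightarrow> f * g \<in> Idl\<^bsub>mp_ring X\<^esub> Fs \<Longrightarrow> g \<in> Idl\<^bsub>mp_ring X\<^esub> Fs"
    and A: "finite A" "\<And>a. a \<in> A \<Longrightarrow> w a \<in> carrier (mp_ring X)"
    and ind: "independent_mod A w (Idl\<^bsub>mp_ring X\<^esub> (insert f Fs))"
  shows "independent_mod (A \<times> {..k}) (\<lambda>(a, b). f ^ b * w a) (Idl\<^bsub>mp_ring X\<^esub> Fs)"
proof -
  note J = mp_idealD[OF mp_genideal(1)[OF Fs]]
  have g_carrier: "(\<Sum>a\<in>A. single 0 (c a) * w a) \<in> carrier (mp_ring X)" for c
    by (intro mp_ring_sum_closed mp_ring_closed(2) mp_ring_single A(2)) auto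
  have f_carrier: "f ^ b \<in> carrier (mp_ring X)" for b
    by (induction b) (auto intro!: mp_ring_closed(2) f)
  have main: "\<forall>b\<le>k. \<forall>a\<in>A. c a b = 0"
    if "(\<Sum>b\<le>k. f ^ b * (\<Sum>a\<in>A. single 0 (c a b) * w a)) \<in> Idl\<^bsub>mp_ring X\<^esub> Fs" for c :: "_ \<Rightarrow> nat \<Rightarrow> 'k"
    using that
  proof (induction k arbitrary: c)
    case 0
    have "(\<Sum>a\<in>A. single 0 (c a 0) * w a) \<in> Idl\<^bsub>mp_ring X\<^esub> Fs" using 0 by simp
    then have "(\<Sum>a\<in>A. single 0 (c a 0) * w a) + f * 0 \<in> Idl\<^bsub>mp_ring X\<^esub> (insert f Fs)"
      unfolding mp_genideal_insert[OF Fs f] using mp_ring_zero_one(1)[of X] by blast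
    then show ?case using independent_modD[OF ind, of "\<lambda>a. c a 0"] by simp
  next
    case (Suc k)
    define g where "g b = (\<Sum>a\<in>A. single 0 (c a b) * w a)" for b
    define h where "h = (\<Sum>b\<le>k. f ^ b * g (Suc b))"
    have h: "h \<in> carrier (mp_ring X)"
      unfolding h_def g_def by (intro mp_ring_sum_closed mp_ring_closed(2) f_carrier g_carrier)
    have "(\<Sum>b\<le>Suc k. f ^ b * g b) = g 0 + (\<Sum>b\<le>k. f ^ Suc b * g (Suc b))"
      by (subst sum.atMost_Suc_shift) simp
    also have "\<dots> = g 0 + f * h" by (simp add: h_def sum_distrib_left mult.assoc)
    finally have gh: "g 0 + f * h \<in> Idl\<^bsub>mp_ring X\<^esub> Fs" using Suc.prems by (simp add: g_def)
    have "g 0 = (g 0 + f * h) + f * (- h)" by simp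
    then have "g 0 \<in> Idl\<^bsub>mp_ring X\<^esub> (insert f Fs)"
      unfolding mp_genideal_insert[OF Fs f] using gh mp_ring_closed(3)[OF h h] by blast
    then have c0: "\<forall>a\<in>A. c a 0 = 0"
      unfolding g_def using independent_modD[OF ind, of "\<lambda>a. c a 0"] by simp
    then have "g 0 = 0" by (simp add: g_def)
    with gh have "f * h \<in> Idl\<^bsub>mp_ring X\<^esub> Fs" by simp
    from reg[OF h this] have "\<forall>b\<le>k. \<forall>a\<in>A. c a (Suc b) = 0"
      using Suc.IH[of "\<lambda>a b. c a (Suc b)"] by (simp add: h_def g_def)
    then show ?case using c0 by (metis Suc_le_mono not0_implies_Suc)
  qed
  show ?thesis
    unfolding independent_mod_def
  proof (intro allI impI)
    fix c :: "_ \<Rightarrow> 'k"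
    assume c: "(\<Sum>a\<in>A \<times> {..k}. single 0 (c a) * (case a of (a, b) \<Rightarrow> f ^ b * w a)) \<in> Idl\<^bsub>mp_ring X\<^esub> Fs"
    have "(\<Sum>a\<in>A \<times> {..k}. single 0 (c a) * (case a of (a, b) \<Rightarrow> f ^ b * w a))
        = (\<Sum>a\<in>A. \<Sum>b\<le>k. single 0 (c (a, b)) * (f ^ b * w a))"
      by (subst sum.cartesian_product) (auto intro: sum.cong)
    also have "\<dots> = (\<Sum>b\<le>k. f ^ b * (\<Sum>a\<in>A. single 0 (c (a, b)) * w a))"
      by (subst sum.swap) (simp add: sum_distrib_left ac_simps)
    finally have "\<forall>b\<le>k. \<forall>a\<in>A. c (a, b) = 0" using c main[of "\<lambda>a b. c (a, b)"] by simp
    then show "\<forall>a\<in>A \<times> {..k}. c a = 0" by auto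
  qed
qed

definition has_independent ::
  "'x set \<Rightarrow> ('x, 'k::comm_ring_1) mpolynomial set \<Rightarrow> nat \<Rightarrow> nat \<Rightarrow> bool" where
  "has_independent X J D n \<longleftrightarrow>
     (\<exists>w :: nat \<Rightarrow> _. w ` {..<n} \<subseteq> bounded_polys X D \<and> independent_mod {..<n} w J)"

lemma has_independentI:
  fixes w :: "'a \<Rightarrow> ('x, 'k::comm_ring_1) mpolynomial"
  assumes "finite A" "independent_mod A w J" "w ` A \<subseteq> bounded_polys X D"
  shows "has_independent X J D (card A)"
proof -
  obtain h where h: "bij_betw h {0..<card A} A" using ex_bij_betw_nat_finite[OF assms(1)] by blast
  then have h: "bij_betw h {..<card A} A" by (simp add: lessThan_atLeast0)
  let ?g = "the_inv_into {..<card A} h"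
  have "independent_mod {..<card A} (w \<circ> h) J"
    unfolding independent_mod_def
  proof (intro allI impI)
    fix c :: "nat \<Rightarrow> 'k" assume c: "(\<Sum>a<card A. single 0 (c a) * (w \<circ> h) a) \<in> J"
    have g: "?g (h i) = i" if "i < card A" for i
      using h that by (simp add: bij_betw_def the_inv_into_f_f)
    have "(\<Sum>a\<in>A. single 0 (c (?g a)) * w a) = (\<Sum>i<card A. single 0 (c (?g (h i))) * w (h i))"
      by (rule sum.reindex_bij_betw[OF h, symmetric])
    also have "\<dots> = (\<Sum>i<card A. single 0 (c i) * (w \<circ> h) i)"
      by (rule sum.cong) (auto simp: g)
    finally have sum: "(\<Sum>a\<in>A. single 0 (c (?g a)) * w a) \<in> J" using c by simp
    show "\<forall>i\<in>{..<card A}. c i = 0"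
    proof
      fix i assume i: "i \<in> {..<card A}"
      then have "h i \<in> A" using h by (auto simp: bij_betw_def)
      from independent_modD[OF assms(2) sum this] show "c i = 0" using g i by simp
    qed
  qed
  moreover have "(w \<circ> h) ` {..<card A} \<subseteq> bounded_polys X D"
    using h assms(3) by (auto simp: bij_betw_def)
  ultimately show ?thesis unfolding has_independent_def by (intro exI conjI)
qed

lemma has_independent_regular_step:
  fixes f :: "('x, 'k::comm_ring_1) mpolynomial"
  assumes "Fs \<subseteq> carrier (mp_ring X)" "f \<in> bounded_polys X d"
    and reg: "\<And>g. g \<in> carrier (mp_ring X) \<Longrightarrow> f * g \<in> Idl\<^bsub>mp_ring X\<^esub> Fs \<Longrightarrow> g \<in> Idl\<^bsub>mp_ring X\<^esub> Fs"
    and ind: "has_independent X (Idl\<^bsub>mp_ring X\<^esub> (insert f Fs)) D n"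
  shows "has_independent X (Idl\<^bsub>mp_ring X\<^esub> Fs) (D + k * d) (n * (k + 1))"
proof -
  from ind obtain w :: "nat \<Rightarrow> ('x, 'k) mpolynomial" where w: "w ` {..<n} \<subseteq> bounded_polys X D"
    "independent_mod {..<n} w (Idl\<^bsub>mp_ring X\<^esub> (insert f Fs))"
    unfolding has_independent_def by blast
  have f: "f \<in> carrier (mp_ring X)" using assms(2) bounded_polys_carrier by blast
  have "independent_mod ({..<n} \<times> {..k}) (\<lambda>(a, b). f ^ b * w a) (Idl\<^bsub>mp_ring X\<^esub> Fs)"
    using w bounded_polys_carrier
    by (intro independent_mod_regular_step[OF assms(1) f reg]) (auto simp del: mp_ring_simps)
  moreover have "f ^ b * w a \<in> bounded_polys X (D + k * d)" if "a < n" "b \<le> k" for a b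
  proof -
    have "f ^ b * w a \<in> bounded_polys X (b * d + D)"
      using w(1) that by (intro bounded_polys_mult bounded_polys_power assms(2)) auto
    then show ?thesis using bounded_polys_mono[of "b * d + D" "D + k * d" X] that(2)
      by (auto simp: mult_le_mono1)
  qed
  ultimately have "has_independent X (Idl\<^bsub>mp_ring X\<^esub> Fs) (D + k * d) (card ({..<n} \<times> {..k}))"
    by (intro has_independentI) auto
  then show ?thesis by simp
qed

text \<open>Dropping the last generator multiplies the number of independent polynomials by
  \<open>k + 1\<close> and raises the exponent bound only by \<open>k * d\<close>. Once all are
  dropped, what remains is plain linear independence.\<close>

lemma regular_sequence_has_independent:
  fixes fs :: "('x, 'k::comm_ring_1) mpolynomial list"
  assumes reg: "regular_sequence (mp_ring X) fs" and fs: "set fs \<subseteq> bounded_polys X d"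
    and ind: "has_independent X (Idl\<^bsub>mp_ring X\<^esub> (set fs)) D n"
  shows "has_independent X {0 :: ('x, 'k) mpolynomial} (D + length fs * (k * d)) (n * (k + 1) ^ length fs)"
proof -
  have c: "set fs \<subseteq> carrier (mp_ring X)" using reg by (simp add: regular_sequence_def)
  have "has_independent X (Idl\<^bsub>mp_ring X\<^esub> (set (take (length fs - i) fs))) (D + i * (k * d)) (n * (k + 1) ^ i)"
    if "i \<le> length fs" for i
    using that
  proof (induction i)
    case 0
    then show ?case using ind by simp
  next
    case (Suc i)
    define j where "j = length fs - Suc i"
    have j: "j < length fs" "length fs - i = Suc j" using Suc.prems by (auto simp: j_def)
    have take: "set (take (Suc j) fs) = insert (fs ! j) (set (take j fs))"
      using j by (simp add: take_Suc_conv_app_nth)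
    have "has_independent X (Idl\<^bsub>mp_ring X\<^esub> (set (take j fs))) ((D + i * (k * d)) + k * d) (n * (k + 1) ^ i * (k + 1))"
    proof (rule has_independent_regular_step)
      show "set (take j fs) \<subseteq> carrier (mp_ring X)" using c set_take_subset[of j fs] by blast
      show "fs ! j \<in> bounded_polys X d" using fs j by auto
      show "g \<in> Idl\<^bsub>mp_ring X\<^esub> (set (take j fs))"
        if "g \<in> carrier (mp_ring X)" "fs ! j * g \<in> Idl\<^bsub>mp_ring X\<^esub> (set (take j fs))" for g
        using reg j that by (auto simp: regular_sequence_def)
      show "has_independent X (Idl\<^bsub>mp_ring X\<^esub> (insert (fs ! j) (set (take j fs)))) (D + i * (k * d)) (n * (k + 1) ^ i)"
        using Suc j take by simp
    qed
    then show ?case by (simp add: j_def algebra_simps)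
  qed
  from this[of "length fs"] show ?thesis by (simp add: mp_genideal_empty)
qed

lemma has_independent_zero_bound:
  fixes X :: "'x set"
  assumes "finite X" "has_independent X {0 :: ('x, 'k::field) mpolynomial} D n"
  shows "n \<le> (D + 1) ^ card X"
proof (rule ccontr)
  assume "\<not> n \<le> (D + 1) ^ card X"
  then have n: "card (mons X D) < card {..<n}" using card_mons(2)[OF assms(1), of D] by simp
  obtain w :: "nat \<Rightarrow> ('x, 'k) mpolynomial" where w: "w ` {..<n} \<subseteq> bounded_polys X D" "independent_mod {..<n} w {0}"
    using assms(2) unfolding has_independent_def by blast
  obtain c where c: "\<exists>a\<in>{..<n}. c a \<noteq> 0" "\<forall>m\<in>mons X D. (\<Sum>a<n. c a * lookup (w a) m) = 0"
    using homogeneous_system_nontrivial[OF card_mons(1)[OF assms(1)] _ n, of "\<lambda>a m. lookup (w a) m"] by blast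
  have "(\<Sum>a<n. single 0 (c a) * w a) = 0"
  proof (rule poly_mapping_eqI)
    fix m
    have l: "lookup (single 0 (c a) * w a) m = c a * lookup (w a) m" for a
      unfolding mult_map_scale_conv_mult[symmetric] by (simp add: map.rep_eq when_def)
    show "lookup (\<Sum>a<n. single 0 (c a) * w a) m = lookup 0 m"
    proof (cases "m \<in> mons X D")
      case True
      with c(2) show ?thesis by (simp add: lookup_sum l)
    next
      case False
      then have "lookup (w a) m = 0" if "a < n" for a
        using that w(1) by (auto simp: bounded_polys_def in_keys_iff image_subset_iff subset_iff)
      then show ?thesis by (simp add: lookup_sum l)
    qed
  qed
  with w(2) c(1) show False by (auto simp: independent_mod_def)
qed

text \<open>Growth in \<open>k\<close> decides: \<open>(k + 1) ^ (d + length fs)\<close> independent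
  polynomials lie in a box whose side is linear in \<open>k\<close>, so the exponent cannot exceed
  the number of variables. Here \<open>d\<close> plays the part of a lower bound for the dimension
  of the quotient.\<close>

lemma regular_sequence_length_bound:
  fixes fs :: "('x, 'k::field) mpolynomial list"
  assumes X: "finite X" and reg: "regular_sequence (mp_ring X) fs"
    and ind: "\<And>k. has_independent X (Idl\<^bsub>mp_ring X\<^esub> (set fs)) (c * k) ((k + 1) ^ d)"
  shows "length fs + d \<le> card X"
proof (rule ccontr)
  assume "\<not> length fs + d \<le> card X"
  then have le: "Suc (card X) \<le> d + length fs" by simp
  obtain e where e: "set fs \<subseteq> bounded_polys X e"
    using ex_bounded_polys[of "set fs" X] reg by (auto simp: regular_sequence_def)
  \<comment> \<open>Large enough that the side \<open>c * k + length fs * (k * e) + 1\<close> of the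
    box is at most \<open>C * (k + 1)\<close>.\<close>
  define C where "C = c + length fs * e + 1"
  have k: "k + 1 \<le> C ^ card X" for k
  proof -
    have "(k + 1) ^ Suc (card X) \<le> (k + 1) ^ (d + length fs)"
      using le by (rule power_increasing) simp
    also have "\<dots> = (k + 1) ^ d * (k + 1) ^ length fs" by (simp add: power_add)
    also have "\<dots> \<le> (c * k + length fs * (k * e) + 1) ^ card X"
      by (rule has_independent_zero_bound[OF X regular_sequence_has_independent[OF reg e ind]])
    also have "\<dots> \<le> (C * (k + 1)) ^ card X"
      by (intro power_mono) (auto simp: C_def algebra_simps)
    finally have "(k + 1) * (k + 1) ^ card X \<le> C ^ card X * (k + 1) ^ card X"
      by (simp only: power_Suc power_mult_distrib)
    then show ?thesis unfolding mult_le_cancel2 by simp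
  qed
  have "C ^ card X + 1 \<le> C ^ card X" by (rule k)
  then show False by simp
qed

section \<open>A lower bound for the number of generators\<close>

text \<open>The functionals \<open>pair (\<omega> a)\<close> vanish on the product of the irrelevant ideal with the ideal
  generated by \<open>fs\<close>, so the \<open>g a\<close> are linearly independent modulo that product.\<close>
lemma generators_lower_bound:
  fixes fs :: "('x, 'k::field) mpolynomial list"
  assumes fs: "set fs \<subseteq> carrier (mp_ring X)" and A: "finite A"
    and \<omega>: "\<And>a p m. a \<in> A \<Longrightarrow> p \<in> Idl\<^bsub>mp_ring X\<^esub> (set fs) \<Longrightarrow> keys m \<subseteq> X \<Longrightarrow> m \<noteq> 0 \<Longrightarrow>
      pair (\<lambda>u. \<omega> a (m + u)) p = 0"
    and g: "\<And>a. a \<in> A \<Longrightarrow> g a \<in> Idl\<^bsub>mp_ring X\<^esub> (set fs)"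
    and dual: "\<And>a b. a \<in> A \<Longrightarrow> b \<in> A \<Longrightarrow> pair (\<omega> a) (g b) = (if a = b then 1 else 0)"
  shows "card A \<le> length fs"
proof (rule ccontr)
  assume "\<not> card A \<le> length fs"
  then have less: "card (set fs) < card A" using card_length[of fs] by simp
  then obtain c where c: "\<exists>a\<in>A. c a \<noteq> 0" "\<forall>f\<in>set fs. (\<Sum>a\<in>A. c a * pair (\<omega> a) f) = 0"
    using homogeneous_system_nontrivial[OF finite_set A less, of "\<lambda>a f. pair (\<omega> a) f"] by blast
  let ?I = "Idl\<^bsub>mp_ring X\<^esub> (set fs)"
  define l where "l p = (\<Sum>a\<in>A. c a * pair (\<omega> a) p)" for p
  \<comment> \<open>Since \<open>l\<close> vanishes on multiples of elements of the ideal by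
    nonconstant monomials, its kernel within the ideal is again an ideal. It contains
    \<open>fs\<close>, hence everything, contrary to \<open>l (g a) = c a\<close>.\<close>
  define K where "K = {p \<in> ?I. l p = 0}"
  note I = mp_idealD[OF mp_genideal(1)[OF fs]]
  have l_add: "l (p + q) = l p + l q" for p q
    by (simp add: l_def pair_add algebra_simps sum.distrib)
  have l_sum: "l (sum h B) = (\<Sum>b\<in>B. l (h b))" for h and B :: "('x \<Rightarrow>\<^sub>0 nat) set"
    by (induction B rule: infinite_finite_induct) (auto simp: l_add, auto simp: l_def)
  have "ideal K (mp_ring X)"
  proof (rule mp_idealI)
    show "K \<subseteq> carrier (mp_ring X)" using I(1) by (auto simp: K_def)
    show "0 \<in> K" using I(2) by (simp add: K_def l_def)
    show "p + q \<in> K" if "p \<in> K" "q \<in> K" for p q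
      using that I(3) by (simp add: K_def l_add)
  next
    fix p h :: "('x, 'k) mpolynomial" assume p: "p \<in> K" and h: "h \<in> carrier (mp_ring X)"
    have "l (single m b * p) = 0" if "m \<in> keys h" for m b
    proof (cases "m = 0")
      case True
      have "l (single m b * p) = b * l p"
        by (simp add: l_def True pair_single_times sum_distrib_left mult.left_commute)
      then show ?thesis using p by (simp add: K_def)
    next
      case False
      have "keys m \<subseteq> X" using h that by (simp add: mp_ring_simps(1))
      then show ?thesis using p False \<omega> by (simp add: l_def pair_single_times K_def)
    qed
    moreover have "l (h * p) = (\<Sum>m\<in>keys h. l (single m (lookup h m) * p))"
      by (subst poly_mapping_expand[of h]) (simp add: sum_distrib_right l_sum)
    ultimately have "l (h * p) = 0" by simp
    then show "h * p \<in> K" using I(5)[OF _ h] p by (simp add: K_def)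
  qed
  moreover have "set fs \<subseteq> K"
    using mp_genideal(2)[OF fs] c(2) by (auto simp: K_def l_def)
  ultimately have "?I \<subseteq> K" by (intro mp_genideal(3)[OF fs])
  moreover have "l (g b) = c b" if "b \<in> A" for b
  proof -
    have "l (g b) = (\<Sum>a\<in>A. if a = b then c a else 0)"
      unfolding l_def using dual that by (intro sum.cong) auto
    then show ?thesis using that A by simp
  qed
  moreover obtain a where "a \<in> A" "c a \<noteq> 0" using c(1) by blast
  moreover have "g a \<in> K" using g[OF \<open>a \<in> A\<close>] \<open>?I \<subseteq> K\<close> by blast
  ultimately show False by (simp add: K_def)
qed

subsection \<open>Monomials as multisets\<close>

text \<open>As a multiset, a monomial can be mapped along \<open>Cut G\<close>, which forgets the
  choice among partitions with the same cut.\<close>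

definition ms :: "('x \<Rightarrow>\<^sub>0 nat) \<Rightarrow> 'x multiset" where
  "ms m = Abs_multiset (lookup m)"

definition mon :: "'x multiset \<Rightarrow> 'x \<Rightarrow>\<^sub>0 nat" where
  "mon Q = (\<Sum>x\<in>#Q. single x 1)"

lemma count_ms [simp]: "count (ms m) x = lookup m x"
proof -
  have "finite {x. 0 < lookup m x}" using finite_keys[of m] by (simp add: keys.rep_eq)
  then show ?thesis by (simp add: ms_def Abs_multiset_inverse)
qed

lemma lookup_sum_mset: "lookup (\<Sum>x\<in>#Q. f x) y = (\<Sum>x\<in>#Q. lookup (f x) y)"
  by (induction Q) (simp_all add: lookup_add)

lemma lookup_mon [simp]: "lookup (mon Q) x = count Q x"
  by (induction Q) (simp_all add: mon_def lookup_add lookup_single when_def)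

lemma ms_mon [simp]: "ms (mon Q) = Q"
  by (rule multiset_eqI) simp

lemma ms_add [simp]: "ms (a + b) = ms a + ms b"
  by (rule multiset_eqI) (simp add: lookup_add)

lemma ms_zero [simp]: "ms 0 = {#}"
  by (rule multiset_eqI) simp

lemma ms_single [simp]: "ms (single x 1) = {#x#}"
  by (rule multiset_eqI) (simp add: lookup_single when_def)

lemmas ms_single_Suc_0 [simp] = ms_single[unfolded One_nat_def]

lemma ms_inject: "ms a = ms b \<longleftrightarrow> a = b"
  by (metis count_ms poly_mapping_eqI)

lemma ms_eq_empty [simp]: "ms m = {#} \<longleftrightarrow> m = 0"
  using ms_inject[of m 0] by simp

lemma set_mset_ms [simp]: "set_mset (ms m) = keys m"
  by (auto simp: set_mset_def keys.rep_eq)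

lemma keys_mon: "keys (mon Q) = set_mset Q"
  by (auto simp: in_keys_iff)

lemma ms_expand: "ms m = (\<Sum>x\<in>keys m. replicate_mset (lookup m x) x)"
proof (rule multiset_eqI)
  fix y
  have "count (\<Sum>x\<in>keys m. replicate_mset (lookup m x) x) y = (\<Sum>x\<in>keys m. if x = y then lookup m y else 0)"
    unfolding count_sum by (rule sum.cong) auto
  then show "count (ms m) y = count (\<Sum>x\<in>keys m. replicate_mset (lookup m x) x) y"
    by (simp add: in_keys_iff)
qed

subsection \<open>The cut map on monomials\<close>

definition cut_exp :: "'v ugraph \<Rightarrow> 'v set set \<Rightarrow> 'v edge_var \<Rightarrow>\<^sub>0 nat" where
  "cut_exp G C = (\<Sum>e\<in>C. single (S_var e) 1) + (\<Sum>e\<in>edges G - C. single (T_var e) 1)"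

definition cut_weight :: "'v ugraph \<Rightarrow> ('v set set \<Rightarrow>\<^sub>0 nat) \<Rightarrow> 'v edge_var \<Rightarrow>\<^sub>0 nat" where
  "cut_weight G m = (\<Sum>P\<in>#ms m. cut_exp G (Cut G P))"

text \<open>Equality of images under the cut map: the exponent of \<open>S_var e\<close> counts the
  cuts through \<open>e\<close>, and that of \<open>T_var e\<close> is the size minus this
  count.\<close>

definition similar :: "'e set \<Rightarrow> 'e set multiset \<Rightarrow> 'e set multiset \<Rightarrow> bool" where
  "similar E Q Q' \<longleftrightarrow> size Q = size Q' \<and>
     (\<forall>e\<in>E. size {#C \<in># Q. e \<in> C#} = size {#C \<in># Q'. e \<in> C#})"

definition cuts :: "'v ugraph \<Rightarrow> 'v set set set" where
  "cuts G = Cut G ` partitions G"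

lemma finite_edges: "simple_graph G \<Longrightarrow> finite (edges G)"
proof -
  assume "simple_graph G"
  then have "edges G \<subseteq> Pow (verts G)" "finite (verts G)" by (auto simp: simple_graph_def)
  then show ?thesis by (meson finite_Pow_iff finite_subset)
qed

lemma Cut_subset: "Cut G P \<subseteq> edges G"
  by (auto simp: Cut_def)

lemma finite_partitions: "simple_graph G \<Longrightarrow> finite (partitions G)"
proof -
  assume "simple_graph G"
  then have "finite (Pow (Pow (verts G)))" by (simp add: simple_graph_def)
  moreover have "partitions G \<subseteq> Pow (Pow (verts G))" by (auto simp: partitions_def)
  ultimately show ?thesis by (rule finite_subset[rotated])
qed

lemma prod_single:
  "(\<Prod>x\<in>A. single (f x) (1 :: 'k::comm_ring_1)) = single (\<Sum>x\<in>A. (f x :: 'y \<Rightarrow>\<^sub>0 nat)) 1"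
  by (induction A rule: infinite_finite_induct) (simp_all add: mult_single)

lemma power_single:
  "single (a :: 'y \<Rightarrow>\<^sub>0 nat) (1 :: 'k::comm_ring_1) ^ n = single (\<Sum>\<^sub># (replicate_mset n a)) 1"
  by (induction n) (simp_all add: mult_single)

lemma sum_mset_image_sum:
  "(\<Sum>x\<in>#(\<Sum>a\<in>A. R a). f x) = (\<Sum>a\<in>A. \<Sum>x\<in>#R a. f x :: 'b::comm_monoid_add)"
  by (induction A rule: infinite_finite_induct) simp_all

lemma cut_map_eq_lin:
  fixes p :: "('v set set, 'k::field) mpolynomial"
  shows "cut_map G p = lin (cut_weight G) p"
proof -
  have h: "(\<Prod>e\<in>Cut G P. mp_var (S_var e)) * (\<Prod>e\<in>edges G - Cut G P. mp_var (T_var e))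
      = single (cut_exp G (Cut G P)) (1 :: 'k)" for P
    by (simp add: mp_var_def prod_single mult_single cut_exp_def)
  have "(\<Prod>P\<in>keys m. single (cut_exp G (Cut G P)) (1 :: 'k) ^ lookup m P) = single (cut_weight G m) 1" for m
  proof -
    have "(\<Prod>P\<in>keys m. single (cut_exp G (Cut G P)) (1 :: 'k) ^ lookup m P)
        = single (\<Sum>P\<in>keys m. \<Sum>x\<in>#replicate_mset (lookup m P) P. cut_exp G (Cut G P)) 1"
      unfolding prod_single[symmetric] by (rule prod.cong) (simp_all add: power_single)
    also have "(\<Sum>P\<in>keys m. \<Sum>x\<in>#replicate_mset (lookup m P) P. cut_exp G (Cut G P))
        = (\<Sum>P\<in>keys m. \<Sum>x\<in>#replicate_mset (lookup m P) P. cut_exp G (Cut G x))"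
      by simp
    also have "\<dots> = cut_weight G m"
      unfolding cut_weight_def sum_mset_image_sum[symmetric] ms_expand ..
    finally show ?thesis .
  qed
  then show ?thesis
    by (simp add: cut_map_def mp_subst_def h lin_def mp_const_def mult_single)
qed

lemma cut_ideal_eq:
  "cut_ideal G = {p \<in> carrier (mp_ring (partitions G)). lin (cut_weight G) p = (0 :: (_, 'k::field) mpolynomial)}"
  unfolding cut_ideal_def a_kernel_def' by (simp add: cut_map_eq_lin)

lemma lookup_sum_single_inj:
  assumes "finite A" "inj f"
  shows "lookup (\<Sum>e\<in>A. single (f e) (1 :: nat)) (f e') = of_bool (e' \<in> A)"
proof -
  have "lookup (\<Sum>e\<in>A. single (f e) (1 :: nat)) (f e') = (\<Sum>e\<in>A. if e = e' then 1 else 0)"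
    unfolding lookup_sum using assms(2)
    by (intro sum.cong) (auto simp: lookup_single when_def inj_def)
  with assms(1) show ?thesis by simp
qed

lemma lookup_cut_exp:
  assumes "finite (edges G)" "C \<subseteq> edges G"
  shows "lookup (cut_exp G C) (S_var e) = of_bool (e \<in> C)"
    and "lookup (cut_exp G C) (T_var e) = of_bool (e \<in> edges G - C)"
proof -
  have f: "finite C" using assms finite_subset by blast
  have "lookup (\<Sum>e\<in>A. single (S_var e) (1 :: nat)) (T_var e') = 0"
    "lookup (\<Sum>e\<in>A. single (T_var e) (1 :: nat)) (S_var e') = 0" for A and e' :: "'a set"
    by (simp_all add: lookup_sum lookup_single)
  then show "lookup (cut_exp G C) (S_var e) = of_bool (e \<in> C)"
    and "lookup (cut_exp G C) (T_var e) = of_bool (e \<in> edges G - C)"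
    using f assms lookup_sum_single_inj[of C S_var e] lookup_sum_single_inj[of "edges G - C" T_var e]
    by (simp_all add: cut_exp_def lookup_add inj_def)
qed

lemma size_filter_eq_sum: "size {#x \<in># Q. p x#} = (\<Sum>x\<in>#Q. of_bool (p x))"
  by (induction Q) auto

lemma cut_weight_lookup:
  assumes "simple_graph G"
  shows "lookup (cut_weight G m) (S_var e) = size {#C \<in># image_mset (Cut G) (ms m). e \<in> C#}"
    and "e \<in> edges G \<Longrightarrow> lookup (cut_weight G m) (T_var e) + size {#C \<in># image_mset (Cut G) (ms m). e \<in> C#}
      = size (ms m)"
    and "e \<notin> edges G \<Longrightarrow> lookup (cut_weight G m) (S_var e) = 0"
    and "e \<notin> edges G \<Longrightarrow> lookup (cut_weight G m) (T_var e) = 0"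
proof -
  note l = lookup_cut_exp[OF finite_edges[OF assms] Cut_subset]
  show S: "lookup (cut_weight G m) (S_var e) = size {#C \<in># image_mset (Cut G) (ms m). e \<in> C#}"
    unfolding cut_weight_def lookup_sum_mset l(1) by (simp add: size_filter_eq_sum image_mset.compositionality o_def)
  show "lookup (cut_weight G m) (T_var e) + size {#C \<in># image_mset (Cut G) (ms m). e \<in> C#} = size (ms m)"
    if "e \<in> edges G"
  proof -
    have "(\<Sum>P\<in>#Q. of_bool (e \<in> edges G - Cut G P)) + (\<Sum>P\<in>#Q. of_bool (e \<in> Cut G P)) = size Q" for Q
      using that by (induction Q) auto
    then show ?thesis
      unfolding cut_weight_def lookup_sum_mset l(2)
      by (simp add: size_filter_eq_sum image_mset.compositionality o_def)
  qed
  show "lookup (cut_weight G m) (S_var e) = 0" if "e \<notin> edges G"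
    unfolding cut_weight_def lookup_sum_mset l(1) using that Cut_subset[of G] by (auto simp: subset_iff)
  show "lookup (cut_weight G m) (T_var e) = 0" if "e \<notin> edges G"
    unfolding cut_weight_def lookup_sum_mset l(2) using that by simp
qed

lemma cut_weight_eq_iff:
  assumes "simple_graph G" "edges G \<noteq> {}"
  shows "cut_weight G m = cut_weight G m' \<longleftrightarrow>
    similar (edges G) (image_mset (Cut G) (ms m)) (image_mset (Cut G) (ms m'))"
    (is "?L \<longleftrightarrow> similar _ ?Q ?Q'")
proof
  note l = cut_weight_lookup[OF assms(1)]
  {
    assume ?L
    then have *: "size {#C \<in># ?Q. e \<in> C#} = size {#C \<in># ?Q'. e \<in> C#}" for e
      using l(1)[of m e] l(1)[of m' e] by simp
    \<comment> \<open>The degree is the sum of the exponents of the two variables of any one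
      edge.\<close>
    obtain e where "e \<in> edges G" using assms(2) by blast
    then have "size (ms m) = size (ms m')" using l(2)[of e m] l(2)[of e m'] \<open>?L\<close> * by metis
    with * show "similar (edges G) ?Q ?Q'" by (simp add: similar_def)
  next
    assume s: "similar (edges G) ?Q ?Q'"
    show ?L
    proof (rule poly_mapping_eqI)
      fix x
      show "lookup (cut_weight G m) x = lookup (cut_weight G m') x"
      proof (cases x)
        case (S_var e)
        then show ?thesis using l(1)[of m e] l(1)[of m' e] l(3)[of e m] l(3)[of e m'] s
          by (cases "e \<in> edges G") (auto simp: similar_def)
      next
        case (T_var e)
        then show ?thesis using l(2)[of e m] l(2)[of e m'] l(4)[of e m] l(4)[of e m'] s
          by (cases "e \<in> edges G") (auto simp: similar_def)
      qed
    qed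
  }
qed

lemma cut_weight_add: "cut_weight G (a + b) = cut_weight G a + cut_weight G b"
  by (simp add: cut_weight_def)

subsection \<open>Cuts\<close>

definition delta :: "'v ugraph \<Rightarrow> 'v set \<Rightarrow> 'v set set" where
  "delta G A = {e \<in> edges G. card (e \<inter> A) = 1}"

abbreviation part :: "'v ugraph \<Rightarrow> 'v set \<Rightarrow> 'v set set" where
  "part G A \<equiv> {A, verts G - A}"

lemma edgeE:
  assumes "simple_graph G" "e \<in> edges G"
  obtains i j where "i \<noteq> j" "i \<in> verts G" "j \<in> verts G" "e = {i, j}"
proof -
  have e: "e \<subseteq> verts G" "card e = 2" using assms unfolding simple_graph_def by blast+
  then obtain i j where "e = {i, j}" "i \<noteq> j" unfolding card_2_iff by blast
  with e(1) that[of i j] show ?thesis by blast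
qed

lemma mem_delta:
  assumes "i \<noteq> j"
  shows "{i, j} \<in> delta G A \<longleftrightarrow> {i, j} \<in> edges G \<and> (i \<in> A \<longleftrightarrow> j \<notin> A)"
proof -
  have "{i, j} \<inter> A = (if i \<in> A then {i} else {}) \<union> (if j \<in> A then {j} else {})" by auto
  then show ?thesis using assms by (auto simp: delta_def)
qed

lemma part_in_partitions: "A \<subseteq> verts G \<Longrightarrow> part G A \<in> partitions G"
  by (auto simp: partitions_def)

lemma partitionsE:
  assumes "P \<in> partitions G" obtains A where "A \<subseteq> verts G" "P = part G A"
proof -
  obtain A B where AB: "P = {A, B}" "A \<union> B = verts G" "A \<inter> B = {}"
    using assms unfolding partitions_def by blast
  then have "B = verts G - A" by blast
  with AB that[of A] show ?thesis by blast
qed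

lemma Cut_part:
  assumes "simple_graph G" "A \<subseteq> verts G"
  shows "Cut G (part G A) = delta G A"
proof (intro Set.set_eqI)
  fix e
  show "e \<in> Cut G (part G A) \<longleftrightarrow> e \<in> delta G A"
  proof (cases "e \<in> edges G")
    case True
    then obtain i j where e: "i \<noteq> j" "i \<in> verts G" "j \<in> verts G" "e = {i, j}"
      using edgeE[OF assms(1)] by metis
    have "e \<in> Cut G (part G A) \<longleftrightarrow> (i \<in> A \<longleftrightarrow> j \<notin> A)"
    proof
      assume "e \<in> Cut G (part G A)"
      then show "i \<in> A \<longleftrightarrow> j \<notin> A" using e unfolding Cut_def by (auto simp: doubleton_eq_iff)
    next
      assume ij: "i \<in> A \<longleftrightarrow> j \<notin> A"
      show "e \<in> Cut G (part G A)"
      proof (cases "i \<in> A")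
        case True
        with ij e \<open>e \<in> edges G\<close> show ?thesis unfolding Cut_def by blast
      next
        case False
        have "part G A = {verts G - A, A}" by blast
        with False ij e \<open>e \<in> edges G\<close> show ?thesis unfolding Cut_def by blast
      qed
    qed
    then show ?thesis using mem_delta[OF e(1), of G A] True e(4) by simp
  qed (auto simp: Cut_def delta_def)
qed

lemma cuts_eq:
  assumes "simple_graph G" shows "cuts G = delta G ` Pow (verts G)"
proof
  show "cuts G \<subseteq> delta G ` Pow (verts G)"
    using Cut_part[OF assms] by (auto simp: cuts_def elim!: partitionsE)
  show "delta G ` Pow (verts G) \<subseteq> cuts G"
    using Cut_part[OF assms, symmetric] part_in_partitions by (fastforce simp: cuts_def)
qed

subsection \<open>The dimension of the cut algebra\<close>

text \<open>For an edge \<open>e = {u, v}\<close> the products \<open>q\<^sub>u q\<^sub>v\<close> and \<open>q\<^sub>\<emptyset> q\<^sub>e\<close> have images that differ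
  only in the variables of \<open>e\<close>, so the exponents \<open>b\<close> and \<open>j\<close> can be read off from the image.\<close>
definition dim_block :: "'v ugraph \<Rightarrow> nat \<Rightarrow> 'v set \<Rightarrow> nat \<Rightarrow> 'v set set multiset" where
  "dim_block G k e b = repeat_mset b (image_mset (\<lambda>v. part G {v}) (mset_set e)) +
     repeat_mset (k - b) {#part G {}, part G e#}"

definition dim_mset :: "'v ugraph \<Rightarrow> nat \<Rightarrow> ('v set \<Rightarrow> nat) \<times> nat \<Rightarrow> 'v set set multiset" where
  "dim_mset G k bj = (\<Sum>e\<in>edges G. dim_block G k e (fst bj e)) + replicate_mset (snd bj) (part G {})"

lemma size_filter_repeat: "size {#x \<in># repeat_mset n Q. p x#} = n * size {#x \<in># Q. p x#}"
  by (induction n) simp_all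

lemma size_filter_image_sum:
  "size {#x \<in># image_mset f (\<Sum>a\<in>A. R a). p x#} = (\<Sum>a\<in>A. size {#x \<in># image_mset f (R a). p x#})"
  by (induction A rule: infinite_finite_induct) simp_all

lemma size_sum_mset: "size (\<Sum>a\<in>A. R a :: 'b multiset) = (\<Sum>a\<in>A. size (R a))"
  by (induction A rule: infinite_finite_induct) simp_all

lemma image_repeat_mset: "image_mset f (repeat_mset n Q) = repeat_mset n (image_mset f Q)"
  by (induction n) simp_all

lemma set_repeat_mset: "set_mset (repeat_mset n Q) \<subseteq> set_mset Q"
  by (induction n) auto

lemma edge_facts:
  assumes "simple_graph G" "e \<in> edges G"
  shows "finite e" "card e = 2" "e \<subseteq> verts G"
  using assms by (auto simp: simple_graph_def intro: card_ge_0_finite)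

lemma card_edges_Int:
  assumes "simple_graph G" "e \<in> edges G" "e' \<in> edges G" "e \<noteq> e'"
  shows "card (e \<inter> e') \<le> 1"
proof (rule ccontr)
  assume "\<not> card (e \<inter> e') \<le> 1"
  then have "card e \<le> card (e \<inter> e')" "card e' \<le> card (e \<inter> e')"
    using edge_facts(2)[OF assms(1)] assms(2,3) by auto
  then have "e \<inter> e' = e" "e \<inter> e' = e'"
    using edge_facts(1)[OF assms(1)] assms(2,3) by (meson card_seteq Int_lower1 Int_lower2)+
  with assms(4) show False by simp
qed

text \<open>Each of the \<open>k\<close> pairs in the block of \<open>e'\<close> cuts an adjacent
  edge exactly once and a disjoint edge never, whichever of the two kinds the pair is. Only for
  \<open>e'\<close> itself do the kinds differ: twice against never.\<close>

lemma dim_block_count: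
  assumes G: "simple_graph G" and e: "e \<in> edges G" "e' \<in> edges G" and b: "b \<le> k"
  shows "size {#C \<in># image_mset (Cut G) (dim_block G k e' b). e \<in> C#} =
    (if e = e' then 2 * b else k * card (e \<inter> e'))"
proof -
  note f = edge_facts[OF G e(2)]
  have Cut_single: "Cut G (part G {v}) = delta G {v}" if "v \<in> e'" for v
    using Cut_part[OF G, of "{v}"] that f(3) by auto
  have "size {#C \<in># image_mset (\<lambda>v. Cut G (part G {v})) (mset_set e'). e \<in> C#}
      = size {#C \<in># image_mset (\<lambda>v. delta G {v}) (mset_set e'). e \<in> C#}"
    using f(1) by (intro arg_cong[of _ _ size] arg_cong[of _ _ "filter_mset _"] image_mset_cong) (simp add: Cut_single)
  also have "\<dots> = (\<Sum>v\<in>e'. of_bool (e \<in> delta G {v}))"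
    by (simp add: size_filter_eq_sum image_mset.compositionality o_def sum_unfold_sum_mset)
  also have "\<dots> = (\<Sum>v\<in>e'. of_bool (v \<in> e))"
    using e(1) by (intro sum.cong) (auto simp: delta_def)
  also have "\<dots> = card (e \<inter> e')"
    using f(1) by (simp add: Int_commute)
  finally have 1: "size {#C \<in># image_mset (\<lambda>v. Cut G (part G {v})) (mset_set e'). e \<in> C#} = card (e \<inter> e')" .
  have 2: "Cut G (part G {}) = {}" using Cut_part[OF G, of "{}"] by (simp add: delta_def)
  have 3: "e \<in> Cut G (part G e') \<longleftrightarrow> card (e \<inter> e') = 1"
    using Cut_part[OF G f(3)] e(1) by (simp add: delta_def)
  have "size {#C \<in># image_mset (Cut G) (dim_block G k e' b). e \<in> C#}
      = b * card (e \<inter> e') + (k - b) * of_bool (card (e \<inter> e') = 1)"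
    by (simp only: dim_block_def image_repeat_mset image_mset_union filter_union_mset size_union
        size_filter_repeat image_mset.compositionality o_def 1) (simp add: 2[simplified] 3)
  also have "\<dots> = (if e = e' then 2 * b else k * card (e \<inter> e'))"
  proof (cases "e = e'")
    case False
    then have "card (e \<inter> e') = 0 \<or> card (e \<inter> e') = 1" using card_edges_Int[OF G e] by linarith
    then show ?thesis using False b by (auto simp: algebra_simps)
  qed (use f(2) in simp)
  finally show ?thesis .
qed

lemma dim_block_size:
  assumes "simple_graph G" "e \<in> edges G" "b \<le> k" shows "size (dim_block G k e b) = 2 * k"
  using edge_facts[OF assms(1,2)] assms(3) by (simp add: dim_block_def)

text \<open>The blocks of other edges contribute a constant to the count at \<open>e\<close>, so
  this count determines the exponent of \<open>e\<close>. The last exponent is then found from the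
  degree.\<close>

lemma dim_mset_inj:
  assumes G: "simple_graph G" and ne: "edges G \<noteq> {}"
    and bj: "bj \<in> PiE (edges G) (\<lambda>_. {..k}) \<times> {..k}" "bj' \<in> PiE (edges G) (\<lambda>_. {..k}) \<times> {..k}"
    and eq: "cut_weight G (mon (dim_mset G k bj)) = cut_weight G (mon (dim_mset G k bj'))"
  shows "bj = bj'"
proof -
  have fin: "finite (edges G)" by (rule finite_edges[OF G])
  have b: "fst c e \<le> k" if "c \<in> PiE (edges G) (\<lambda>_. {..k}) \<times> {..k}" "e \<in> edges G" for c :: "(_ \<Rightarrow> nat) \<times> nat" and e
    using that by auto
  have sz: "size (dim_mset G k c) = 2 * k * card (edges G) + snd c"
    if "c \<in> PiE (edges G) (\<lambda>_. {..k}) \<times> {..k}" for c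
    using dim_block_size[OF G _ b[OF that]] by (simp add: dim_mset_def size_sum_mset)
  have cnt: "size {#C \<in># image_mset (Cut G) (dim_mset G k c). e \<in> C#}
      = 2 * fst c e + (\<Sum>e'\<in>edges G - {e}. k * card (e \<inter> e'))"
    if c: "c \<in> PiE (edges G) (\<lambda>_. {..k}) \<times> {..k}" and e: "e \<in> edges G" for c e
  proof -
    have 0: "e \<notin> Cut G (part G {})" using Cut_part[OF G, of "{}"] by (simp add: delta_def)
    have "size {#C \<in># image_mset (Cut G) (dim_mset G k c). e \<in> C#}
        = (\<Sum>e'\<in>edges G. size {#C \<in># image_mset (Cut G) (dim_block G k e' (fst c e')). e \<in> C#})"
      using 0 by (simp add: dim_mset_def size_filter_image_sum)
    also have "\<dots> = (\<Sum>e'\<in>edges G. if e = e' then 2 * fst c e' else k * card (e \<inter> e'))"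
      by (rule sum.cong) (simp_all add: dim_block_count[OF G e _ b[OF c]])
    also have "\<dots> = 2 * fst c e + (\<Sum>e'\<in>edges G - {e}. if e = e' then 2 * fst c e' else k * card (e \<inter> e'))"
      using fin e by (subst sum.remove[of _ e]) auto
    also have "(\<Sum>e'\<in>edges G - {e}. if e = e' then 2 * fst c e' else k * card (e \<inter> e'))
        = (\<Sum>e'\<in>edges G - {e}. k * card (e \<inter> e'))"
      by (rule sum.cong) auto
    finally show ?thesis .
  qed
  have s: "similar (edges G) (image_mset (Cut G) (dim_mset G k bj)) (image_mset (Cut G) (dim_mset G k bj'))"
    using eq cut_weight_eq_iff[OF G ne] by simp
  have "fst bj e = fst bj' e" if "e \<in> edges G" for e
    using s that cnt[OF bj(1) that] cnt[OF bj(2) that] unfolding similar_def by fastforce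
  then have "fst bj = fst bj'" using bj by (intro PiE_ext[of _ "edges G" "\<lambda>_. {..k}"]) auto
  moreover have "snd bj = snd bj'" using s sz[OF bj(1)] sz[OF bj(2)] by (simp add: similar_def)
  ultimately show ?thesis by (simp add: prod_eq_iff)
qed

text \<open>Distinct images for a whole box of \<open>card (edges G) + 1\<close> exponents amount to
  this lower bound for the dimension. Exponents are estimated by the total degree,
  \<open>2 * k\<close> for each edge and at most \<open>k\<close> for the extra factor.\<close>

lemma cut_ideal_has_independent:
  assumes G: "simple_graph G" and ne: "edges G \<noteq> {}"
  shows "has_independent (partitions G) (cut_ideal G :: (_, 'k::field) mpolynomial set)
    ((2 * card (edges G) + 1) * k) ((k + 1) ^ (card (edges G) + 1))"
proof -
  let ?A = "PiE (edges G) (\<lambda>_. {..k}) \<times> {..k}"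
  let ?m = "\<lambda>a. mon (dim_mset G k a)"
  have fin: "finite (edges G)" by (rule finite_edges[OF G])
  have card: "card ?A = (k + 1) ^ (card (edges G) + 1)"
    using fin by (simp add: card_cartesian_product card_PiE)
  have fA: "finite ?A" using fin by (auto intro!: finite_PiE)
  have "independent_mod ?A (\<lambda>a. single (?m a) 1) (cut_ideal G :: (_, 'k) mpolynomial set)"
    unfolding independent_mod_def
  proof (intro allI impI ballI)
    fix c :: "_ \<Rightarrow> 'k" and a
    assume c: "(\<Sum>a\<in>?A. single 0 (c a) * single (?m a) 1) \<in> cut_ideal G" and a: "a \<in> ?A"
    have "(\<Sum>a\<in>?A. single (cut_weight G (?m a)) (c a)) = 0"
      using c by (simp add: cut_ideal_eq lin_sum mult_single)
    then have "0 = (\<Sum>a'\<in>?A. lookup (single (cut_weight G (?m a')) (c a')) (cut_weight G (?m a)))"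
      by (simp flip: lookup_sum)
    also have "\<dots> = (\<Sum>a'\<in>?A. if a' = a then c a else 0)"
      using dim_mset_inj[OF G ne _ a] by (intro sum.cong) (auto simp: lookup_single when_def)
    also have "\<dots> = c a" using fA a by simp
    finally show "c a = 0" ..
  qed
  moreover have "single (?m a) (1 :: 'k) \<in> bounded_polys (partitions G) ((2 * card (edges G) + 1) * k)"
    if a: "a \<in> ?A" for a
  proof -
    have "count (dim_mset G k a) x \<le> (2 * card (edges G) + 1) * k" for x
    proof -
      have "size (dim_mset G k a) = (\<Sum>e\<in>edges G. 2 * k) + snd a"
        unfolding dim_mset_def size_union size_sum_mset size_replicate_mset
        using a by (intro arg_cong2[of _ _ _ _ "(+)"] sum.cong dim_block_size[OF G]) auto
      also have "\<dots> \<le> (2 * card (edges G) + 1) * k" using a by (auto simp: algebra_simps)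
      finally show ?thesis using count_le_size[of "dim_mset G k a" x] by linarith
    qed
    moreover have "set_mset (dim_mset G k a) \<subseteq> partitions G"
    proof -
      have "set_mset (dim_block G k e b) \<subseteq> partitions G" if e: "e \<in> edges G" for e b
      proof -
        note f = edge_facts[OF G e]
        have h: "set_mset (image_mset (\<lambda>v. part G {v}) (mset_set e)) \<subseteq> partitions G"
          "set_mset {#part G {}, part G e#} \<subseteq> partitions G"
          using f part_in_partitions[of "{}" G] by (auto intro!: part_in_partitions)
        then show ?thesis
          unfolding dim_block_def set_mset_union
          by (intro Un_least order_trans[OF set_repeat_mset h(1)] order_trans[OF set_repeat_mset h(2)])
      qed
      then have "set_mset (\<Sum>e\<in>E. dim_block G k e (fst a e)) \<subseteq> partitions G" if "E \<subseteq> edges G" for E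
        using that by (induction E rule: infinite_finite_induct) auto
      from this[of "edges G"] show ?thesis
        using part_in_partitions[of "{}" G] by (auto simp: dim_mset_def)
    qed
    ultimately show ?thesis by (auto simp: bounded_polys_def mons_def keys_mon)
  qed
  ultimately have "has_independent (partitions G) (cut_ideal G :: (_, 'k) mpolynomial set)
    ((2 * card (edges G) + 1) * k) (card ?A)"
    using fA by (intro has_independentI) auto
  then show ?thesis by (simp only: card)
qed

subsection \<open>Minimal generators of the cut ideal\<close>

text \<open>In the graph on the monomials with a given image, where monomials with a common variable are
  adjacent, \<open>Q\<close> is an isolated vertex; a second vertex in that graph then yields a minimal generator.\<close>
definition isolated :: "'v ugraph \<Rightarrow> 'v set set multiset \<Rightarrow> bool" where
  "isolated G Q \<longleftrightarrow>
     (\<forall>U U'. U \<subset># Q \<longrightarrow> set_mset U' \<subseteq> cuts G \<longrightarrow> similar (edges G) U U' \<longrightarrow> U = U')"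

lemma similar_refl: "similar E Q Q"
  and similar_sym: "similar E Q Q' \<Longrightarrow> similar E Q' Q"
  and similar_trans: "similar E Q Q' \<Longrightarrow> similar E Q' Q'' \<Longrightarrow> similar E Q Q''"
  by (simp_all add: similar_def)

lemma single_Suc_0_inject [simp]: "single a (Suc 0) = single b (Suc 0) \<longleftrightarrow> a = b"
  using ms_inject[of "single a (Suc 0)" "single b (Suc 0)"] by simp

text \<open>A functional that is constant on the fibres of \<open>\<mu>\<close> within the support
  factors through \<open>lin \<mu>\<close>.\<close>

lemma pair_fibre_constant:
  assumes "lin \<mu> p = 0" "\<And>u u'. u \<in> keys p \<Longrightarrow> u' \<in> keys p \<Longrightarrow> \<mu> u = \<mu> u' \<Longrightarrow> w u = w u'"
  shows "pair w p = 0"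
proof -
  define W where "W b = w (SOME u. u \<in> keys p \<and> \<mu> u = b)" for b
  have "w u = W (\<mu> u)" if "u \<in> keys p" for u
  proof -
    have "(SOME u'. u' \<in> keys p \<and> \<mu> u' = \<mu> u) \<in> keys p \<and> \<mu> (SOME u'. u' \<in> keys p \<and> \<mu> u' = \<mu> u) = \<mu> u"
      by (rule someI[of "\<lambda>u'. u' \<in> keys p \<and> \<mu> u' = \<mu> u" u]) (simp add: that)
    then show ?thesis unfolding W_def using assms(2) that by metis
  qed
  then have "pair w p = pair (\<lambda>u. W (\<mu> u)) p" by (rule pair_cong)
  also have "\<dots> = pair W (lin \<mu> p)" by (simp add: pair_lin)
  finally show ?thesis by (simp add: assms(1))
qed

lemma representatives_card:
  assumes "finite S" "\<And>x. x \<in> S \<Longrightarrow> r x \<in> S \<and> r x \<noteq> x \<and> R x (r x)"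
    and "\<And>x. R x x" "\<And>x y. R x y \<Longrightarrow> R y x" "\<And>x y z. R x y \<Longrightarrow> R y z \<Longrightarrow> R x z"
  shows "\<exists>\<rho>. (\<forall>x\<in>S. \<rho> x \<in> S \<and> R x (\<rho> x)) \<and> card S \<le> 2 * card (S - \<rho> ` S)"
proof -
  define \<rho> where "\<rho> x = (SOME y. y \<in> S \<and> R x y)" for x
  have \<rho>: "\<rho> x \<in> S" "R x (\<rho> x)" if "x \<in> S" for x
    using someI[of "\<lambda>y. y \<in> S \<and> R x y" x] that assms(3) by (auto simp: \<rho>_def)
  have eq: "\<rho> x = \<rho> y" if "R x y" for x y
  proof -
    have "R x = R y" using that assms(4,5) by blast
    then show ?thesis by (simp add: \<rho>_def)
  qed
  have inj: "inj_on (\<lambda>x. r x) (\<rho> ` S)"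
  proof (rule inj_onI)
    fix x y assume "x \<in> \<rho> ` S" "y \<in> \<rho> ` S" "r x = r y"
    then obtain a b where ab: "a \<in> S" "b \<in> S" "x = \<rho> a" "y = \<rho> b" by blast
    have "R x (r x)" "R y (r y)" using assms(2) \<rho>(1) ab by auto
    then have "R x y" using \<open>r x = r y\<close> assms(4,5) by metis
    moreover have "R a x" "R b y" using \<rho>(2) ab by auto
    ultimately have "R a b" using assms(4,5) by blast
    then show "x = y" using eq ab by simp
  qed
  have "r ` \<rho> ` S \<subseteq> S - \<rho> ` S"
  proof
    fix y assume "y \<in> r ` \<rho> ` S"
    then obtain a where a: "a \<in> S" "y = r (\<rho> a)" by blast
    then have y: "y \<in> S" "y \<noteq> \<rho> a" "R (\<rho> a) y" using assms(2) \<rho>(1) by auto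
    have "R a y" using y(3) \<rho>(2)[OF a(1)] assms(5) by blast
    have "y \<notin> \<rho> ` S"
    proof
      assume "y \<in> \<rho> ` S"
      then obtain b where b: "b \<in> S" "y = \<rho> b" by blast
      then have "R a b" using \<open>R a y\<close> \<rho>(2)[OF b(1)] assms(4,5) by metis
      then show False using eq[of a b] b y(2) by simp
    qed
    with y show "y \<in> S - \<rho> ` S" by blast
  qed
  then have "card (\<rho> ` S) \<le> card (S - \<rho> ` S)"
    using inj assms(1) by (metis card_image card_mono finite_Diff)
  moreover have "card (S - \<rho> ` S) = card S - card (\<rho> ` S)"
    using \<rho>(1) assms(1) by (intro card_Diff_subset) auto
  ultimately have "card S \<le> 2 * card (S - \<rho> ` S)" by linarith
  with \<rho> show ?thesis by blast
qed


text \<open>There is a linear generator for each partition other than the chosen representative of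
  its cut, \<open>card (partitions G) - card (cuts G)\<close> in all, and a further binomial for
  each member of \<open>S\<close> other than the representative of its similarity class, at least
  half of \<open>S\<close>.\<close>

lemma cut_generators_bound:
  fixes fs :: "('v set set, 'k::field) mpolynomial list"
  assumes G: "simple_graph G" and ne: "edges G \<noteq> {}"
    and fs: "set fs \<subseteq> carrier (mp_ring (partitions G))"
    and I: "cut_ideal G = Idl\<^bsub>mp_ring (partitions G)\<^esub> (set fs)"
    and S: "finite S" "\<And>Q. Q \<in> S \<Longrightarrow> set_mset Q \<subseteq> cuts G \<and> 2 \<le> size Q \<and> isolated G Q"
    and r: "\<And>Q. Q \<in> S \<Longrightarrow> r Q \<in> S \<and> r Q \<noteq> Q \<and> similar (edges G) Q (r Q)"
  shows "2 * card (partitions G) + card S \<le> 2 * card (cuts G) + 2 * length fs"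
proof -
  let ?X = "partitions G"
  define \<kappa> where "\<kappa> m = image_mset (Cut G) (ms m)" for m
  have \<kappa>_add: "\<kappa> (a + b) = \<kappa> a + \<kappa> b" for a b by (simp add: \<kappa>_def)
  have size_\<kappa>: "size (\<kappa> m) = size (ms m)" for m by (simp add: \<kappa>_def)
  have w_iff: "cut_weight G u = cut_weight G u' \<longleftrightarrow> similar (edges G) (\<kappa> u) (\<kappa> u')" for u u'
    unfolding \<kappa>_def by (rule cut_weight_eq_iff[OF G ne])
  define \<sigma> where "\<sigma> C = (SOME P. P \<in> ?X \<and> Cut G P = C)" for C
  have \<sigma>: "\<sigma> C \<in> ?X" "Cut G (\<sigma> C) = C" if "C \<in> cuts G" for C
    using that someI_ex[of "\<lambda>P. P \<in> ?X \<and> Cut G P = C"] by (auto simp: cuts_def \<sigma>_def)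
  have finX: "finite ?X" by (rule finite_partitions[OF G])
  obtain \<rho> where \<rho>: "\<And>Q. Q \<in> S \<Longrightarrow> \<rho> Q \<in> S \<and> similar (edges G) Q (\<rho> Q)"
    and card_S: "card S \<le> 2 * card (S - \<rho> ` S)"
  proof -
    have "\<exists>\<rho>. (\<forall>Q\<in>S. \<rho> Q \<in> S \<and> similar (edges G) Q (\<rho> Q)) \<and> card S \<le> 2 * card (S - \<rho> ` S)"
    proof (rule representatives_card[where r = r and R = "similar (edges G)", OF S(1)])
      show "r Q \<in> S \<and> r Q \<noteq> Q \<and> similar (edges G) Q (r Q)" if "Q \<in> S" for Q
        by (rule r[OF that])
      show "similar (edges G) Q Q" for Q by (rule similar_refl)
      show "similar (edges G) Q' Q" if "similar (edges G) Q Q'" for Q Q' by (rule similar_sym[OF that])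
      show "similar (edges G) Q Q''" if "similar (edges G) Q Q'" "similar (edges G) Q' Q''" for Q Q' Q''
        by (rule similar_trans[OF that])
    qed
    then show ?thesis using that by blast
  qed
  define N where "N = {P \<in> ?X. \<sigma> (Cut G P) \<noteq> P}"
  define M where "M = S - \<rho> ` S"
  have card_N: "card ?X = card N + card (cuts G)"
  proof -
    have "?X - N = \<sigma> ` cuts G" using \<sigma> by (auto simp: N_def cuts_def)
    moreover have "inj_on \<sigma> (cuts G)" using \<sigma>(2) by (metis inj_onI)
    ultimately have "card (?X - N) = card (cuts G)" by (simp add: card_image)
    moreover have "card ?X = card N + card (?X - N)"
      using finX card_Diff_subset[of N ?X] card_mono[of ?X N] finite_subset[of N ?X] by (auto simp: N_def)
    ultimately show ?thesis by simp
  qed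
  define lift where "lift Q = mon (image_mset \<sigma> Q)" for Q
  have \<kappa>_lift: "\<kappa> (lift Q) = Q" if "Q \<in> S" for Q
  proof -
    have "image_mset (\<lambda>C. Cut G (\<sigma> C)) Q = image_mset (\<lambda>C. C) Q"
      using S(2)[OF that] \<sigma>(2) by (intro image_mset_cong) blast
    then show ?thesis by (simp add: \<kappa>_def lift_def image_mset.compositionality o_def)
  qed
  have lift_keys: "keys (lift Q) \<subseteq> ?X" if "Q \<in> S" for Q
    using S(2)[OF that] \<sigma>(1) by (auto simp: lift_def keys_mon)
  let ?A = "Inl ` N \<union> Inr ` M"
  \<comment> \<open>For a linear generator the functional tests a single variable. For the others it
    tests the multiset of cuts, so it does not notice exchanges of partitions with equal
    cuts.\<close>
  define \<omega> :: "('v set set + 'v set set multiset) \<Rightarrow> ('v set set \<Rightarrow>\<^sub>0 nat) \<Rightarrow> 'k" where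
    "\<omega> a m = (case a of Inl P \<Rightarrow> of_bool (m = single P 1) | Inr Q \<Rightarrow> of_bool (\<kappa> m = Q))" for a m
  define g :: "('v set set + 'v set set multiset) \<Rightarrow> ('v set set, 'k) mpolynomial" where
    "g a = (case a of Inl P \<Rightarrow> single (single P 1) 1 - single (single (\<sigma> (Cut G P)) 1) 1
      | Inr Q \<Rightarrow> single (lift Q) 1 - single (lift (\<rho> Q)) 1)" for a
  have finN: "finite N" "finite M" using finX S(1) by (auto simp: N_def M_def)
  have bin_mem: "single u 1 - single v 1 \<in> (cut_ideal G :: (_, 'k) mpolynomial set)"
    if "keys u \<subseteq> ?X" "keys v \<subseteq> ?X" "similar (edges G) (\<kappa> u) (\<kappa> v)" for u v
  proof -
    have "single u 1 - single v (1 :: 'k) \<in> carrier (mp_ring ?X)" by (rule binomial_carrier[OF that(1,2)])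
    moreover have "cut_weight G u = cut_weight G v" using that(3) w_iff by simp
    ultimately show ?thesis by (simp add: cut_ideal_eq lin_diff)
  qed
  have "card ?A \<le> length fs"
  proof (rule generators_lower_bound[OF fs, where \<omega> = \<omega> and g = g])
    show "finite ?A" using finN by simp
  next
    fix a and p :: "('v set set, 'k) mpolynomial" and m :: "'v set set \<Rightarrow>\<^sub>0 nat"
    assume a: "a \<in> ?A" and p: "p \<in> Idl\<^bsub>mp_ring ?X\<^esub> (set fs)" and m: "keys m \<subseteq> ?X" "m \<noteq> 0"
    have p': "p \<in> carrier (mp_ring ?X)" "lin (cut_weight G) p = 0"
      using p unfolding I[symmetric] by (auto simp: cut_ideal_eq)
    have m1: "size (ms m) \<noteq> 0" using m(2) by simp
    \<comment> \<open>A functional that is nonzero at \<open>m + u\<close> is \<open>1\<close> along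
      the fibre of \<open>u\<close>. In the linear case the degree forces \<open>u = 0\<close>.
      Otherwise \<open>m\<close> is nonconstant, so the cuts of \<open>u\<close> form a proper part
      of \<open>Q\<close>, and isolation fixes the cuts of \<open>u'\<close>.\<close>
    have imp: "\<omega> a (m + u') = 1" if u: "u' \<in> keys p" "cut_weight G u = cut_weight G u'" "\<omega> a (m + u) \<noteq> 0" for u u'
    proof (cases a)
      case (Inl P)
      then have mu: "m + u = single P 1" using u(3) by (auto simp: \<omega>_def split: if_splits)
      have "size (ms m) + size (ms u) = 1"
        using arg_cong[OF mu, of "\<lambda>m. size (ms m)"] by simp
      then have "size (ms u) = 0" using m1 by linarith
      then have "size (ms u') = 0" using u(2) w_iff size_\<kappa> unfolding similar_def by metis
      with \<open>size (ms u) = 0\<close> have "u = 0" "u' = 0" by auto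
      then show ?thesis using mu Inl by (simp add: \<omega>_def)
    next
      case (Inr Q)
      then have Q: "\<kappa> m + \<kappa> u = Q" "Q \<in> S" using u(3) a by (auto simp: \<omega>_def \<kappa>_add M_def split: if_splits)
      have "\<kappa> m \<noteq> {#}" using m1 size_\<kappa>[of m] by auto
      then have "\<kappa> u \<subset># Q" unfolding Q(1)[symmetric] by (simp add: subset_mset_def)
      moreover have "set_mset (\<kappa> u') \<subseteq> cuts G"
        using u(1) p'(1) by (auto simp: \<kappa>_def cuts_def mp_ring_simps(1))
      ultimately have "\<kappa> u = \<kappa> u'" using S(2)[OF Q(2)] u(2) w_iff unfolding isolated_def by blast
      then show ?thesis using Q(1) Inr by (simp add: \<omega>_def \<kappa>_add)
    qed
    have 01: "\<omega> a x = 0 \<or> \<omega> a x = 1" for x by (auto simp: \<omega>_def split: sum.split)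
    show "pair (\<lambda>u. \<omega> a (m + u)) p = 0"
    proof (rule pair_fibre_constant[OF p'(2)])
      fix u u' assume "u \<in> keys p" "u' \<in> keys p" "cut_weight G u = cut_weight G u'"
      then show "\<omega> a (m + u) = \<omega> a (m + u')" using imp[of u u'] imp[of u' u] 01 by metis
    qed
  next
    fix a assume a: "a \<in> ?A"
    show "g a \<in> Idl\<^bsub>mp_ring ?X\<^esub> (set fs)"
    proof (cases a)
      case (Inl P)
      then have P: "P \<in> ?X" using a by (auto simp: N_def)
      then have C: "Cut G P \<in> cuts G" by (auto simp: cuts_def)
      have "\<kappa> (single P 1) = \<kappa> (single (\<sigma> (Cut G P)) 1)" using \<sigma>(2)[OF C] by (simp only: \<kappa>_def ms_single) simp
      then have "single (single P 1) 1 - single (single (\<sigma> (Cut G P)) 1) 1 \<in> (cut_ideal G :: (_, 'k) mpolynomial set)"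
        using P \<sigma>(1)[OF C] by (intro bin_mem) (simp_all add: similar_refl)
      then show ?thesis unfolding I[symmetric] by (simp add: g_def Inl)
    next
      case (Inr Q)
      then have "Q \<in> S" using a by (auto simp: M_def)
      then have "single (lift Q) 1 - single (lift (\<rho> Q)) 1 \<in> (cut_ideal G :: (_, 'k) mpolynomial set)"
        using \<rho> by (intro bin_mem lift_keys) (auto simp: \<kappa>_lift)
      then show ?thesis unfolding I[symmetric] by (simp add: g_def Inr)
    qed
  next
    fix a b assume a: "a \<in> ?A" and b: "b \<in> ?A"
    have lift_single: "lift Q \<noteq> single P 1" if "Q \<in> S" for Q P
    proof
      assume "lift Q = single P 1"
      then have "size (ms (lift Q)) = 1" by (simp only: ms_single) simp
      then show False using S(2)[OF that] by (simp add: lift_def)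
    qed
    have \<kappa>_single: "\<kappa> (single P 1) \<noteq> Q" if "Q \<in> S" for Q P
    proof
      assume "\<kappa> (single P 1) = Q"
      then have "size Q = 1" by (auto simp only: \<kappa>_def ms_single size_image_mset) simp
      then show False using S(2)[OF that] by simp
    qed
    show "pair (\<omega> a) (g b) = (if a = b then 1 else 0)"
    proof (cases b)
      case b: (Inl P)
      then have P: "P \<in> ?X" "\<sigma> (Cut G P) \<noteq> P" using \<open>b \<in> ?A\<close> by (auto simp: N_def)
      show ?thesis
      proof (cases a)
        case (Inl P')
        have "\<sigma> (Cut G P) \<noteq> P'"
        proof
          assume eq: "\<sigma> (Cut G P) = P'"
          have "Cut G P \<in> cuts G" using P(1) by (auto simp: cuts_def)
          then have "Cut G P' = Cut G P" using \<sigma>(2) eq by metis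
          then have "\<sigma> (Cut G P') = P'" using eq by simp
          then show False using a Inl by (auto simp: N_def)
        qed
        with P(2) show ?thesis by (simp add: b Inl g_def \<omega>_def pair_diff eq_commute[of P])
      next
        case (Inr Q)
        then have "Q \<in> S" using a by (auto simp: M_def)
        then show ?thesis using \<kappa>_single[of Q] by (simp add: b Inr g_def \<omega>_def pair_diff)
      qed
    next
      case b: (Inr Q)
      then have Q: "Q \<in> S" "\<rho> Q \<in> S" using \<open>b \<in> ?A\<close> \<rho> by (auto simp: M_def)
      show ?thesis
      proof (cases a)
        case (Inl P')
        then show ?thesis using lift_single[OF Q(1), of P'] lift_single[OF Q(2), of P']
          by (simp add: b g_def \<omega>_def pair_diff)
      next
        case (Inr Q')
        then have "\<rho> Q \<noteq> Q'" using a Q(1) by (auto simp: M_def)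
        then show ?thesis by (auto simp: b Inr g_def \<omega>_def pair_diff \<kappa>_lift Q)
      qed
    qed
  qed
  moreover have "card ?A = card N + card M"
    using finN by (subst card_Un_disjoint) (auto simp: card_image)
  ultimately show ?thesis using card_N card_S by (simp add: M_def)
qed

text \<open>The lower bound for the number of generators meets the upper bound from the dimension,
  and the number of partitions cancels.\<close>

lemma complete_intersection_isolated_bound:
  assumes G: "simple_graph G" and ne: "edges G \<noteq> {}"
    and ci: "complete_intersection (partitions G) (cut_ideal G :: (_, 'k::field) mpolynomial set)"
    and S: "finite S" "\<And>Q. Q \<in> S \<Longrightarrow> set_mset Q \<subseteq> cuts G \<and> 2 \<le> size Q \<and> isolated G Q"
    and r: "\<And>Q. Q \<in> S \<Longrightarrow> r Q \<in> S \<and> r Q \<noteq> Q \<and> similar (edges G) Q (r Q)"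
  shows "card S + 2 * card (edges G) + 2 \<le> 2 * card (cuts G)"
proof -
  obtain fs :: "('a set set, 'k) mpolynomial list" where fs: "regular_sequence (mp_ring (partitions G)) fs"
    "cut_ideal G = Idl\<^bsub>mp_ring (partitions G)\<^esub> (set fs)"
    using ci unfolding complete_intersection_def by blast
  have "2 * card (partitions G) + card S \<le> 2 * card (cuts G) + 2 * length fs"
    using fs by (intro cut_generators_bound[OF G ne _ fs(2) S r]) (auto simp: regular_sequence_def)
  moreover have "length fs + (card (edges G) + 1) \<le> card (partitions G)"
    using cut_ideal_has_independent[OF G ne, where 'k = 'k] unfolding fs(2)
    by (rule regular_sequence_length_bound[OF finite_partitions[OF G] fs(1)])
  ultimately show ?thesis by linarith
qed

subsection \<open>Counting cosets of subgroups of the cut space\<close>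

lemma delta_subset: "delta G A \<subseteq> edges G"
  by (auto simp: delta_def)

lemma edge_sets_eqI:
  assumes "simple_graph G" "C \<subseteq> edges G" "D \<subseteq> edges G"
    and "\<And>u v. u \<noteq> v \<Longrightarrow> u \<in> verts G \<Longrightarrow> v \<in> verts G \<Longrightarrow> {u, v} \<in> edges G \<Longrightarrow> {u, v} \<in> C \<longleftrightarrow> {u, v} \<in> D"
  shows "C = D"
proof (intro Set.set_eqI)
  fix e
  show "e \<in> C \<longleftrightarrow> e \<in> D"
  proof (cases "e \<in> edges G")
    case True
    then obtain u v where "u \<noteq> v" "u \<in> verts G" "v \<in> verts G" "e = {u, v}"
      using edgeE[OF assms(1)] by metis
    with True assms(4)[of u v] show ?thesis by simp
  qed (use assms(2,3) in auto)
qed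

lemma delta_sym_diff:
  assumes "simple_graph G"
  shows "delta G (sym_diff A B) = sym_diff (delta G A) (delta G B)"
proof (rule edge_sets_eqI[OF assms delta_subset])
  show "sym_diff (delta G A) (delta G B) \<subseteq> edges G" using delta_subset[of G] by blast
  show "{u, v} \<in> delta G (sym_diff A B) \<longleftrightarrow> {u, v} \<in> sym_diff (delta G A) (delta G B)"
    if "u \<noteq> v" "{u, v} \<in> edges G" for u v
    using that by (auto simp: mem_delta)
qed

lemma delta_in_cuts: "simple_graph G \<Longrightarrow> A \<subseteq> verts G \<Longrightarrow> delta G A \<in> cuts G"
  by (simp add: cuts_eq)

lemma cutsE:
  assumes "simple_graph G" "C \<in> cuts G" obtains A where "A \<subseteq> verts G" "C = delta G A"
  using assms by (auto simp: cuts_eq)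

lemma cuts_sym_diff:
  assumes "simple_graph G" "C \<in> cuts G" "D \<in> cuts G" shows "sym_diff C D \<in> cuts G"
proof -
  obtain A where A: "A \<subseteq> verts G" "C = delta G A" using cutsE[OF assms(1,2)] .
  obtain B where B: "B \<subseteq> verts G" "D = delta G B" using cutsE[OF assms(1,3)] .
  note AB = A B
  have "delta G (sym_diff A B) \<in> cuts G" using AB by (intro delta_in_cuts[OF assms(1)]) blast
  then show ?thesis by (simp add: AB delta_sym_diff[OF assms(1)])
qed

lemma empty_in_cuts: "simple_graph G \<Longrightarrow> {} \<in> cuts G"
  using delta_in_cuts[of G "{}"] by (simp add: delta_def)

lemma cuts_subset_edges: "simple_graph G \<Longrightarrow> C \<in> cuts G \<Longrightarrow> C \<subseteq> edges G"
  by (auto elim!: cutsE simp: delta_def)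

lemma finite_cuts: "simple_graph G \<Longrightarrow> finite (cuts G)"
  by (simp add: cuts_def finite_partitions)

abbreviation translate :: "'e set \<Rightarrow> 'e set set \<Rightarrow> 'e set set" where
  "translate C Z \<equiv> (\<lambda>D. sym_diff C D) ` Z"

abbreviation mtranslate :: "'e set \<Rightarrow> 'e set multiset \<Rightarrow> 'e set multiset" where
  "mtranslate C Q \<equiv> image_mset (\<lambda>D. sym_diff C D) Q"

lemma sym_diff_cancel: "sym_diff C (sym_diff C D) = D"
  by blast

lemma sym_diff_assoc: "sym_diff C (sym_diff D E) = sym_diff (sym_diff C D) E"
  by blast

lemma inj_sym_diff: "inj_on (\<lambda>D. sym_diff C D) Z"
  by (rule inj_on_inverseI[of _ "\<lambda>D. sym_diff C D"]) (rule sym_diff_cancel)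

lemma mtranslate_mtranslate: "mtranslate C (mtranslate C Q) = Q"
  by (simp add: image_mset.compositionality o_def sym_diff_cancel)

lemma mset_set_translate: "mset_set (translate C Z) = mtranslate C (mset_set Z)"
  by (simp add: image_mset_mset_set[OF inj_sym_diff])

text \<open>Switching by \<open>C\<close> replaces the count at an edge of \<open>C\<close> by the
  size minus this count and keeps the other counts.\<close>

lemma similar_mtranslate:
  assumes "similar E Q Q'" shows "similar E (mtranslate C Q) (mtranslate C Q')"
proof -
  have "size {#D \<in># mtranslate C Q. e \<in> D#} =
      (if e \<in> C then size Q - size {#D \<in># Q. e \<in> D#} else size {#D \<in># Q. e \<in> D#})" for e and Q :: "'a set multiset"
  proof -
    have "size {#D \<in># mtranslate C Q. e \<in> D#} + (if e \<in> C then size {#D \<in># Q. e \<in> D#} else 0) =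
       (if e \<in> C then size Q else size {#D \<in># Q. e \<in> D#})"
      by (induction Q) auto
    then show ?thesis by (auto split: if_splits)
  qed
  with assms show ?thesis by (simp add: similar_def)
qed

text \<open>Switching is an involution that respects inclusion and similarity, so a violation would
  translate back to \<open>Q\<close>.\<close>

lemma isolated_mtranslate:
  assumes G: "simple_graph G" and "isolated G Q" "C \<in> cuts G" shows "isolated G (mtranslate C Q)"
  unfolding isolated_def
proof (intro allI impI)
  fix U U' assume U: "U \<subset># mtranslate C Q" "set_mset U' \<subseteq> cuts G" "similar (edges G) U U'"
  have "mtranslate C U \<subset># mtranslate C (mtranslate C Q)" by (rule image_mset_subset_mono[OF U(1)])
  then have "mtranslate C U \<subset># Q" by (simp only: mtranslate_mtranslate)
  moreover have "set_mset (mtranslate C U') \<subseteq> cuts G"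
    using U(2) cuts_sym_diff[OF G assms(3)] by auto
  ultimately have "mtranslate C U = mtranslate C U'"
    using assms(2) similar_mtranslate[OF U(3)] unfolding isolated_def by blast
  then show "U = U'" using mtranslate_mtranslate by metis
qed

definition cosets :: "'v ugraph \<Rightarrow> 'v set set set \<Rightarrow> 'v set set set set" where
  "cosets G Z = (\<lambda>C. translate C Z) ` cuts G"

lemma cosetsE:
  assumes "c \<in> cosets G Z" obtains C where "C \<in> cuts G" "c = translate C Z"
  using assms unfolding cosets_def by (rule imageE) (rule that)

text \<open>Switching by a cut maps \<open>Z\<close> to a coset of \<open>Z\<close> and preserves both isolation and the
  similarity of \<open>Z\<close> to a different coset, so every coset contributes to the minimal generators.\<close>
definition cut_shape :: "'v ugraph \<Rightarrow> 'v set set set \<Rightarrow> bool" where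
  "cut_shape G Z \<longleftrightarrow> Z \<subseteq> cuts G \<and> {} \<in> Z \<and> (\<forall>C\<in>Z. \<forall>D\<in>Z. sym_diff C D \<in> Z) \<and>
     isolated G (mset_set Z) \<and>
     (\<exists>P\<in>cuts G. P \<notin> Z \<and> similar (edges G) (mset_set Z) (mset_set (translate P Z)))"

lemma mem_translate: "x \<in> translate C Z \<longleftrightarrow> sym_diff C x \<in> Z"
proof
  assume "sym_diff C x \<in> Z"
  then have "sym_diff C (sym_diff C x) \<in> translate C Z" by (rule imageI)
  then show "x \<in> translate C Z" by (simp only: sym_diff_cancel)
next
  assume "x \<in> translate C Z"
  then obtain D where "D \<in> Z" "x = sym_diff C D" by blast
  then show "sym_diff C x \<in> Z" using sym_diff_cancel by metis
qed

lemma translate_eq_iff: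
  assumes "{} \<in> Z" "\<forall>C\<in>Z. \<forall>D\<in>Z. sym_diff C D \<in> Z" "x \<in> translate C Z"
  shows "translate C Z = translate x Z"
proof -
  have x: "sym_diff C x \<in> Z" using assms(3) by (simp only: mem_translate)
  have "sym_diff C y \<in> Z \<longleftrightarrow> sym_diff x y \<in> Z" for y
  proof -
    have "sym_diff (sym_diff C x) (sym_diff C y) = sym_diff x y"
      "sym_diff (sym_diff C x) (sym_diff x y) = sym_diff C y" by blast+
    then show ?thesis using assms(2) x by metis
  qed
  then show ?thesis by (intro Set.set_eqI) (simp only: mem_translate)
qed

text \<open>Lagrange's theorem in the group of cuts under symmetric difference.\<close>

lemma card_cosets:
  assumes G: "simple_graph G" and Z: "Z \<subseteq> cuts G" "{} \<in> Z" "\<forall>C\<in>Z. \<forall>D\<in>Z. sym_diff C D \<in> Z"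
  shows "card (cosets G Z) * card Z = card (cuts G)"
proof -
  have un: "\<Union>(cosets G Z) = cuts G"
  proof
    show "\<Union>(cosets G Z) \<subseteq> cuts G"
      using cuts_sym_diff[OF G] Z(1) by (auto simp: cosets_def)
    show "cuts G \<subseteq> \<Union>(cosets G Z)"
    proof
      fix C assume C: "C \<in> cuts G"
      have "C \<in> translate C Z" using Z(2) by (simp add: mem_translate)
      with C show "C \<in> \<Union>(cosets G Z)" by (auto simp only: cosets_def)
    qed
  qed
  have "card Z * card (cosets G Z) = card (\<Union>(cosets G Z))"
  proof (rule card_partition)
    show "finite (cosets G Z)" using finite_cuts[OF G] by (simp add: cosets_def)
    show "finite (\<Union>(cosets G Z))" unfolding un by (rule finite_cuts[OF G])
    show "card c = card Z" if "c \<in> cosets G Z" for c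
      using that card_image[OF inj_sym_diff] by (auto simp only: cosets_def)
    show "c \<inter> c' = {}" if cc: "c \<in> cosets G Z" "c' \<in> cosets G Z" "c \<noteq> c'" for c c'
    proof (rule ccontr)
      assume "c \<inter> c' \<noteq> {}"
      then obtain x where x: "x \<in> c" "x \<in> c'" by blast
      obtain C where C0: "c = translate C Z" using cosetsE[OF cc(1)] by metis
      obtain C' where "c' = translate C' Z" using cosetsE[OF cc(2)] by metis
      note C = C0 this
      have "c = translate x Z" "c' = translate x Z"
        using translate_eq_iff[OF Z(2,3), of x C] translate_eq_iff[OF Z(2,3), of x C'] x unfolding C by simp_all
      with cc(3) show False by simp
    qed
  qed
  then show ?thesis by (simp only: un mult.commute)
qed

text \<open>A coset determines its subgroup, so different subgroups contribute different
  monomials.\<close>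

lemma cosets_disjoint:
  assumes "{} \<in> Z" "\<forall>C\<in>Z. \<forall>D\<in>Z. sym_diff C D \<in> Z" "{} \<in> Z'" "\<forall>C\<in>Z'. \<forall>D\<in>Z'. sym_diff C D \<in> Z'"
    and "c \<in> cosets G Z" "c \<in> cosets G Z'"
  shows "Z = Z'"
proof -
  obtain C where C0: "c = translate C Z" using cosetsE[OF assms(5)] by metis
  obtain C' where "c = translate C' Z'" using cosetsE[OF assms(6)] by metis
  note C = C0 this
  have "C \<in> c" using assms(1) unfolding C(1) by (simp add: mem_translate)
  then have "translate C' Z' = translate C Z'"
    unfolding C(2) by (rule translate_eq_iff[OF assms(3,4)])
  then have "translate C Z = translate C Z'" by (rule trans[OF trans[OF C(1)[symmetric] C(2)]])
  then have "translate C (translate C Z) = translate C (translate C Z')" by (rule arg_cong)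
  then show ?thesis unfolding image_image by (simp only: sym_diff_cancel image_ident)
qed

text \<open>A subgroup \<open>Z\<close> has \<open>card (cuts G) / card Z\<close> cosets.
  Multiplying the previous bound by four turns this into weight \<open>2\<close> for subgroups of
  order two and weight \<open>1\<close> for those of order four.\<close>

lemma complete_intersection_shapes_bound:
  assumes G: "simple_graph G" and ne: "edges G \<noteq> {}"
    and ci: "complete_intersection (partitions G) (cut_ideal G :: (_, 'k::field) mpolynomial set)"
    and fin: "finite \<Z>" and \<Z>: "\<And>Z. Z \<in> \<Z> \<Longrightarrow> cut_shape G Z \<and> (card Z = 2 \<or> card Z = 4)"
  shows "(\<Sum>Z\<in>\<Z>. 4 div card Z) * card (cuts G) + 8 * card (edges G) + 8 \<le> 8 * card (cuts G)"
proof -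
  let ?S = "\<Union>Z\<in>\<Z>. cosets G Z"
  have finZ: "finite Z" if "Z \<in> \<Z>" for Z
  proof -
    have "Z \<subseteq> cuts G" using \<Z>[OF that] unfolding cut_shape_def by blast
    then show ?thesis by (rule finite_subset[OF _ finite_cuts[OF G]])
  qed
  have fin_S: "finite ?S" using fin finite_cuts[OF G] by (auto simp: cosets_def)
  have fin_mem: "finite c" if c: "c \<in> ?S" for c
  proof -
    obtain Z where Z: "Z \<in> \<Z>" "c \<in> cosets G Z" using c by blast
    obtain C where "c = translate C Z" using cosetsE[OF Z(2)] by metis
    then show ?thesis using finZ[OF Z(1)] by simp
  qed
  have S_E: thesis if Q: "Q \<in> mset_set ` ?S"
    and thesis: "\<And>Z C. Z \<in> \<Z> \<Longrightarrow> C \<in> cuts G \<Longrightarrow> Q = mset_set (translate C Z) \<Longrightarrow> thesis" for Q thesis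
  proof -
    obtain c where "c \<in> ?S" "Q = mset_set c" using Q by (rule imageE)
    then obtain Z where "Z \<in> \<Z>" "c \<in> cosets G Z" by blast
    obtain C where "C \<in> cuts G" "c = translate C Z" using cosetsE[OF \<open>c \<in> cosets G Z\<close>] by metis
    then show thesis using thesis[OF \<open>Z \<in> \<Z>\<close>] \<open>Q = mset_set c\<close> by simp
  qed
  have "\<exists>Q'. Q' \<in> mset_set ` ?S \<and> Q' \<noteq> Q \<and> similar (edges G) Q Q'" if Q: "Q \<in> mset_set ` ?S" for Q
  proof -
    obtain Z C where Z: "Z \<in> \<Z>" "C \<in> cuts G" "Q = mset_set (translate C Z)"
      by (rule S_E[OF Q])
    note s = \<Z>[OF Z(1), unfolded cut_shape_def]
    obtain P where P: "P \<in> cuts G" "P \<notin> Z" "similar (edges G) (mset_set Z) (mset_set (translate P Z))"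
      using s by blast
    \<comment> \<open>Switching by \<open>C\<close> carries the similarity between \<open>Z\<close>
      and its coset by \<open>P\<close> over to the coset by \<open>C\<close>.\<close>
    let ?c = "translate (sym_diff C P) Z"
    have eq: "translate C (translate P Z) = ?c"
      unfolding image_image by (rule image_cong[OF refl]) (rule sym_diff_assoc)
    have c: "?c \<in> ?S" using Z(1) cuts_sym_diff[OF G Z(2) P(1)] unfolding cosets_def by blast
    have "sym_diff C C = {}" "sym_diff (sym_diff C P) C = P" by blast+
    then have "C \<in> translate C Z" "C \<notin> ?c" using s P(2) unfolding mem_translate by simp_all
    then have "?c \<noteq> translate C Z" by blast
    moreover have "finite ?c" "finite (translate C Z)" using finZ[OF Z(1)] by auto
    ultimately have "mset_set ?c \<noteq> Q" unfolding Z(3) by (simp only: mset_set_eq_iff) simp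
    moreover have "similar (edges G) Q (mset_set ?c)"
      using similar_mtranslate[OF P(3), of C] unfolding Z(3) eq[symmetric] by (simp only: mset_set_translate)
    ultimately show ?thesis using c by blast
  qed
  then obtain r where r: "\<And>Q. Q \<in> mset_set ` ?S \<Longrightarrow> r Q \<in> mset_set ` ?S \<and> r Q \<noteq> Q \<and> similar (edges G) Q (r Q)"
    by metis
  have "card (mset_set ` ?S) + 2 * card (edges G) + 2 \<le> 2 * card (cuts G)"
  proof (rule complete_intersection_isolated_bound[OF G ne ci _ _ r])
    show "finite (mset_set ` ?S)" using fin_S by simp
    show "set_mset Q \<subseteq> cuts G \<and> 2 \<le> size Q \<and> isolated G Q" if Q: "Q \<in> mset_set ` ?S" for Q
    proof -
      obtain Z C where Z: "Z \<in> \<Z>" "C \<in> cuts G" "Q = mset_set (translate C Z)"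
        by (rule S_E[OF Q])
      note s = \<Z>[OF Z(1)]
      have "Z \<subseteq> cuts G" "isolated G (mset_set Z)" using s unfolding cut_shape_def by blast+
      then have "isolated G Q" unfolding Z(3) mset_set_translate by (intro isolated_mtranslate[OF G _ Z(2)])
      moreover have "size Q = card Z" unfolding Z(3) mset_set_translate by simp
      moreover have "set_mset Q \<subseteq> cuts G"
        using \<open>Z \<subseteq> cuts G\<close> cuts_sym_diff[OF G Z(2)] finZ[OF Z(1)] unfolding Z(3) by auto
      ultimately show ?thesis using s by auto
    qed
  qed
  moreover have "card (mset_set ` ?S) = card ?S"
    using fin_mem by (intro card_image inj_onI) (simp add: mset_set_eq_iff)
  moreover have "card ?S = (\<Sum>Z\<in>\<Z>. card (cosets G Z))"
  proof (rule card_UN_disjoint[OF fin])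
    show "\<forall>Z\<in>\<Z>. finite (cosets G Z)" using finite_cuts[OF G] by (simp add: cosets_def)
    show "\<forall>Z\<in>\<Z>. \<forall>Z'\<in>\<Z>. Z \<noteq> Z' \<longrightarrow> cosets G Z \<inter> cosets G Z' = {}"
    proof (intro ballI impI)
      fix Z Z' assume ZZ: "Z \<in> \<Z>" "Z' \<in> \<Z>" "Z \<noteq> Z'"
      then show "cosets G Z \<inter> cosets G Z' = {}"
        using \<Z>[OF ZZ(1)] \<Z>[OF ZZ(2)] cosets_disjoint[of Z Z'] unfolding cut_shape_def by blast
    qed
  qed
  moreover have "4 * card (cosets G Z) = 4 div card Z * card (cuts G)" if "Z \<in> \<Z>" for Z
  proof -
    have "card (cosets G Z) * card Z = card (cuts G)"
      using \<Z>[OF that] unfolding cut_shape_def by (intro card_cosets[OF G]) auto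
    then show ?thesis using \<Z>[OF that] by auto
  qed
  then have "4 * (\<Sum>Z\<in>\<Z>. card (cosets G Z)) = (\<Sum>Z\<in>\<Z>. 4 div card Z) * card (cuts G)"
    by (simp add: sum_distrib_left sum_distrib_right)
  ultimately show ?thesis by linarith
qed

subsection \<open>Two families of minimal generators\<close>

lemma edge_ends:
  assumes "simple_graph G" "{u, v} \<in> edges G"
  shows "u \<noteq> v" "u \<in> verts G" "v \<in> verts G"
  using edge_facts[OF assms] by auto

text \<open>A proper part has at most one member, and a single cut is determined by its edge
  counts.\<close>

lemma isolated_pair:
  assumes G: "simple_graph G" and CD: "C \<in> cuts G" "D \<in> cuts G" and ne: "edges G \<noteq> {}"
  shows "isolated G {#C, D#}"
  unfolding isolated_def
proof (intro allI impI)
  fix U U' assume U: "U \<subset># {#C, D#}" "set_mset U' \<subseteq> cuts G" "similar (edges G) U U'"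
  have "size U < 2" using mset_subset_size[OF U(1)] by simp
  then consider "size U = 0" | "size U = Suc 0" by linarith
  then show "U = U'"
  proof cases
    case 1
    then show ?thesis using U(3) by (simp add: similar_def)
  next
    case 2
    then have "size U' = Suc 0" using U(3) by (simp add: similar_def)
    with 2 obtain x y where xy: "U = {#x#}" "U' = {#y#}" by (metis size_1_singleton_mset One_nat_def)
    have "x \<in> cuts G" using U(1) xy CD mset_subset_eqD[of U "{#C, D#}" x] by (auto simp: subset_mset_def)
    then have "x \<subseteq> edges G" "y \<subseteq> edges G" using U(2) xy cuts_subset_edges[OF G] by auto
    moreover have "e \<in> x \<longleftrightarrow> e \<in> y" if "e \<in> edges G" for e
      using U(3) that by (auto simp: similar_def xy split: if_splits)
    ultimately have "x = y" by blast
    then show ?thesis by (simp add: xy)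
  qed
qed

text \<open>Behind this is the quadratic relation between the pair of the empty cut and
  \<open>D1 \<union> D2\<close> and the pair of \<open>D1\<close> and \<open>D2\<close>; the latter
  is the coset by \<open>D1\<close>.\<close>

lemma cut_shape_decomposable:
  assumes G: "simple_graph G" and D: "D1 \<in> cuts G" "D2 \<in> cuts G" "D1 \<noteq> {}" "D2 \<noteq> {}" "D1 \<inter> D2 = {}"
  shows "cut_shape G {{}, D1 \<union> D2}" "card {{}, D1 \<union> D2} = 2"
proof -
  have un: "sym_diff D1 D2 = D1 \<union> D2" "sym_diff D1 (D1 \<union> D2) = D2" using D(5) by blast+
  have D12: "D1 \<union> D2 \<in> cuts G" using cuts_sym_diff[OF G D(1,2)] un(1) by simp
  have ne: "edges G \<noteq> {}" using D(1,3) cuts_subset_edges[OF G] by blast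
  have ms: "mset_set {{}, D1 \<union> D2} = {#{}, D1 \<union> D2#}" using D(3) by simp
  have "mset_set (translate D1 {{}, D1 \<union> D2}) = {#D1, D2#}"
    unfolding mset_set_translate ms by (simp add: un(2)[simplified])
  moreover have "similar (edges G) {#{}, D1 \<union> D2#} {#D1, D2#}"
    using D(5) by (auto simp: similar_def)
  ultimately have "\<exists>P\<in>cuts G. P \<notin> {{}, D1 \<union> D2} \<and> similar (edges G) (mset_set {{}, D1 \<union> D2}) (mset_set (translate P {{}, D1 \<union> D2}))"
    using D ms by (intro bexI[of _ D1]) auto
  then show "cut_shape G {{}, D1 \<union> D2}"
    unfolding cut_shape_def ms using isolated_pair[OF G empty_in_cuts[OF G] D12 ne] D12 empty_in_cuts[OF G] by simp
  show "card {{}, D1 \<union> D2} = 2" using D(3) by simp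
qed

lemma klein_closed:
  assumes XY: "sym_diff X Y = W" "sym_diff X W = Y" "sym_diff Y W = X"
    and CD: "C \<in> {{}, X, Y, W}" "D \<in> {{}, X, Y, W}"
  shows "sym_diff C D \<in> {{}, X, Y, W}"
proof -
  have "sym_diff Y X = W" "sym_diff W X = Y" "sym_diff W Y = X"
    using XY by (simp_all add: Un_commute)
  moreover have "sym_diff S {} = S" "sym_diff {} S = S" "sym_diff S S = {}" for S :: "'a set" by auto
  ultimately show ?thesis using CD XY by (elim insertE emptyE) (simp_all only:, simp_all)
qed

section \<open>Contractions and partitions into four pairwise adjacent classes\<close>

text \<open>\<open>contraction G f\<close> says that the fibres of \<open>f\<close> induce connected subgraphs.\<close>
definition contraction :: "'v ugraph \<Rightarrow> ('v \<Rightarrow> 'l) \<Rightarrow> bool" where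
  "contraction G f \<longleftrightarrow> (\<forall>A\<subseteq>verts G. (\<forall>u v. {u, v} \<in> edges G \<longrightarrow> f u = f v \<longrightarrow> (u \<in> A \<longleftrightarrow> v \<in> A)) \<longrightarrow>
     (\<forall>u\<in>verts G. \<forall>v\<in>verts G. f u = f v \<longrightarrow> (u \<in> A \<longleftrightarrow> v \<in> A)))"

text \<open>The cut pulled back from the quotient of \<open>G\<close> by the fibres of
  \<open>f\<close>.\<close>

definition fdelta :: "'v ugraph \<Rightarrow> ('v \<Rightarrow> 'l) \<Rightarrow> 'l set \<Rightarrow> 'v set set" where
  "fdelta G f T = delta G {v \<in> verts G. f v \<in> T}"

definition adj :: "'v ugraph \<Rightarrow> ('v \<Rightarrow> 'l) \<Rightarrow> 'l \<Rightarrow> 'l \<Rightarrow> bool" where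
  "adj G f a b \<longleftrightarrow> (\<exists>u v. {u, v} \<in> edges G \<and> f u = a \<and> f v = b)"

lemma adj_sym: "adj G f a b \<longleftrightarrow> adj G f b a"
  unfolding adj_def by (metis insert_commute)

lemma mem_fdelta:
  assumes "simple_graph G"
  shows "{u, v} \<in> fdelta G f T \<longleftrightarrow> {u, v} \<in> edges G \<and> (f u \<in> T \<longleftrightarrow> f v \<notin> T)"
proof (cases "{u, v} \<in> edges G")
  case True
  then show ?thesis using edge_ends[OF assms True] by (simp add: fdelta_def mem_delta)
qed (simp add: fdelta_def delta_def)

lemma fdelta_in_cuts: "simple_graph G \<Longrightarrow> fdelta G f T \<in> cuts G"
  unfolding fdelta_def by (rule delta_in_cuts) auto

lemma fdelta_subset: "fdelta G f T \<subseteq> edges G"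
  by (auto simp: fdelta_def delta_def)

lemma fdelta_cong:
  assumes G: "simple_graph G" and "(\<forall>x\<in>f ` verts G. x \<in> S \<longleftrightarrow> x \<in> T) \<or> (\<forall>x\<in>f ` verts G. x \<in> S \<longleftrightarrow> x \<notin> T)"
  shows "fdelta G f S = fdelta G f T"
proof (rule edge_sets_eqI[OF G fdelta_subset fdelta_subset])
  fix u v assume "u \<in> verts G" "v \<in> verts G"
  then show "{u, v} \<in> fdelta G f S \<longleftrightarrow> {u, v} \<in> fdelta G f T"
    using assms(2) unfolding mem_fdelta[OF G] by blast
qed

lemma fdelta_sym_diff:
  assumes "simple_graph G"
  shows "fdelta G f (sym_diff S T) = sym_diff (fdelta G f S) (fdelta G f T)"
proof -
  have "{v \<in> verts G. f v \<in> sym_diff S T} = sym_diff {v \<in> verts G. f v \<in> S} {v \<in> verts G. f v \<in> T}" by blast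
  then show ?thesis unfolding fdelta_def by (simp only: delta_sym_diff[OF assms])
qed

text \<open>Classes are connected, so a cut without edges inside classes splits none of them and
  separates a union of classes from the rest.\<close>

lemma cut_factors:
  assumes G: "simple_graph G" and f: "contraction G f" and C: "C \<in> cuts G"
    and inner: "\<And>u v. {u, v} \<in> edges G \<Longrightarrow> f u = f v \<Longrightarrow> {u, v} \<notin> C"
  shows "\<exists>T. C = fdelta G f T"
proof -
  obtain A where A: "A \<subseteq> verts G" "C = delta G A" using cutsE[OF G C] .
  have "u \<in> A \<longleftrightarrow> v \<in> A" if "{u, v} \<in> edges G" "f u = f v" for u v
    using inner[OF that] edge_ends[OF G that(1)] that(1) A by (simp add: mem_delta)
  then have *: "\<forall>u\<in>verts G. \<forall>v\<in>verts G. f u = f v \<longrightarrow> (u \<in> A \<longleftrightarrow> v \<in> A)"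
    using f A(1) unfolding contraction_def by blast
  have "{v \<in> verts G. f v \<in> f ` A} = A"
  proof (intro Set.set_eqI)
    fix v
    show "v \<in> {v \<in> verts G. f v \<in> f ` A} \<longleftrightarrow> v \<in> A"
      using * A(1) by (simp add: image_iff) (metis subsetD)
  qed
  then have "C = fdelta G f (f ` A)" by (simp add: fdelta_def A(2))
  then show ?thesis ..
qed

context
  fixes G :: "'v ugraph" and f :: "'v \<Rightarrow> 'l" and a b c d :: 'l
  assumes G: "simple_graph G" and f: "contraction G f" and im: "f ` verts G = {a, b, c, d}"
    and dist: "distinct [a, b, c, d]"
    and adjs: "adj G f a b" "adj G f a c" "adj G f a d" "adj G f b c" "adj G f b d" "adj G f c d"
begin

private abbreviation (input) "F4 \<equiv> fdelta G f"

lemma K4_labels: "{u, v} \<in> edges G \<Longrightarrow> f u \<in> {a, b, c, d} \<and> f v \<in> {a, b, c, d}"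
  using edge_ends[OF G] im by blast

text \<open>Complementary label sets give the same cut, for instance \<open>{b, c}\<close> and
  \<open>{a, d}\<close>.\<close>

lemma K4_sum:
  "sym_diff (F4 {a, b}) (F4 {a, c}) = F4 {a, d}" "sym_diff (F4 {a, b}) (F4 {a, d}) = F4 {a, c}"
  "sym_diff (F4 {a, c}) (F4 {a, d}) = F4 {a, b}"
  "sym_diff (F4 {a}) (F4 {a, b}) = F4 {b}" "sym_diff (F4 {a}) (F4 {a, c}) = F4 {c}" "sym_diff (F4 {a}) (F4 {a, d}) = F4 {d}"
  unfolding fdelta_sym_diff[OF G, symmetric]
  using dist by (intro fdelta_cong[OF G]; simp add: im; metis)+

lemma K4_edges:
  obtains eab eac ead ebc ebd ecd where "{eab, eac, ead, ebc, ebd, ecd} \<subseteq> edges G"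
    and "\<forall>T. eab \<in> F4 T \<longleftrightarrow> (a \<in> T \<longleftrightarrow> b \<notin> T)" "\<forall>T. eac \<in> F4 T \<longleftrightarrow> (a \<in> T \<longleftrightarrow> c \<notin> T)"
      "\<forall>T. ead \<in> F4 T \<longleftrightarrow> (a \<in> T \<longleftrightarrow> d \<notin> T)" "\<forall>T. ebc \<in> F4 T \<longleftrightarrow> (b \<in> T \<longleftrightarrow> c \<notin> T)"
      "\<forall>T. ebd \<in> F4 T \<longleftrightarrow> (b \<in> T \<longleftrightarrow> d \<notin> T)" "\<forall>T. ecd \<in> F4 T \<longleftrightarrow> (c \<in> T \<longleftrightarrow> d \<notin> T)"
proof -
  have *: "\<exists>e\<in>edges G. \<forall>T. e \<in> F4 T \<longleftrightarrow> (x \<in> T \<longleftrightarrow> y \<notin> T)" if "adj G f x y" for x y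
    using that mem_fdelta[OF G] unfolding adj_def by metis
  obtain eab where ab: "eab \<in> edges G" "\<forall>T. eab \<in> F4 T \<longleftrightarrow> (a \<in> T \<longleftrightarrow> b \<notin> T)" using *[OF adjs(1)] by blast
  obtain eac where ac: "eac \<in> edges G" "\<forall>T. eac \<in> F4 T \<longleftrightarrow> (a \<in> T \<longleftrightarrow> c \<notin> T)" using *[OF adjs(2)] by blast
  obtain ead where ad: "ead \<in> edges G" "\<forall>T. ead \<in> F4 T \<longleftrightarrow> (a \<in> T \<longleftrightarrow> d \<notin> T)" using *[OF adjs(3)] by blast
  obtain ebc where bc: "ebc \<in> edges G" "\<forall>T. ebc \<in> F4 T \<longleftrightarrow> (b \<in> T \<longleftrightarrow> c \<notin> T)" using *[OF adjs(4)] by blast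
  obtain ebd where bd: "ebd \<in> edges G" "\<forall>T. ebd \<in> F4 T \<longleftrightarrow> (b \<in> T \<longleftrightarrow> d \<notin> T)" using *[OF adjs(5)] by blast
  obtain ecd where cd: "ecd \<in> edges G" "\<forall>T. ecd \<in> F4 T \<longleftrightarrow> (c \<in> T \<longleftrightarrow> d \<notin> T)" using *[OF adjs(6)] by blast
  show thesis
    by (rule that[of eab eac ead ebc ebd ecd]) (simp_all add: ab ac ad bc bd cd)
qed

text \<open>The number of cut edges among one representative edge for each of the six pairs of classes is
  \<open>4\<close> for the three balanced cuts and at most \<open>3\<close> for all others.\<close>
lemma K4_isolated_core:
  assumes V: "set_mset V \<subseteq> {F4 {a, b}, F4 {a, c}, F4 {a, d}}" and V': "set_mset V' \<subseteq> cuts G"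
    and s: "similar (edges G) V V'"
  shows "V = V'"
proof -
  obtain eab eac ead ebc ebd ecd where e: "{eab, eac, ead, ebc, ebd, ecd} \<subseteq> edges G"
    and m': "\<forall>T. eab \<in> F4 T \<longleftrightarrow> (a \<in> T \<longleftrightarrow> b \<notin> T)" "\<forall>T. eac \<in> F4 T \<longleftrightarrow> (a \<in> T \<longleftrightarrow> c \<notin> T)"
      "\<forall>T. ead \<in> F4 T \<longleftrightarrow> (a \<in> T \<longleftrightarrow> d \<notin> T)" "\<forall>T. ebc \<in> F4 T \<longleftrightarrow> (b \<in> T \<longleftrightarrow> c \<notin> T)"
      "\<forall>T. ebd \<in> F4 T \<longleftrightarrow> (b \<in> T \<longleftrightarrow> d \<notin> T)" "\<forall>T. ecd \<in> F4 T \<longleftrightarrow> (c \<in> T \<longleftrightarrow> d \<notin> T)"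
    using K4_edges .
  note m = m'[rule_format]
  have d: "a \<noteq> b" "a \<noteq> c" "a \<noteq> d" "b \<noteq> c" "b \<noteq> d" "c \<noteq> d" using dist by auto
  define h :: "'v set set \<Rightarrow> nat" where "h C = of_bool (eab \<in> C) + of_bool (eac \<in> C) + of_bool (ead \<in> C) +
    of_bool (ebc \<in> C) + of_bool (ebd \<in> C) + of_bool (ecd \<in> C)" for C
  have sum_h: "(\<Sum>C\<in>#Q. h C) = size {#C \<in># Q. eab \<in> C#} + size {#C \<in># Q. eac \<in> C#} + size {#C \<in># Q. ead \<in> C#} +
    size {#C \<in># Q. ebc \<in> C#} + size {#C \<in># Q. ebd \<in> C#} + size {#C \<in># Q. ecd \<in> C#}" for Q
    unfolding size_filter_eq_sum by (induction Q) (simp_all add: h_def)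
  have size: "size V = size V'" using s by (simp add: similar_def)
  have hs: "(\<Sum>C\<in>#V. h C) = (\<Sum>C\<in>#V'. h C)" using s e unfolding sum_h similar_def by auto
  have "h (F4 {a, b}) = 4" "h (F4 {a, c}) = 4" "h (F4 {a, d}) = 4" using d by (auto simp: h_def m)
  then have "h C = 4" if "C \<in># V" for C using V that by blast
  then have hV: "(\<Sum>C\<in>#V. h C) = 4 * size V" by (induction V) auto
  \<comment> \<open>Members of \<open>V\<close> contain no edge inside a class. By similarity
    neither do those of \<open>V'\<close>, which therefore come from label sets.\<close>
  have fac: "\<exists>T. C = F4 T" if C: "C \<in># V'" for C
  proof (rule cut_factors[OF G f])
    show "C \<in> cuts G" using C V' by blast
    show "{u, v} \<notin> C" if uv: "{u, v} \<in> edges G" "f u = f v" for u v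
    proof
      assume "{u, v} \<in> C"
      then have "{#C \<in># V'. {u, v} \<in> C#} \<noteq> {#}" using C by (auto simp: filter_mset_eq_conv)
      moreover have "{#C \<in># V. {u, v} \<in> C#} = {#}"
        using V uv(2) by (auto simp: filter_mset_eq_conv mem_fdelta[OF G])
      moreover have "size {#C \<in># V. {u, v} \<in> C#} = size {#C \<in># V'. {u, v} \<in> C#}"
        using s uv(1) unfolding similar_def by blast
      ultimately show False by (simp only: size_empty size_eq_0_iff_empty[symmetric])
    qed
  qed
  have bal: "C \<in> {F4 {a, b}, F4 {a, c}, F4 {a, d}} \<or> h C < 4" if C: "C \<in># V'" for C
  proof -
    obtain T where T: "C = F4 T" using fac[OF C] by blast
    consider "h C < 4" | "\<forall>x\<in>{a, b, c, d}. x \<in> T \<longleftrightarrow> x \<in> {a, b}" | "\<forall>x\<in>{a, b, c, d}. x \<in> T \<longleftrightarrow> x \<notin> {a, b}"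
      | "\<forall>x\<in>{a, b, c, d}. x \<in> T \<longleftrightarrow> x \<in> {a, c}" | "\<forall>x\<in>{a, b, c, d}. x \<in> T \<longleftrightarrow> x \<notin> {a, c}"
      | "\<forall>x\<in>{a, b, c, d}. x \<in> T \<longleftrightarrow> x \<in> {a, d}" | "\<forall>x\<in>{a, b, c, d}. x \<in> T \<longleftrightarrow> x \<notin> {a, d}"
      unfolding h_def T m using d
      by (cases "a \<in> T"; cases "b \<in> T"; cases "c \<in> T"; cases "d \<in> T") simp_all
    then show ?thesis
    proof cases
      case 1 then show ?thesis by simp
    next
      case 2 then have "F4 T = F4 {a, b}" by (intro fdelta_cong[OF G]) (simp add: im)
      then show ?thesis by (simp add: T)
    next
      case 3 then have "F4 T = F4 {a, b}" by (intro fdelta_cong[OF G]) (simp add: im)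
      then show ?thesis by (simp add: T)
    next
      case 4 then have "F4 T = F4 {a, c}" by (intro fdelta_cong[OF G]) (simp add: im)
      then show ?thesis by (simp add: T)
    next
      case 5 then have "F4 T = F4 {a, c}" by (intro fdelta_cong[OF G]) (simp add: im)
      then show ?thesis by (simp add: T)
    next
      case 6 then have "F4 T = F4 {a, d}" by (intro fdelta_cong[OF G]) (simp add: im)
      then show ?thesis by (simp add: T)
    next
      case 7 then have "F4 T = F4 {a, d}" by (intro fdelta_cong[OF G]) (simp add: im)
      then show ?thesis by (simp add: T)
    qed
  qed
  \<comment> \<open>On \<open>V'\<close> the values of \<open>h\<close> are at most \<open>4\<close>
    and have average \<open>4\<close>, so no member lies below.\<close>
  have V'3: "C \<in> {F4 {a, b}, F4 {a, c}, F4 {a, d}}" if C: "C \<in># V'" for C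
  proof (rule ccontr)
    assume "C \<notin> {F4 {a, b}, F4 {a, c}, F4 {a, d}}"
    with bal[OF C] have "h C < 4" by blast
    have h4: "h D \<le> 4" if "D \<in># V'" for D using bal[OF that] \<open>h (F4 {a, b}) = 4\<close> \<open>h (F4 {a, c}) = 4\<close> \<open>h (F4 {a, d}) = 4\<close> by auto
    obtain W where W: "V' = add_mset C W" using C by (metis insert_DiffM)
    have "(\<Sum>D\<in>#W. h D) \<le> (\<Sum>D\<in>#W. 4)" using h4 by (intro sum_mset_mono) (simp add: W)
    then have "(\<Sum>D\<in>#V'. h D) < 4 * size V'" using \<open>h C < 4\<close> by (simp add: W)
    then show False using hs hV size by simp
  qed
  \<comment> \<open>The edge between \<open>a\<close> and \<open>b\<close> lies in every balanced
    cut except \<open>F4 {a, b}\<close>, so counting it yields the multiplicity of that cut;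
    likewise for \<open>c\<close> and \<open>d\<close> in place of \<open>b\<close>.\<close>
  have cnt: "size {#C \<in># Q. e \<in> C#} + count Q D = size Q"
    if "set_mset Q \<subseteq> {F4 {a, b}, F4 {a, c}, F4 {a, d}}" "\<And>C. C \<in> {F4 {a, b}, F4 {a, c}, F4 {a, d}} \<Longrightarrow> e \<in> C \<longleftrightarrow> C \<noteq> D" for Q e D
    using that(1)
  proof (induction Q)
    case (add x Q)
    then show ?case using that(2)[of x] by auto
  qed simp
  have V'_sub: "set_mset V' \<subseteq> {F4 {a, b}, F4 {a, c}, F4 {a, d}}" using V'3 by blast
  have *: "count V D = count V' D" if "e \<in> edges G" "\<And>C. C \<in> {F4 {a, b}, F4 {a, c}, F4 {a, d}} \<Longrightarrow> e \<in> C \<longleftrightarrow> C \<noteq> D" for e D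
    using cnt[OF V that(2)] cnt[OF V'_sub that(2)] s that(1) size by (simp add: similar_def)
  have ne: "F4 {a, b} \<noteq> F4 {a, c}" "F4 {a, b} \<noteq> F4 {a, d}" "F4 {a, c} \<noteq> F4 {a, d}"
    using m(1)[of "{a, b}"] m(1)[of "{a, c}"] m(1)[of "{a, d}"] m(2)[of "{a, c}"] m(2)[of "{a, d}"] d by auto
  have "count V (F4 {a, b}) = count V' (F4 {a, b})"
    by (rule *[of eab]) (use e d ne in \<open>auto simp: m\<close>)
  moreover have "count V (F4 {a, c}) = count V' (F4 {a, c})"
    by (rule *[of eac]) (use e d ne in \<open>auto simp: m\<close>)
  moreover have "count V (F4 {a, d}) = count V' (F4 {a, d})"
    by (rule *[of ead]) (use e d ne in \<open>auto simp: m\<close>)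
  moreover have "count V D = 0" "count V' D = 0" if "D \<notin> {F4 {a, b}, F4 {a, c}, F4 {a, d}}" for D
    using V V'_sub that by (auto simp: count_eq_zero_iff)
  ultimately have "count V D = count V' D" for D
    by (cases "D \<in> {F4 {a, b}, F4 {a, c}, F4 {a, d}}") auto
  then show ?thesis by (rule multiset_eqI)
qed

text \<open>Behind this is the quartic relation between the empty cut with the three balanced cuts
  on one side and the four cuts that split off a single class on the other: both sides cut every
  edge between classes twice.\<close>

lemma cut_shape_K4:
  "cut_shape G {{}, F4 {a, b}, F4 {a, c}, F4 {a, d}}" (is "cut_shape G ?Z")
  "card {{}, F4 {a, b}, F4 {a, c}, F4 {a, d}} = 4"
proof -
  obtain eab eac ead ebc ebd ecd where e: "{eab, eac, ead, ebc, ebd, ecd} \<subseteq> edges G"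
    and m': "\<forall>T. eab \<in> F4 T \<longleftrightarrow> (a \<in> T \<longleftrightarrow> b \<notin> T)" "\<forall>T. eac \<in> F4 T \<longleftrightarrow> (a \<in> T \<longleftrightarrow> c \<notin> T)"
      "\<forall>T. ead \<in> F4 T \<longleftrightarrow> (a \<in> T \<longleftrightarrow> d \<notin> T)" "\<forall>T. ebc \<in> F4 T \<longleftrightarrow> (b \<in> T \<longleftrightarrow> c \<notin> T)"
      "\<forall>T. ebd \<in> F4 T \<longleftrightarrow> (b \<in> T \<longleftrightarrow> d \<notin> T)" "\<forall>T. ecd \<in> F4 T \<longleftrightarrow> (c \<in> T \<longleftrightarrow> d \<notin> T)"
    using K4_edges .
  note m = m'[rule_format]
  have d: "a \<noteq> b" "a \<noteq> c" "a \<noteq> d" "b \<noteq> c" "b \<noteq> d" "c \<noteq> d" using dist by auto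
  have ne: "F4 {a, b} \<noteq> F4 {a, c}" "F4 {a, b} \<noteq> F4 {a, d}" "F4 {a, c} \<noteq> F4 {a, d}"
    "F4 {a, b} \<noteq> {}" "F4 {a, c} \<noteq> {}" "F4 {a, d} \<noteq> {}"
    using m(1)[of "{a, b}"] m(1)[of "{a, c}"] m(1)[of "{a, d}"] m(2)[of "{a, c}"] m(2)[of "{a, b}"] m(2)[of "{a, d}"] d by auto
  then show "card ?Z = 4" by simp
  have ms: "mset_set ?Z = {#{}, F4 {a, b}, F4 {a, c}, F4 {a, d}#}" using ne by simp
  have sub: "?Z \<subseteq> cuts G" using fdelta_in_cuts[OF G] empty_in_cuts[OF G] by blast
  have closed: "sym_diff C D \<in> ?Z" if "C \<in> ?Z" "D \<in> ?Z" for C D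
    using that by (rule klein_closed[OF K4_sum(1-3)])
  have "isolated G (mset_set ?Z)"
    unfolding isolated_def
  proof (intro allI impI)
    fix U U' assume U: "U \<subset># mset_set ?Z" "set_mset U' \<subseteq> cuts G" "similar (edges G) U U'"
    have Usub: "count U z \<le> count (mset_set ?Z) z" for z
      using U(1) by (simp add: subset_mset_def subseteq_mset_def)
    have "\<exists>z. count U z \<noteq> count (mset_set ?Z) z" using U(1) by (auto simp: subset_mset_def intro: multiset_eqI)
    \<comment> \<open>A proper part of \<open>?Z\<close> misses some \<open>z\<close>. Switching by
      \<open>z\<close> preserves \<open>?Z\<close> and takes \<open>z\<close> to the empty cut, so
      the translated part consists of balanced cuts only.\<close>
    then obtain z where z: "count U z < count (mset_set ?Z) z" using Usub by (metis le_neq_implies_less)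
    then have zZ: "z \<in> ?Z" "z \<notin># U" by (auto simp: count_mset_set' not_in_iff split: if_splits)
    have USet: "set_mset U \<subseteq> ?Z" using U(1) set_mset_mono[of U "mset_set ?Z"] by (auto simp: subset_mset_def)
    have "mtranslate z U = mtranslate z U'"
    proof (rule K4_isolated_core)
      show "similar (edges G) (mtranslate z U) (mtranslate z U')" by (rule similar_mtranslate[OF U(3)])
      show "set_mset (mtranslate z U') \<subseteq> cuts G" using U(2) cuts_sym_diff[OF G, of z] zZ(1) sub by auto
      show "set_mset (mtranslate z U) \<subseteq> {F4 {a, b}, F4 {a, c}, F4 {a, d}}"
      proof
        fix D assume "D \<in># mtranslate z U"
        then obtain x where x: "x \<in># U" "D = sym_diff z x" by auto
        have "D \<in> ?Z" unfolding x(2) by (rule closed[OF zZ(1) subsetD[OF USet x(1)]])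
        moreover have "D \<noteq> {}"
        proof
          assume "D = {}"
          then have "z = x" unfolding x(2) by blast
          then show False using x(1) zZ(2) by simp
        qed
        ultimately show "D \<in> {F4 {a, b}, F4 {a, c}, F4 {a, d}}" by blast
      qed
    qed
    then show "U = U'" using mtranslate_mtranslate by metis
  qed
  moreover have "F4 {a} \<notin> ?Z"
  proof -
    have "eab \<in> F4 {a}" "eac \<in> F4 {a}" "ead \<in> F4 {a}" "eab \<notin> F4 {a, b}" "eac \<notin> F4 {a, c}" "ead \<notin> F4 {a, d}"
      using d by (simp_all add: m)
    then show ?thesis by (metis insertE emptyE)
  qed
  moreover have "similar (edges G) (mset_set ?Z) (mset_set (translate (F4 {a}) ?Z))"
  proof -
    have "mset_set (translate (F4 {a}) ?Z) = {#F4 {a}, F4 {b}, F4 {c}, F4 {d}#}"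
      unfolding mset_set_translate ms by (simp add: K4_sum(4-6)[simplified])
    moreover have "size {#C \<in># {#{}, F4 {a, b}, F4 {a, c}, F4 {a, d}#}. x \<in> C#} = size {#C \<in># {#F4 {a}, F4 {b}, F4 {c}, F4 {d}#}. x \<in> C#}"
      if x: "x \<in> edges G" for x
    proof -
      obtain u v where uv: "x = {u, v}" using edgeE[OF G x] by metis
      note l = K4_labels[OF x[unfolded uv]]
      show ?thesis using l d unfolding uv
        by (elim conjE insertE emptyE) (simp_all add: mem_fdelta[OF G] x[unfolded uv])
    qed
    ultimately show ?thesis unfolding ms similar_def by simp
  qed
  ultimately have "\<exists>P\<in>cuts G. P \<notin> ?Z \<and> similar (edges G) (mset_set ?Z) (mset_set (translate P ?Z))"
    using fdelta_in_cuts[OF G, of f "{a}"] by (intro bexI[of _ "F4 {a}"] conjI)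
  then show "cut_shape G ?Z"
    unfolding cut_shape_def using sub closed \<open>isolated G (mset_set ?Z)\<close> by (intro conjI ballI) simp_all
qed

end

subsection \<open>Connected graphs with at least five vertices\<close>

text \<open>Connectedness in the form that matches cuts: only trivial vertex sets have no edge
  leaving them.\<close>

definition cut_connected :: "'v ugraph \<Rightarrow> bool" where
  "cut_connected G \<longleftrightarrow> (\<forall>A\<subseteq>verts G. (\<forall>u v. {u, v} \<in> edges G \<longrightarrow> (u \<in> A \<longleftrightarrow> v \<in> A)) \<longrightarrow> A = {} \<or> A = verts G)"

lemma cut_connectedD:
  assumes "cut_connected G" "A \<subseteq> verts G" "A \<noteq> {}" "A \<noteq> verts G"
  obtains u v where "{u, v} \<in> edges G" "u \<in> A" "v \<notin> A"
proof -
  have "\<not> (\<forall>u v. {u, v} \<in> edges G \<longrightarrow> (u \<in> A \<longleftrightarrow> v \<in> A))"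
    using assms unfolding cut_connected_def by blast
  then obtain u v where uv: "{u, v} \<in> edges G" "(u \<in> A) \<noteq> (v \<in> A)" by blast
  show thesis
  proof (cases "u \<in> A")
    case True
    with uv that[of u v] show ?thesis by blast
  next
    case False
    with uv that[of v u] show ?thesis by (simp add: insert_commute)
  qed
qed

lemma contraction_id: "contraction G (\<lambda>v. v)"
  by (simp add: contraction_def)

lemma contraction_merge:
  assumes G: "simple_graph G" and f: "contraction G f" and ij: "adj G f i j"
  shows "contraction G (\<lambda>w. if f w = j then i else f w)" (is "contraction G ?g")
  unfolding contraction_def
proof (intro allI impI ballI)
  fix A w w'
  assume A: "A \<subseteq> verts G" "\<forall>u v. {u, v} \<in> edges G \<longrightarrow> ?g u = ?g v \<longrightarrow> (u \<in> A \<longleftrightarrow> v \<in> A)"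
    and w: "w \<in> verts G" "w' \<in> verts G" "?g w = ?g w'"
  have fib: "u \<in> A \<longleftrightarrow> v \<in> A" if "u \<in> verts G" "v \<in> verts G" "f u = f v" for u v
  proof -
    have "\<forall>u v. {u, v} \<in> edges G \<longrightarrow> f u = f v \<longrightarrow> (u \<in> A \<longleftrightarrow> v \<in> A)" using A(2) by simp
    then show ?thesis using f A(1) that unfolding contraction_def by blast
  qed
  obtain u v where uv: "{u, v} \<in> edges G" "f u = i" "f v = j" using ij unfolding adj_def by blast
  note V = edge_ends(2,3)[OF G uv(1)]
  have e: "u \<in> A \<longleftrightarrow> v \<in> A" using A(2) uv by auto
  have "w \<in> A \<longleftrightarrow> u \<in> A" if "?g w = i" "w \<in> verts G" for w
    using that fib[OF that(2) V(1)] fib[OF that(2) V(2)] e uv(2,3) by (auto split: if_splits)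
  then show "w \<in> A \<longleftrightarrow> w' \<in> A"
    using w fib[OF w(1,2)] by (cases "?g w = i") (auto split: if_splits)
qed

text \<open>Starting from the identity, two adjacent classes are merged at each step. As long as
  there are several classes, connectedness gives an edge that leaves a chosen one.\<close>

lemma contraction_exists:
  assumes G: "simple_graph G" and conn: "cut_connected G" and k: "1 \<le> k" "k \<le> card (verts G)"
  shows "\<exists>f :: 'v \<Rightarrow> 'v. contraction (G :: 'v ugraph) f \<and> card (f ` verts G) = k"
  using k(2,1)
proof (induction k rule: inc_induct)
  case base
  then show ?case using contraction_id[of G] by (intro exI[of _ "\<lambda>v. v"]) simp
next
  case (step n)
  then obtain f :: "'v \<Rightarrow> 'v" where f: "contraction G f" "card (f ` verts G) = Suc n" by auto
  have fin: "finite (f ` verts G)" using G by (simp add: simple_graph_def)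
  obtain x where x: "x \<in> f ` verts G" using f(2) by fastforce
  let ?A = "{v \<in> verts G. f v = x}"
  have A1: "?A \<noteq> {}" using x by blast
  have A2: "?A \<noteq> verts G"
  proof
    assume "?A = verts G"
    then have "f ` verts G \<subseteq> {x}" by blast
    then show False using f(2) step.prems card_mono[of "{x}" "f ` verts G"] by simp
  qed
  have A3: "?A \<subseteq> verts G" by blast
  obtain u v where "{u, v} \<in> edges G" "u \<in> ?A" "v \<notin> ?A"
    using cut_connectedD[OF conn A3 A1 A2] .
  then have uv: "{u, v} \<in> edges G" "f u = x" "f v \<noteq> x" "v \<in> verts G" "u \<in> verts G"
    using edge_ends[OF G] by auto
  let ?g = "\<lambda>w. if f w = f v then f u else f w"
  have "contraction G ?g" using uv by (intro contraction_merge[OF G f(1)]) (auto simp: adj_def)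
  moreover have "?g ` verts G = f ` verts G - {f v}" using uv by auto
  then have "card (?g ` verts G) = n" using f(2) fin uv(4) by simp
  ultimately show ?case by blast
qed

section \<open>Pulled back cuts of a connected graph\<close>

context
  fixes G :: "'v ugraph" and f :: "'v \<Rightarrow> 'l"
  assumes G: "simple_graph G" and conn: "cut_connected G" and f: "contraction G f"
begin

private abbreviation (input) "F \<equiv> fdelta G f"
private abbreviation (input) "L \<equiv> f ` verts G"

lemma fdelta_eq_empty:
  assumes "X \<subseteq> L" "F X = {}" shows "X = {} \<or> X = L"
proof -
  let ?A = "{v \<in> verts G. f v \<in> X}"
  have *: "u \<in> ?A \<longleftrightarrow> v \<in> ?A" if "{u, v} \<in> edges G" for u v
    using assms(2) mem_fdelta[OF G, of u v f X] edge_ends[OF G that] that by auto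
  have "?A = {} \<or> ?A = verts G"
  proof (rule ccontr)
    assume n: "\<not> (?A = {} \<or> ?A = verts G)"
    then have n': "?A \<subseteq> verts G" "?A \<noteq> {}" "?A \<noteq> verts G" by simp_all
    obtain u v where "{u, v} \<in> edges G" "u \<in> ?A" "v \<notin> ?A"
      using cut_connectedD[OF conn n'] .
    with *[of u v] show False by simp
  qed
  then show ?thesis using assms(1) by blast
qed

lemma fdelta_eq_fdelta:
  assumes "X \<subseteq> L" "Y \<subseteq> L" "F X = F Y" shows "X = Y \<or> X = L - Y"
proof -
  have "F (sym_diff X Y) = {}" using assms(3) by (simp add: fdelta_sym_diff[OF G])
  then have "sym_diff X Y = {} \<or> sym_diff X Y = L" using assms(1,2) by (intro fdelta_eq_empty) auto
  then show ?thesis using assms(1,2) by blast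
qed

text \<open>No edge joins \<open>X\<close> to \<open>Y\<close>, so their cuts share no edge and the
  cut of the union decomposes.\<close>

lemma cut_shape_nonadjacent:
  assumes X: "X \<subseteq> L" "Y \<subseteq> L" "X \<noteq> {}" "Y \<noteq> {}" "X \<inter> Y = {}" "X \<union> Y \<noteq> L"
    and na: "\<And>x y. x \<in> X \<Longrightarrow> y \<in> Y \<Longrightarrow> \<not> adj G f x y"
  shows "cut_shape G {{}, F (X \<union> Y)}"
proof -
  have dis: "F X \<inter> F Y = {}"
  proof (rule ccontr)
    assume "F X \<inter> F Y \<noteq> {}"
    then have "\<exists>e. e \<in> F X \<inter> F Y" unfolding ex_in_conv .
    then obtain e where "e \<in> F X \<inter> F Y" ..
    then have e: "e \<in> F X" "e \<in> F Y" by simp_all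
    then have "e \<in> edges G" using fdelta_subset by blast
    then obtain u v where uv: "e = {u, v}" using edgeE[OF G] by metis
    have "(f u \<in> X \<and> f v \<in> Y) \<or> (f v \<in> X \<and> f u \<in> Y)"
      using e X(5) unfolding uv mem_fdelta[OF G] by blast
    moreover have "adj G f (f u) (f v)" "adj G f (f v) (f u)"
      using \<open>e \<in> edges G\<close> unfolding adj_def uv by (metis insert_commute)+
    ultimately show False using na by blast
  qed
  have "sym_diff (F X) (F Y) = F X \<union> F Y" using dis by blast
  moreover have "sym_diff X Y = X \<union> Y" using X(5) by blast
  ultimately have "F (X \<union> Y) = F X \<union> F Y" using fdelta_sym_diff[OF G, of f X Y] by simp
  moreover have "F X \<noteq> {}" "F Y \<noteq> {}" using fdelta_eq_empty[of X] fdelta_eq_empty[of Y] X by blast+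
  ultimately show ?thesis
    using cut_shape_decomposable(1)[OF G fdelta_in_cuts[OF G] fdelta_in_cuts[OF G] _ _ dis] by simp
qed

definition pair_shape :: "'l set \<Rightarrow> 'v set set set" where
  "pair_shape S = {{}, F S}"

text \<open>Merging the two classes of \<open>S\<close> among five leaves four. Each balanced cut of
  these has a side consisting of two of the three classes outside \<open>S\<close>, so the Klein
  four-group can be written without the merged class.\<close>

definition triple_shape :: "'l set \<Rightarrow> 'v set set set" where
  "triple_shape S = insert {} (F ` {Y. Y \<subseteq> L - S \<and> card Y = 2})"

section \<open>Contractions onto five classes\<close>

context
  assumes card_L: "card L = 5"
begin

lemma finite_L: "finite L"
  using G by (simp add: simple_graph_def)

text \<open>Equal cuts come from equal or complementary label sets, and the complement of a pair
  among five labels has three elements.\<close>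

lemma fdelta_inj_pairs:
  assumes "X \<subseteq> L" "Y \<subseteq> L" "card X = 2" "card Y = 2" "F X = F Y" shows "X = Y"
proof (rule ccontr)
  assume "X \<noteq> Y"
  then have "X = L - Y" using fdelta_eq_fdelta assms by blast
  then have "card X = 3" using assms finite_L card_L by (simp add: card_Diff_subset finite_subset)
  with assms show False by simp
qed

lemma fdelta_pair_ne:
  assumes "X \<subseteq> L" "card X = 2" shows "F X \<noteq> {}"
  using fdelta_eq_empty[OF assms(1)] assms(2) card_L by auto

lemma pair_shape_inj: "inj_on pair_shape {S. S \<subseteq> L \<and> card S = 2}"
proof (rule inj_onI)
  fix S S' assume S: "S \<in> {S. S \<subseteq> L \<and> card S = 2}" "S' \<in> {S. S \<subseteq> L \<and> card S = 2}" "pair_shape S = pair_shape S'"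
  then have "F S = F S'" using fdelta_pair_ne[of S] unfolding pair_shape_def by blast
  then show "S = S'" using S fdelta_inj_pairs by blast
qed

text \<open>A class \<open>x\<close> of \<open>S'\<close> outside \<open>S\<close> lies in a pair
  that avoids \<open>S\<close>. This pair contributes to the shape of \<open>S\<close> but not to
  that of \<open>S'\<close>.\<close>

lemma triple_shape_inj: "inj_on triple_shape {S. S \<subseteq> L \<and> card S = 2}"
proof (rule inj_onI, rule ccontr)
  fix S S' assume S: "S \<in> {S. S \<subseteq> L \<and> card S = 2}" "S' \<in> {S. S \<subseteq> L \<and> card S = 2}"
    "triple_shape S = triple_shape S'" "S \<noteq> S'"
  have fin: "finite S" "finite S'" using S(1,2) finite_L finite_subset by blast+
  have "\<not> S' \<subseteq> S" using S(1,2,4) card_subset_eq[OF fin(1), of S'] by auto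
  then obtain x where x: "x \<in> S'" "x \<notin> S" by blast
  have "card (L - S - {x}) = 2"
  proof -
    have "card (L - S) = 3" using S(1) fin(1) card_L by (simp add: card_Diff_subset)
    moreover have "x \<in> L - S" using x S(2) by blast
    ultimately show ?thesis by simp
  qed
  then have "L - S - {x} \<noteq> {}" by (metis card.empty zero_neq_numeral)
  then obtain y where y: "y \<in> L - S - {x}" by blast
  have xy: "{x, y} \<subseteq> L - S" "card {x, y} = 2" using x y S(2) by auto
  have "F {x, y} \<in> triple_shape S"
    unfolding triple_shape_def by (rule insertI2, rule imageI) (use xy in simp)
  moreover have "F {x, y} \<noteq> {}" using xy by (intro fdelta_pair_ne) auto
  ultimately have "F {x, y} \<in> F ` {Y. Y \<subseteq> L - S' \<and> card Y = 2}"
    unfolding S(3) by (simp add: triple_shape_def)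
  then obtain Y where Y: "Y \<subseteq> L - S'" "card Y = 2" "F {x, y} = F Y"
    unfolding image_iff Bex_def by (elim exE conjE) (rule that, simp_all)
  then have "{x, y} = Y" using xy by (intro fdelta_inj_pairs) auto
  then show False using Y(1) x(1) by blast
qed

lemma card_pair_shape:
  assumes "S \<subseteq> L" "card S = 2" shows "card (pair_shape S) = 2"
  using fdelta_pair_ne[OF assms] by (simp add: pair_shape_def eq_commute[of "{}"])

lemma card_triple_shape:
  assumes "S \<subseteq> L" "card S = 2" shows "card (triple_shape S) = 4"
proof -
  let ?Y = "{Y. Y \<subseteq> L - S \<and> card Y = 2}"
  have "card (L - S) = 3" using assms finite_L card_L by (simp add: card_Diff_subset finite_subset)
  then have "card ?Y = 3" using n_subsets[of "L - S" 2] finite_L by (simp add: choose_two)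
  moreover have inj: "inj_on F ?Y"
  proof (rule inj_onI)
    fix X Y assume "X \<in> ?Y" "Y \<in> ?Y" "F X = F Y"
    then show "X = Y" by (intro fdelta_inj_pairs) auto
  qed
  moreover have "{} \<notin> F ` ?Y"
  proof
    assume "{} \<in> F ` ?Y"
    then obtain Y where "Y \<in> ?Y" "F Y = {}" unfolding image_iff by auto
    then show False using fdelta_pair_ne[of Y] by auto
  qed
  moreover have "finite (F ` ?Y)" using finite_L by (auto intro: finite_subset[of _ "Pow L"])
  ultimately show ?thesis
    unfolding triple_shape_def using card_insert_disjoint[of "F ` ?Y" "{}"] card_image[OF inj] by linarith
qed

definition pair_weight :: "'l set \<Rightarrow> nat" where
  "pair_weight S = 2 * of_bool (cut_shape G (pair_shape S)) + of_bool (cut_shape G (triple_shape S))"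

lemma pair_weight_bound:
  assumes ci: "complete_intersection (partitions G) (cut_ideal G :: (_, 'k::field) mpolynomial set)"
    and ne: "edges G \<noteq> {}"
  shows "(\<Sum>S | S \<subseteq> L \<and> card S = 2. pair_weight S) < 8"
proof -
  let ?P = "{S. S \<subseteq> L \<and> card S = 2}"
  let ?A = "{S \<in> ?P. cut_shape G (pair_shape S)}" and ?B = "{S \<in> ?P. cut_shape G (triple_shape S)}"
  have finP: "finite ?P" using finite_L by (auto intro: finite_subset[of _ "Pow L"])
  have finA: "finite ?A" by (rule finite_subset[OF _ finP]) blast
  have finB: "finite ?B" by (rule finite_subset[OF _ finP]) blast
  have "pair_shape ` ?A \<inter> triple_shape ` ?B = {}"
  proof (rule ccontr)
    assume "pair_shape ` ?A \<inter> triple_shape ` ?B \<noteq> {}"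
    then obtain S S' where "S \<in> ?A" "S' \<in> ?B" "pair_shape S = triple_shape S'" by auto
    then show False using card_pair_shape[of S] card_triple_shape[of S'] by simp
  qed
  then have "(\<Sum>Z\<in>pair_shape ` ?A \<union> triple_shape ` ?B. 4 div card Z)
      = (\<Sum>Z\<in>pair_shape ` ?A. 4 div card Z) + (\<Sum>Z\<in>triple_shape ` ?B. 4 div card Z)"
    by (intro sum.union_disjoint finite_imageI finA finB)
  also have "(\<Sum>Z\<in>pair_shape ` ?A. 4 div card Z) = (\<Sum>S\<in>?A. 2)"
    by (subst sum.reindex) (auto intro!: inj_on_subset[OF pair_shape_inj] sum.cong simp: card_pair_shape)
  also have "(\<Sum>Z\<in>triple_shape ` ?B. 4 div card Z) = (\<Sum>S\<in>?B. 1)"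
    by (subst sum.reindex) (auto intro!: inj_on_subset[OF triple_shape_inj] sum.cong simp: card_triple_shape)
  also have "(\<Sum>S\<in>?A. 2) + (\<Sum>S\<in>?B. 1) = (\<Sum>S\<in>?P. pair_weight S)"
    unfolding sum.inter_filter[OF finP] sum.distrib[symmetric]
    by (rule sum.cong) (auto simp: pair_weight_def)
  finally have w: "(\<Sum>Z\<in>pair_shape ` ?A \<union> triple_shape ` ?B. 4 div card Z) = (\<Sum>S\<in>?P. pair_weight S)" .
  have "(\<Sum>S\<in>?P. pair_weight S) * card (cuts G) + 8 * card (edges G) + 8 \<le> 8 * card (cuts G)"
    unfolding w[symmetric]
    by (rule complete_intersection_shapes_bound[OF G ne ci])
      (use finA finB card_pair_shape card_triple_shape in auto)
  then have "(\<Sum>S\<in>?P. pair_weight S) * card (cuts G) < 8 * card (cuts G)" by linarith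
  then show ?thesis by simp
qed

text \<open>The cut that separates \<open>i, j\<close> from the rest decomposes along
  \<open>{i}\<close> and \<open>{j}\<close> if these are not adjacent, or along a partition of the
  complement \<open>{k, l, m}\<close> when one class there is adjacent to neither of the other two.
  The second summand is the condition that merging \<open>i\<close> and \<open>j\<close> leaves four
  pairwise adjacent classes.\<close>

lemma pair_weight_adj:
  assumes L: "L = {i, j, k, l, m}" and dist: "distinct [i, j, k, l, m]"
  shows "2 * of_bool (\<not> adj G f i j \<or> \<not> adj G f k l \<and> \<not> adj G f k m \<or> \<not> adj G f k l \<and> \<not> adj G f l m \<or>
       \<not> adj G f k m \<and> \<not> adj G f l m) +
     of_bool (adj G f i j \<and> adj G f k l \<and> adj G f k m \<and> adj G f l m \<and> (adj G f i k \<or> adj G f j k) \<and>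
       (adj G f i l \<or> adj G f j l) \<and> (adj G f i m \<or> adj G f j m)) \<le> pair_weight {i, j}"
proof -
  have d: "i \<noteq> j" "i \<noteq> k" "i \<noteq> l" "i \<noteq> m" "j \<noteq> k" "j \<noteq> l" "j \<noteq> m" "k \<noteq> l" "k \<noteq> m" "l \<noteq> m"
    using dist by auto
  have compl: "F {i, j} = F {k, l, m}" using d by (intro fdelta_cong[OF G]) (simp add: L)
  have 1: "cut_shape G {{}, F {i, j}}" if "\<not> adj G f i j"
  proof -
    have "cut_shape G {{}, F ({i} \<union> {j})}"
    proof (rule cut_shape_nonadjacent)
      have "k \<in> L" "k \<notin> {i} \<union> {j}" using d by (auto simp: L)
      then show "{i} \<union> {j} \<noteq> L" by blast
    qed (use that d in \<open>auto simp: L\<close>)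
    then show ?thesis by (simp add: insert_commute)
  qed
  have 2: "cut_shape G {{}, F {i, j}}"
    if "{x, y, z} = {k, l, m}" "\<not> adj G f x y" "\<not> adj G f x z" "x \<noteq> y" "x \<noteq> z" for x y z
  proof -
    have "cut_shape G {{}, F ({x} \<union> {y, z})}"
    proof (rule cut_shape_nonadjacent)
      have "{x, y, z} \<subseteq> L" "i \<in> L" "i \<notin> {x, y, z}" unfolding that(1) using d by (auto simp: L)
      then show "{x} \<subseteq> L" "{y, z} \<subseteq> L" "{x} \<union> {y, z} \<noteq> L" by auto
    qed (use that in auto)
    moreover have "{x} \<union> {y, z} = {k, l, m}" unfolding insert_is_Un[symmetric] by (rule that(1))
    ultimately show ?thesis using compl by simp
  qed
  have P: "cut_shape G (pair_shape {i, j})"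
    if "\<not> adj G f i j \<or> \<not> adj G f k l \<and> \<not> adj G f k m \<or> \<not> adj G f k l \<and> \<not> adj G f l m \<or>
       \<not> adj G f k m \<and> \<not> adj G f l m"
    using that 1 2[of k l m] 2[of l k m] 2[of m k l] d adj_sym[of G f]
    unfolding pair_shape_def by (auto simp: insert_commute)
  have T: "cut_shape G (triple_shape {i, j})"
    if a: "adj G f i j" "adj G f k l" "adj G f k m" "adj G f l m" "adj G f i k \<or> adj G f j k"
       "adj G f i l \<or> adj G f j l" "adj G f i m \<or> adj G f j m"
  proof -
    let ?g = "\<lambda>w. if f w = j then i else f w"
    have "L - {i, j} = {k, l, m}" using d by (auto simp: L)
    moreover have "{Y. Y \<subseteq> {k, l, m} \<and> card Y = 2} = {{k, l}, {k, m}, {l, m}}"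
    proof -
      have "{Y. Y \<subseteq> {k, l, m} \<and> card Y = 2} = {Y \<in> Pow {k, l, m}. card Y = 2}" by blast
      also have "\<dots> = {{k, l}, {k, m}, {l, m}}" using d by (auto simp: Pow_insert)
      finally show ?thesis .
    qed
    ultimately have Z: "triple_shape {i, j} = {{}, F {k, l}, F {k, m}, F {l, m}}"
      by (simp add: triple_shape_def)
    have img: "?g ` verts G = {k, l, m, i}"
    proof -
      have "?g ` verts G = (\<lambda>x. if x = j then i else x) ` L" by (auto simp: image_iff)
      then show ?thesis using d unfolding L by auto
    qed
    have adj_g: "adj G ?g x y" if "adj G f x y" "x \<noteq> j" "y \<noteq> j" for x y
      using that unfolding adj_def by force
    have adj_gi: "adj G ?g x i" if "adj G f i x \<or> adj G f j x" "x \<noteq> j" for x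
      using that unfolding adj_def by (metis insert_commute)
    have "cut_shape G {{}, fdelta G ?g {k, l}, fdelta G ?g {k, m}, fdelta G ?g {k, i}}"
      by (rule cut_shape_K4(1)[OF G contraction_merge[OF G f a(1)] img])
        (use a d adj_g adj_gi in auto)
    moreover have "fdelta G ?g S = F {x. (if x = j then i else x) \<in> S}" for S
      unfolding fdelta_def by (rule arg_cong[of _ _ "delta G"]) auto
    \<comment> \<open>In the merged labelling \<open>{k, i}\<close> stands for the classes
      \<open>i, j, k\<close>, the complement of \<open>{l, m}\<close>.\<close>
    moreover have "F {x. (if x = j then i else x) \<in> {k, l}} = F {k, l}"
      "F {x. (if x = j then i else x) \<in> {k, m}} = F {k, m}"
      "F {x. (if x = j then i else x) \<in> {k, i}} = F {l, m}"
      by (rule fdelta_cong[OF G], unfold L, insert d, simp; blast)+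
    ultimately show ?thesis unfolding Z by simp
  qed
  show ?thesis using P T unfolding pair_weight_def of_bool_def by auto
qed

end

end

text \<open>The contribution of a pair \<open>i, j\<close> of the five classes of a contraction with remaining classes
  \<open>k, l, m\<close>, as a function of the adjacencies: \<open>2\<close> if the cut separating \<open>i, j\<close> from \<open>k, l, m\<close> is a
  disjoint union of two nonempty cuts, and \<open>1\<close> if merging \<open>i\<close> and \<open>j\<close> produces a \<open>K\<^sub>4\<close>.\<close>
definition bool_pair_weight :: "bool \<Rightarrow> bool \<Rightarrow> bool \<Rightarrow> bool \<Rightarrow> bool \<Rightarrow> bool \<Rightarrow> bool \<Rightarrow> bool \<Rightarrow> bool \<Rightarrow> bool \<Rightarrow> nat" where
  "bool_pair_weight ij kl km lm ik jk il jl im jm =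
     2 * of_bool (\<not> ij \<or> \<not> kl \<and> \<not> km \<or> \<not> kl \<and> \<not> lm \<or> \<not> km \<and> \<not> lm) +
     of_bool (ij \<and> kl \<and> km \<and> lm \<and> (ik \<or> jk) \<and> (il \<or> jl) \<and> (im \<or> jm))"

text \<open>A finite check over the 1024 graphs on five labelled vertices. Equality occurs for the
  complete graph minus an edge: the nonadjacent pair counts \<open>2\<close>, and each of the six
  pairs that meet it in one vertex counts \<open>1\<close>.\<close>

lemma bool_pair_weight_sum:
  "8 \<le> bool_pair_weight ab cd ce de ac bc ad bd ae be + bool_pair_weight ac bd be de ab bc ad cd ae ce
    + bool_pair_weight ad bc be ce ab bd ac cd ae de + bool_pair_weight ae bc bd cd ab be ac ce ad de
    + bool_pair_weight bc ad ae de ab ac bd cd be ce + bool_pair_weight bd ac ae ce ab ad bc cd be de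
    + bool_pair_weight be ac ad cd ab ae bc ce bd de + bool_pair_weight cd ab ae be ac ad bc bd ce de
    + bool_pair_weight ce ab ad bd ac ae bc be cd de + bool_pair_weight de ab ac bc ad ae bd be cd ce"
  by (cases ab; cases ac; cases ad; cases ae; cases bc; cases bd; cases be; cases cd; cases ce; cases de)
    (simp_all add: bool_pair_weight_def)

lemma not_complete_intersection_ge5:
  assumes G: "simple_graph G" and ne: "edges G \<noteq> {}"
    and ci: "complete_intersection (partitions G) (cut_ideal G :: (_, 'k::field) mpolynomial set)"
    and conn: "cut_connected G"
  shows "card (verts G) \<le> 4"
proof (rule ccontr)
  assume "\<not> card (verts G) \<le> 4"
  then obtain f :: "'a \<Rightarrow> 'a" where f: "contraction G f" and card_L: "card (f ` verts G) = 5"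
  proof -
    have "\<exists>f :: 'a \<Rightarrow> 'a. contraction G f \<and> card (f ` verts G) = 5"
      using \<open>\<not> card (verts G) \<le> 4\<close> by (intro contraction_exists[OF G conn]) simp_all
    then show ?thesis using that by (elim exE conjE)
  qed
  let ?L = "f ` verts G"
  have "finite ?L" using G by (simp add: simple_graph_def)
  obtain ls where ls: "set ls = ?L" "distinct ls" using finite_distinct_list[OF \<open>finite ?L\<close>] by (elim exE conjE)
  have "length ls = 5" using distinct_card[OF ls(2)] unfolding ls(1) card_L by (rule sym)
  then obtain a b c d e where abcde: "ls = [a, b, c, d, e]"
    by (auto simp: numeral_eq_Suc length_Suc_conv)
  have L: "?L = {a, b, c, d, e}" using ls(1) by (simp add: abcde)
  have xs: "a \<noteq> b" "a \<noteq> c" "a \<noteq> d" "a \<noteq> e" "b \<noteq> c" "b \<noteq> d" "b \<noteq> e" "c \<noteq> d" "c \<noteq> e" "d \<noteq> e"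
    using ls(2) by (auto simp: abcde)
  let ?A = "adj G f" and ?W = "pair_weight G f"
  have sym: "?A b a = ?A a b" "?A c a = ?A a c" "?A d a = ?A a d" "?A e a = ?A a e" "?A c b = ?A b c" "?A d b = ?A b d" "?A e b = ?A b e" "?A d c = ?A c d" "?A e c = ?A c e" "?A e d = ?A d e"
    by (rule adj_sym)+
  \<comment> \<open>Each of the ten estimates singles out one pair; \<open>sym\<close> brings the
    adjacencies into alphabetical order so that they fit
    \<open>bool_pair_weight_sum\<close>.\<close>
  have w0: "bool_pair_weight (?A a b) (?A c d) (?A c e) (?A d e) (?A a c) (?A b c) (?A a d) (?A b d) (?A a e) (?A b e)
      \<le> ?W {a, b}"
  proof -
    have "?L = {a, b, c, d, e}" unfolding L by blast
    moreover have "distinct [a, b, c, d, e]" using xs by simp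
    ultimately show ?thesis
      using pair_weight_adj[OF G conn f card_L, of a b c d e] unfolding bool_pair_weight_def by (simp only: sym)
  qed
  have w1: "bool_pair_weight (?A a c) (?A b d) (?A b e) (?A d e) (?A a b) (?A b c) (?A a d) (?A c d) (?A a e) (?A c e)
      \<le> ?W {a, c}"
  proof -
    have "?L = {a, c, b, d, e}" unfolding L by blast
    moreover have "distinct [a, c, b, d, e]" using xs by simp
    ultimately show ?thesis
      using pair_weight_adj[OF G conn f card_L, of a c b d e] unfolding bool_pair_weight_def by (simp only: sym)
  qed
  have w2: "bool_pair_weight (?A a d) (?A b c) (?A b e) (?A c e) (?A a b) (?A b d) (?A a c) (?A c d) (?A a e) (?A d e)
      \<le> ?W {a, d}"
  proof -
    have "?L = {a, d, b, c, e}" unfolding L by blast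
    moreover have "distinct [a, d, b, c, e]" using xs by simp
    ultimately show ?thesis
      using pair_weight_adj[OF G conn f card_L, of a d b c e] unfolding bool_pair_weight_def by (simp only: sym)
  qed
  have w3: "bool_pair_weight (?A a e) (?A b c) (?A b d) (?A c d) (?A a b) (?A b e) (?A a c) (?A c e) (?A a d) (?A d e)
      \<le> ?W {a, e}"
  proof -
    have "?L = {a, e, b, c, d}" unfolding L by blast
    moreover have "distinct [a, e, b, c, d]" using xs by simp
    ultimately show ?thesis
      using pair_weight_adj[OF G conn f card_L, of a e b c d] unfolding bool_pair_weight_def by (simp only: sym)
  qed
  have w4: "bool_pair_weight (?A b c) (?A a d) (?A a e) (?A d e) (?A a b) (?A a c) (?A b d) (?A c d) (?A b e) (?A c e)
      \<le> ?W {b, c}"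
  proof -
    have "?L = {b, c, a, d, e}" unfolding L by blast
    moreover have "distinct [b, c, a, d, e]" using xs by simp
    ultimately show ?thesis
      using pair_weight_adj[OF G conn f card_L, of b c a d e] unfolding bool_pair_weight_def by (simp only: sym)
  qed
  have w5: "bool_pair_weight (?A b d) (?A a c) (?A a e) (?A c e) (?A a b) (?A a d) (?A b c) (?A c d) (?A b e) (?A d e)
      \<le> ?W {b, d}"
  proof -
    have "?L = {b, d, a, c, e}" unfolding L by blast
    moreover have "distinct [b, d, a, c, e]" using xs by simp
    ultimately show ?thesis
      using pair_weight_adj[OF G conn f card_L, of b d a c e] unfolding bool_pair_weight_def by (simp only: sym)
  qed
  have w6: "bool_pair_weight (?A b e) (?A a c) (?A a d) (?A c d) (?A a b) (?A a e) (?A b c) (?A c e) (?A b d) (?A d e)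
      \<le> ?W {b, e}"
  proof -
    have "?L = {b, e, a, c, d}" unfolding L by blast
    moreover have "distinct [b, e, a, c, d]" using xs by simp
    ultimately show ?thesis
      using pair_weight_adj[OF G conn f card_L, of b e a c d] unfolding bool_pair_weight_def by (simp only: sym)
  qed
  have w7: "bool_pair_weight (?A c d) (?A a b) (?A a e) (?A b e) (?A a c) (?A a d) (?A b c) (?A b d) (?A c e) (?A d e)
      \<le> ?W {c, d}"
  proof -
    have "?L = {c, d, a, b, e}" unfolding L by blast
    moreover have "distinct [c, d, a, b, e]" using xs by simp
    ultimately show ?thesis
      using pair_weight_adj[OF G conn f card_L, of c d a b e] unfolding bool_pair_weight_def by (simp only: sym)
  qed
  have w8: "bool_pair_weight (?A c e) (?A a b) (?A a d) (?A b d) (?A a c) (?A a e) (?A b c) (?A b e) (?A c d) (?A d e)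
      \<le> ?W {c, e}"
  proof -
    have "?L = {c, e, a, b, d}" unfolding L by blast
    moreover have "distinct [c, e, a, b, d]" using xs by simp
    ultimately show ?thesis
      using pair_weight_adj[OF G conn f card_L, of c e a b d] unfolding bool_pair_weight_def by (simp only: sym)
  qed
  have w9: "bool_pair_weight (?A d e) (?A a b) (?A a c) (?A b c) (?A a d) (?A a e) (?A b d) (?A b e) (?A c d) (?A c e)
      \<le> ?W {d, e}"
  proof -
    have "?L = {d, e, a, b, c}" unfolding L by blast
    moreover have "distinct [d, e, a, b, c]" using xs by simp
    ultimately show ?thesis
      using pair_weight_adj[OF G conn f card_L, of d e a b c] unfolding bool_pair_weight_def by (simp only: sym)
  qed
  let ?P = "{{a, b}, {a, c}, {a, d}, {a, e}, {b, c}, {b, d}, {b, e}, {c, d}, {c, e}, {d, e}}"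
  have "?P \<subseteq> {S. S \<subseteq> ?L \<and> card S = 2}" unfolding L using xs by simp
  moreover have "finite {S. S \<subseteq> ?L \<and> card S = 2}"
    using \<open>finite ?L\<close> by (auto intro: finite_subset[of _ "Pow ?L"])
  ultimately have "(\<Sum>S\<in>?P. ?W S) \<le> (\<Sum>S | S \<subseteq> ?L \<and> card S = 2. ?W S)"
    by (intro sum_mono2) auto
  also have "\<dots> < 8" by (rule pair_weight_bound[OF G conn f card_L ci ne])
  also have "(\<Sum>S\<in>?P. ?W S) = ?W {a, b} + ?W {a, c} + ?W {a, d} + ?W {a, e} + ?W {b, c} + ?W {b, d} + ?W {b, e} + ?W {c, d} + ?W {c, e} + ?W {d, e}"
    using xs by (simp add: doubleton_eq_iff)
  finally show False
    using bool_pair_weight_sum[of "?A a b" "?A c d" "?A c e" "?A d e" "?A a c" "?A b c" "?A a d" "?A b d" "?A a e" "?A b e"]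
      w0 w1 w2 w3 w4 w5 w6 w7 w8 w9 by linarith
qed

subsection \<open>Disconnected graphs and graphs with four vertices\<close>

definition no_isolated :: "'v ugraph \<Rightarrow> bool" where
  "no_isolated G \<longleftrightarrow> (\<forall>v\<in>verts G. \<exists>x. {v, x} \<in> edges G)"

lemma edge_in_delta_vertex:
  assumes "simple_graph G" "{v, x} \<in> edges G" shows "{v, x} \<in> delta G {v}"
  using assms(2) edge_ends[OF assms] by (simp add: mem_delta)

context
  fixes G :: "'v ugraph" and A :: "'v set"
  assumes G: "simple_graph G" and iso: "no_isolated G"
    and A: "A \<subseteq> verts G" "A \<noteq> {}" "A \<noteq> verts G"
    and sep: "\<And>u v. {u, v} \<in> edges G \<Longrightarrow> u \<in> A \<longleftrightarrow> v \<in> A"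
begin

private abbreviation (input) "B \<equiv> verts G - A"

lemma sep_edges:
  assumes "e \<in> edges G" shows "e \<subseteq> A \<or> e \<subseteq> B"
proof -
  obtain u v where "u \<in> verts G" "v \<in> verts G" "e = {u, v}" using edgeE[OF G assms] by metis
  with sep[of u v] assms show ?thesis by auto
qed

lemma delta_within:
  assumes "X \<subseteq> Y" "Y = A \<or> Y = B" shows "delta G X \<subseteq> {e \<in> edges G. e \<subseteq> Y}"
proof
  fix e assume e: "e \<in> delta G X"
  then have E: "e \<in> edges G" and "e \<inter> X \<noteq> {}" by (auto simp: delta_def)
  then have "e \<inter> Y \<noteq> {}" using assms(1) by blast
  then have "e \<subseteq> Y" using sep_edges[OF E] assms(2) by blast
  with E show "e \<in> {e \<in> edges G. e \<subseteq> Y}" by blast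
qed

lemma split_disjoint: "{e \<in> edges G. e \<subseteq> A} \<inter> {e \<in> edges G. e \<subseteq> B} = {}"
proof -
  have "e \<noteq> {}" if "e \<in> edges G" for e using edge_facts(2)[OF G that] by auto
  then show ?thesis by blast
qed

definition side_cuts :: "'v set \<Rightarrow> 'v set set set" where
  "side_cuts Y = delta G ` Pow Y"

lemma side_cuts_disjoint:
  assumes "C \<in> side_cuts A" "D \<in> side_cuts B" shows "C \<inter> D = {}"
proof -
  have "C \<subseteq> {e \<in> edges G. e \<subseteq> A}" "D \<subseteq> {e \<in> edges G. e \<subseteq> B}"
    using assms delta_within[of _ A] delta_within[of _ B] unfolding side_cuts_def by blast+
  then show ?thesis using split_disjoint by blast
qed

lemma side_cuts_union_inj: "inj_on (\<lambda>(C, D). C \<union> D) (side_cuts A \<times> side_cuts B)"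
proof (rule inj_onI)
  fix x y assume xy: "x \<in> side_cuts A \<times> side_cuts B" "y \<in> side_cuts A \<times> side_cuts B"
    "(\<lambda>(C, D). C \<union> D) x = (\<lambda>(C, D). C \<union> D) y"
  obtain C D C' D' where s: "x = (C, D)" "y = (C', D')" by (metis surj_pair)
  have m: "C \<in> side_cuts A" "D \<in> side_cuts B" "C' \<in> side_cuts A" "D' \<in> side_cuts B" and u: "C \<union> D = C' \<union> D'"
    using xy s by auto
  have "C \<inter> D' = {}" "C' \<inter> D = {}" using side_cuts_disjoint m by blast+
  then have "C = C'" "D = D'" using side_cuts_disjoint[OF m(1,2)] side_cuts_disjoint[OF m(3,4)] u by blast+
  then show "x = y" by (simp add: s)
qed

lemma side_cuts_cuts: "Y = A \<or> Y = B \<Longrightarrow> side_cuts Y \<subseteq> cuts G"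
  unfolding side_cuts_def cuts_eq[OF G] using A(1) by (intro image_mono Pow_mono) auto

lemma finite_side_cuts: "Y = A \<or> Y = B \<Longrightarrow> finite (side_cuts Y)"
  using finite_subset[OF side_cuts_cuts finite_cuts[OF G]] .

text \<open>No edge joins the two sides, so a cut consists of independent cuts of \<open>A\<close>
  and of \<open>B\<close>. With \<open>side_cuts_union_inj\<close> the number of cuts becomes a
  product.\<close>

lemma cuts_split: "cuts G = (\<lambda>(C, D). C \<union> D) ` (side_cuts A \<times> side_cuts B)"
proof (intro equalityI subsetI)
  fix C assume "C \<in> cuts G"
  then obtain X where X: "X \<subseteq> verts G" "C = delta G X" using cutsE[OF G] by metis
  have "sym_diff (X \<inter> A) (X \<inter> B) = X" using X(1) A(1) by blast
  then have "C = sym_diff (delta G (X \<inter> A)) (delta G (X \<inter> B))"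
    using delta_sym_diff[OF G, of "X \<inter> A" "X \<inter> B"] X(2) by simp
  moreover have m: "delta G (X \<inter> A) \<in> side_cuts A" "delta G (X \<inter> B) \<in> side_cuts B"
    by (auto simp: side_cuts_def)
  ultimately have "C = (\<lambda>(C, D). C \<union> D) (delta G (X \<inter> A), delta G (X \<inter> B))"
    using side_cuts_disjoint[OF m] by auto
  then show "C \<in> (\<lambda>(C, D). C \<union> D) ` (side_cuts A \<times> side_cuts B)"
    using m by (intro image_eqI[of _ _ "(delta G (X \<inter> A), delta G (X \<inter> B))"]) auto
next
  fix x assume "x \<in> (\<lambda>(C, D). C \<union> D) ` (side_cuts A \<times> side_cuts B)"
  then obtain C D where CD: "x = C \<union> D" "C \<in> side_cuts A" "D \<in> side_cuts B" by auto
  have "sym_diff C D = C \<union> D" using side_cuts_disjoint[OF CD(2,3)] by blast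
  then show "x \<in> cuts G"
    using cuts_sym_diff[OF G, of C D] CD side_cuts_cuts[of A] side_cuts_cuts[of B] by auto
qed

lemma card_side_cuts_ge2:
  assumes "Y = A \<or> Y = B" shows "2 \<le> card (side_cuts Y)"
proof -
  obtain v where v: "v \<in> Y" "v \<in> verts G" using A assms by blast
  then obtain x where "{v, x} \<in> edges G" using iso unfolding no_isolated_def by blast
  then have ne: "delta G {v} \<noteq> {}" using edge_in_delta_vertex[OF G] by blast
  have "{{}, delta G {v}} \<subseteq> side_cuts Y"
    using v(1) unfolding side_cuts_def by (auto simp: delta_def intro!: image_eqI[of _ _ "{}"])
  then have "card {{}, delta G {v}} \<le> card (side_cuts Y)" by (rule card_mono[OF finite_side_cuts[OF assms]])
  then show ?thesis using ne by (simp add: eq_commute[of "{}"])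
qed

text \<open>A side that is not a single edge has a third vertex besides two adjacent ones
  \<open>a\<close> and \<open>b\<close>. The stars of \<open>a\<close> and of the third vertex are
  nonempty and different; with their sum and the empty cut they make four.\<close>

lemma card_side_cuts_ge4:
  assumes Y: "Y = A \<or> Y = B" and big: "\<nexists>a b. a \<noteq> b \<and> Y = {a, b} \<and> {a, b} \<in> edges G"
  shows "4 \<le> card (side_cuts Y)"
proof -
  obtain a where a: "a \<in> Y" "a \<in> verts G" using A Y by blast
  then obtain b where ab: "{a, b} \<in> edges G" using iso unfolding no_isolated_def by blast
  note e = edge_ends[OF G ab]
  have b: "b \<in> Y" using sep[OF ab] a(1) Y e by auto
  with a big ab e(1) obtain w where w: "w \<in> Y" "w \<noteq> a" "w \<noteq> b" by blast
  then have "w \<in> verts G" using Y A by blast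
  then obtain x where wx: "{w, x} \<in> edges G" using iso unfolding no_isolated_def by blast
  let ?D = "delta G {a}" and ?E = "delta G {w}"
  have D: "{a, b} \<in> ?D" "{a, b} \<notin> ?E" "{w, x} \<in> ?E"
    using ab wx e(1) w edge_ends[OF G wx] by (simp_all add: mem_delta)
  have DE: "sym_diff ?D ?E = delta G {a, w}"
    using delta_sym_diff[OF G, of "{a}" "{w}"] w(2) by (simp add: insert_Diff_if insert_commute)
  have "distinct [{}, ?D, ?E, delta G {a, w}]" using D unfolding DE[symmetric] by auto
  then have "card {{}, ?D, ?E, delta G {a, w}} = 4" by simp
  moreover have "{{}, ?D, ?E, delta G {a, w}} \<subseteq> side_cuts Y"
    using a(1) w(1) unfolding side_cuts_def by (auto simp: delta_def intro!: image_eqI[of _ _ "{}"])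
  then have "card {{}, ?D, ?E, delta G {a, w}} \<le> card (side_cuts Y)"
    by (rule card_mono[OF finite_side_cuts[OF Y]])
  ultimately show ?thesis by simp
qed

text \<open>A union of nonempty cuts of the two sides is decomposable, and all these unions are
  different. The constant \<open>24\<close> is \<open>8 * card (edges G) + 8\<close> with the number
  of edges estimated by two, one on each side.\<close>

lemma two_sided_bound:
  assumes ci: "complete_intersection (partitions G) (cut_ideal G :: (_, 'k::field) mpolynomial set)"
  shows "2 * ((card (side_cuts A) - 1) * (card (side_cuts B) - 1)) * (card (side_cuts A) * card (side_cuts B)) + 24
    \<le> 8 * (card (side_cuts A) * card (side_cuts B))"
proof -
  let ?I = "(side_cuts A - {{}}) \<times> (side_cuts B - {{}})"
  let ?u = "\<lambda>(C, D). C \<union> D" and ?z = "\<lambda>x :: 'v set set. {{}, x}"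
  have e0: "{} \<in> side_cuts A" "{} \<in> side_cuts B"
    unfolding side_cuts_def by (auto simp: delta_def intro!: image_eqI[of _ _ "{}"])
  have inj: "inj_on (?z \<circ> ?u) ?I"
  proof (rule comp_inj_on)
    show "inj_on ?u ?I" by (rule inj_on_subset[OF side_cuts_union_inj]) auto
    show "inj_on ?z (?u ` ?I)" by (rule inj_onI) (auto simp: doubleton_eq_iff)
  qed
  have sh: "cut_shape G ((?z \<circ> ?u) i) \<and> card ((?z \<circ> ?u) i) = 2" if "i \<in> ?I" for i
  proof -
    obtain C D where CD: "i = (C, D)" "C \<in> side_cuts A" "D \<in> side_cuts B" "C \<noteq> {}" "D \<noteq> {}"
      using \<open>i \<in> ?I\<close> by (cases i) auto
    have "C \<in> cuts G" "D \<in> cuts G" using CD side_cuts_cuts[of A] side_cuts_cuts[of B] by auto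
    from cut_shape_decomposable[OF G this CD(4,5) side_cuts_disjoint[OF CD(2,3)]]
    show ?thesis by (simp add: CD(1))
  qed
  have fin: "finite ?I" using finite_side_cuts by simp
  have "(\<Sum>Z\<in>(?z \<circ> ?u) ` ?I. 4 div card Z) = (\<Sum>i\<in>?I. 2)"
    unfolding sum.reindex[OF inj] using sh by (intro sum.cong) auto
  also have "\<dots> = 2 * ((card (side_cuts A) - 1) * (card (side_cuts B) - 1))"
    using e0 finite_side_cuts by (simp add: card_cartesian_product)
  finally have S: "(\<Sum>Z\<in>(?z \<circ> ?u) ` ?I. 4 div card Z) = 2 * ((card (side_cuts A) - 1) * (card (side_cuts B) - 1))" .
  have cc: "card (cuts G) = card (side_cuts A) * card (side_cuts B)"
    unfolding cuts_split card_image[OF side_cuts_union_inj] by (simp add: card_cartesian_product)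
  have edge: "\<exists>e\<in>edges G. e \<subseteq> Y" if Y: "Y = A \<or> Y = B" for Y
  proof -
    obtain v where v: "v \<in> Y" "v \<in> verts G" using A Y by blast
    then obtain x where x: "{v, x} \<in> edges G" using iso unfolding no_isolated_def by blast
    then have "{v, x} \<subseteq> Y" using sep_edges[OF x] v Y by blast
    with x show ?thesis by blast
  qed
  obtain e1 e2 where e12: "e1 \<in> edges G" "e1 \<subseteq> A" "e2 \<in> edges G" "e2 \<subseteq> B" using edge[of A] edge[of B] by blast
  then have "e1 \<noteq> e2" using split_disjoint by blast
  then have "2 = card {e1, e2}" by simp
  also have "\<dots> \<le> card (edges G)" using e12 by (intro card_mono finite_edges[OF G]) auto
  finally have E: "2 \<le> card (edges G)" .
  have ne: "edges G \<noteq> {}" using e12 by blast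
  have "(\<Sum>Z\<in>(?z \<circ> ?u) ` ?I. 4 div card Z) * card (cuts G) + 8 * card (edges G) + 8 \<le> 8 * card (cuts G)"
    by (rule complete_intersection_shapes_bound[OF G ne ci]) (use fin sh in auto)
  then show ?thesis unfolding S cc using E by linarith
qed

lemma two_sided_arith:
  fixes p q :: nat
  assumes "2 * ((p - 1) * (q - 1)) * (p * q) + 24 \<le> 8 * (p * q)" "2 \<le> p" "2 \<le> q"
  shows "p < 4 \<and> q < 4"
proof -
  have *: "p < 4" if "2 * ((p - 1) * (q - 1)) * (p * q) + 24 \<le> 8 * (p * q)" "2 \<le> p" "2 \<le> q" for p q :: nat
  proof (rule ccontr)
    assume "\<not> p < 4"
    have "2 * ((p - 1) * (q - 1)) < 8"
    proof (rule ccontr)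
      assume "\<not> 2 * ((p - 1) * (q - 1)) < 8"
      then have "8 * (p * q) \<le> 2 * ((p - 1) * (q - 1)) * (p * q)" by (intro mult_le_mono1) simp
      with that(1) show False by linarith
    qed
    then have lt: "(p - 1) * (q - 1) < 4" by simp
    have "p - 1 \<le> (p - 1) * (q - 1)" using that(3) by (intro le_trans[OF _ mult_le_mono2[of 1 "q - 1" "p - 1"]]) simp_all
    then have p: "p = 4" using lt \<open>\<not> p < 4\<close> by linarith
    with lt that(3) have "q = 2" by simp
    \<comment> \<open>The constant term is decisive here: \<open>48 + 24\<close> exceeds
      \<open>64\<close>, while \<open>48\<close> does not.\<close>
    with p that(1) show False by (simp add: numeral_eq_Suc)
  qed
  from *[of p q] *[of q p] assms show ?thesis by (simp add: mult.commute)
qed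

lemma disconnected_two_edges:
  assumes ci: "complete_intersection (partitions G) (cut_ideal G :: (_, 'k::field) mpolynomial set)"
  shows "\<exists>a b c d. distinct [a, b, c, d] \<and> verts G = {a, b, c, d} \<and> edges G = {{a, b}, {c, d}}"
proof -
  have lt: "card (side_cuts A) < 4 \<and> card (side_cuts B) < 4"
    by (rule two_sided_arith[OF two_sided_bound[OF ci] card_side_cuts_ge2 card_side_cuts_ge2]) simp_all
  then obtain a b where ab: "a \<noteq> b" "A = {a, b}" "{a, b} \<in> edges G"
    using card_side_cuts_ge4[of A] by force
  obtain c d where cd: "c \<noteq> d" "B = {c, d}" "{c, d} \<in> edges G"
    using lt card_side_cuts_ge4[of B] by force
  have V: "verts G = {a, b, c, d}" using A(1) ab(2) cd(2) by blast
  have dist: "distinct [a, b, c, d]" using ab cd by auto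
  have "edges G = {{a, b}, {c, d}}"
  proof (intro equalityI subsetI)
    fix e assume e: "e \<in> edges G"
    then consider "e \<subseteq> {a, b}" | "e \<subseteq> {c, d}" using sep_edges[OF e] unfolding ab(2)[symmetric] cd(2)[symmetric] by blast
    then show "e \<in> {{a, b}, {c, d}}"
    proof cases
      case 1
      then have "e = {a, b}" using edge_facts(2)[OF G e] ab(1) by (intro card_subset_eq) auto
      then show ?thesis by simp
    next
      case 2
      then have "e = {c, d}" using edge_facts(2)[OF G e] cd(1) by (intro card_subset_eq) auto
      then show ?thesis by simp
    qed
  qed (use ab cd in auto)
  with V dist show ?thesis by blast
qed

end

text \<open>With \<open>u\<close> adjacent to neither \<open>v\<close> nor \<open>w\<close>, the
  cuts of \<open>{u, v}\<close>, \<open>{u, w}\<close> and \<open>{u, v, w}\<close> are decomposable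
  and have total weight \<open>6\<close>. At most eight cuts and at least two edges then contradict
  the bound, as \<open>2 * 8 < 8 * 2 + 8\<close>.\<close>

lemma four_vertices_nonadjacent:
  fixes u v w z :: 'v
  assumes G: "simple_graph G" and iso: "no_isolated G" and conn: "cut_connected G"
    and V: "verts G = {u, v, w, z}" and dist: "distinct [u, v, w, z]"
    and na: "{u, v} \<notin> edges G" "{u, w} \<notin> edges G"
    and ci: "complete_intersection (partitions G) (cut_ideal G :: (_, 'k::field) mpolynomial set)"
  shows False
proof -
  let ?f = "\<lambda>v. v :: 'v"
  have fd: "fdelta G ?f T = delta G T" if "T \<subseteq> verts G" for T
    unfolding fdelta_def using that by (intro arg_cong[of _ _ "delta G"]) auto
  have adj: "adj G ?f x y \<longleftrightarrow> {x, y} \<in> edges G" for x y by (simp add: adj_def)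
  have d: "u \<noteq> v" "u \<noteq> w" "u \<noteq> z" "v \<noteq> w" "v \<noteq> z" "w \<noteq> z" using dist by auto
  note shape = cut_shape_nonadjacent[OF G conn contraction_id, unfolded image_ident adj]
  have "cut_shape G {{}, fdelta G ?f ({u} \<union> {v})}" "cut_shape G {{}, fdelta G ?f ({u} \<union> {w})}"
    "cut_shape G {{}, fdelta G ?f ({u} \<union> {v, w})}"
    by (rule shape; use na d in \<open>auto simp: V\<close>)+
  moreover have "fdelta G ?f ({u} \<union> {v}) = delta G {u, v}" "fdelta G ?f ({u} \<union> {w}) = delta G {u, w}"
    "fdelta G ?f ({u} \<union> {v, w}) = delta G {u, v, w}"
    by (subst fd; simp add: V insert_commute)+
  ultimately have sh: "cut_shape G {{}, delta G {u, v}}" "cut_shape G {{}, delta G {u, w}}"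
    "cut_shape G {{}, delta G {u, v, w}}" by simp_all
  have ne: "delta G X \<noteq> {}" if "X \<subseteq> verts G" "X \<noteq> {}" "X \<noteq> verts G" for X
    using fdelta_eq_empty[OF G conn contraction_id, of X] fd[OF that(1)] that by auto
  have neq: "delta G X \<noteq> delta G Y" if "X \<subseteq> verts G" "Y \<subseteq> verts G" "X \<noteq> Y" "X \<noteq> verts G - Y" for X Y
    using fdelta_eq_fdelta[OF G conn contraction_id, of X Y] fd[OF that(1)] fd[OF that(2)] that by auto
  have n: "delta G {u, v} \<noteq> {}" "delta G {u, w} \<noteq> {}" "delta G {u, v, w} \<noteq> {}"
    by (rule ne; use d in \<open>auto simp: V\<close>)+
  have n': "delta G {u, v} \<noteq> delta G {u, w}" "delta G {u, v} \<noteq> delta G {u, v, w}" "delta G {u, w} \<noteq> delta G {u, v, w}"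
    by (rule neq; use d in \<open>auto simp: V\<close>)+
  have "\<exists>x. {u, x} \<in> edges G" "\<exists>y. {v, y} \<in> edges G" using iso by (simp_all add: no_isolated_def V)
  then obtain x y where xy: "{u, x} \<in> edges G" "{v, y} \<in> edges G" by (elim exE)
  let ?Z = "{{{}, delta G {u, v}}, {{}, delta G {u, w}}, {{}, delta G {u, v, w}}}"
  have "(\<Sum>Z\<in>?Z. 4 div card Z) = 6" using n n' by (simp add: doubleton_eq_iff numeral_2_eq_2[symmetric])
  moreover have "(\<Sum>Z\<in>?Z. 4 div card Z) * card (cuts G) + 8 * card (edges G) + 8 \<le> 8 * card (cuts G)"
  proof (rule complete_intersection_shapes_bound[OF G _ ci])
    show "edges G \<noteq> {}" using xy by blast
    show "cut_shape G Z \<and> (card Z = 2 \<or> card Z = 4)" if "Z \<in> ?Z" for Z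
    proof -
      have "card {{}, X} = 2" if "X \<noteq> {}" for X :: "'v set set" using that by auto
      then show ?thesis using \<open>Z \<in> ?Z\<close> sh n by (elim insertE emptyE) simp_all
    qed
  qed simp
  moreover have "card (cuts G) \<le> 8"
  proof -
    have "cuts G \<subseteq> delta G ` Pow {u, v, w}"
    proof
      fix C assume "C \<in> cuts G"
      then obtain X where X: "X \<subseteq> verts G" "C = delta G X" using cutsE[OF G] by metis
      show "C \<in> delta G ` Pow {u, v, w}"
      proof (cases "z \<in> X")
        case True
        have "fdelta G ?f X = fdelta G ?f (verts G - X)" by (rule fdelta_cong[OF G]) simp
        then have "C = delta G (verts G - X)" using fd X by simp
        moreover have "verts G - X \<subseteq> {u, v, w}" using True V by auto
        ultimately show ?thesis by blast
      next
        case False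
        then have "X \<subseteq> {u, v, w}" using X(1) V by auto
        then show ?thesis using X(2) by blast
      qed
    qed
    then have "card (cuts G) \<le> card (delta G ` Pow {u, v, w})" by (rule card_mono[rotated]) simp
    also have "\<dots> \<le> card (Pow {u, v, w})" by (rule card_image_le) simp
    also have "\<dots> = 8" using d by (simp add: card_Pow)
    finally show ?thesis .
  qed
  moreover have "2 \<le> card (edges G)"
  proof -
    have "{u, x} \<noteq> {v, y}" using na(1) d xy by (auto simp: doubleton_eq_iff insert_commute)
    then have "2 = card {{u, x}, {v, y}}" by simp
    also have "\<dots> \<le> card (edges G)" using xy by (intro card_mono finite_edges[OF G]) auto
    finally show ?thesis .
  qed
  ultimately show False by simp
qed

lemma edges_eqI:
  assumes "simple_graph G" "X \<subseteq> edges G"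
    and "\<And>u v. u \<noteq> v \<Longrightarrow> u \<in> verts G \<Longrightarrow> v \<in> verts G \<Longrightarrow> {u, v} \<in> edges G \<Longrightarrow> {u, v} \<in> X"
  shows "edges G = X"
  using assms by (intro edge_sets_eqI[OF assms(1)]) auto

theorem complete_intersection_imp_listed:
  assumes G: "simple_graph G" and iso: "no_isolated G"
    and ci: "complete_intersection (partitions G) (cut_ideal G :: (_, 'k::field) mpolynomial set)"
  shows "(\<exists>a b. distinct [a, b] \<and> verts G = {a, b} \<and> edges G = {{a, b}}) \<or>
    (\<exists>a b c. distinct [a, b, c] \<and> verts G = {a, b, c} \<and> edges G = {{a, b}, {a, c}, {b, c}}) \<or>
    (\<exists>a b c. distinct [a, b, c] \<and> verts G = {a, b, c} \<and> edges G = {{a, c}, {b, c}}) \<or>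
    (\<exists>a b c d. distinct [a, b, c, d] \<and> verts G = {a, b, c, d} \<and> edges G = {{a, b}, {c, d}}) \<or>
    (\<exists>a b c d. distinct [a, b, c, d] \<and> verts G = {a, b, c, d} \<and> edges G = {{a, b}, {b, c}, {c, d}, {a, d}}) \<or>
    (\<exists>a b c d. distinct [a, b, c, d] \<and> verts G = {a, b, c, d} \<and>
       edges G = {{a, c}, {a, d}, {b, c}, {b, d}, {c, d}}) \<or>
    (\<exists>a b c d. distinct [a, b, c, d] \<and> verts G = {a, b, c, d} \<and>
       edges G = {{a, b}, {a, c}, {a, d}, {b, c}, {b, d}, {c, d}})" (is "?K2 \<or> ?K3 \<or> ?P3 \<or> ?KK \<or> ?C4 \<or> ?K4e \<or> ?K4")
proof (cases "cut_connected G")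
  case False
  then obtain A where "A \<subseteq> verts G" "A \<noteq> {}" "A \<noteq> verts G" "\<forall>u v. {u, v} \<in> edges G \<longrightarrow> (u \<in> A \<longleftrightarrow> v \<in> A)"
    unfolding cut_connected_def by blast
  then have ?KK using disconnected_two_edges[OF G iso _ _ _ _ ci, of A] by blast
  then show ?thesis by blast
next
  case conn: True
  have nbr: "\<exists>x. {v, x} \<in> edges G \<and> x \<in> verts G \<and> x \<noteq> v" if "v \<in> verts G" for v
    using iso that edge_ends[OF G] unfolding no_isolated_def by metis
  have "verts G \<noteq> {}" using G by (simp add: simple_graph_def)
  then obtain a where a: "a \<in> verts G" by blast
  then have ne: "edges G \<noteq> {}" using nbr by blast
  have fin: "finite (verts G)" using G by (simp add: simple_graph_def)
  have "card (verts G) \<le> 4" by (rule not_complete_intersection_ge5[OF G ne ci conn])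
  moreover have "2 \<le> card (verts G)"
  proof -
    obtain x where "x \<in> verts G" "x \<noteq> a" using nbr[OF a] by blast
    then have "card {a, x} \<le> card (verts G)" using a fin by (intro card_mono) auto
    then show ?thesis using \<open>x \<noteq> a\<close> by simp
  qed
  ultimately consider "card (verts G) = 2" | "card (verts G) = 3" | "card (verts G) = 4" by linarith
  then show ?thesis
  proof cases
    case 1
    then obtain p q where pq: "verts G = {p, q}" "p \<noteq> q" unfolding card_2_iff by blast
    then have "{p, q} \<in> edges G" using nbr[of p] by auto
    then have "edges G = {{p, q}}" using pq by (intro edges_eqI[OF G]) (auto simp: insert_commute)
    then have ?K2 using pq by (intro exI[of _ p] exI[of _ q]) simp
    then show ?thesis by blast
  next
    case 2
    show ?thesis
    proof (cases "\<exists>p\<in>verts G. \<exists>q\<in>verts G. p \<noteq> q \<and> {p, q} \<notin> edges G")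
      case True
      then obtain p q where pq: "p \<in> verts G" "q \<in> verts G" "p \<noteq> q" "{p, q} \<notin> edges G" by blast
      then have "card (verts G - {p, q}) = 1" using 2 by (simp add: card_Diff_subset)
      then obtain r where r: "verts G - {p, q} = {r}" by (auto simp: card_1_singleton_iff)
      then have V: "verts G = {p, q, r}" and dist: "distinct [p, q, r]" using pq by auto
      have e: "{p, r} \<in> edges G" "{q, r} \<in> edges G"
        using nbr[of p] nbr[of q] pq(4) V by (auto simp: insert_commute)
      have "edges G = {{p, r}, {q, r}}"
        using pq(4) e V by (intro edges_eqI[OF G]) (auto simp: insert_commute)
      with V dist have ?P3 by blast
      then show ?thesis by blast
    next
      case False
      obtain p q r where V: "verts G = {p, q, r}" and d: "p \<noteq> q" "p \<noteq> r" "q \<noteq> r"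
        using 2 unfolding card_3_iff by blast
      have "edges G = {{p, q}, {p, r}, {q, r}}"
        using False d unfolding V by (intro edges_eqI[OF G]) (auto simp: V insert_commute)
      moreover have "distinct [p, q, r]" using d by simp
      ultimately have ?K3 using V by blast
      then show ?thesis by blast
    qed
  next
    case 3
    show ?thesis
    proof (cases "\<exists>p\<in>verts G. \<exists>q\<in>verts G. p \<noteq> q \<and> {p, q} \<notin> edges G")
      case True
      then obtain p q where pq: "p \<in> verts G" "q \<in> verts G" "p \<noteq> q" "{p, q} \<notin> edges G" by blast
      then have "card (verts G - {p, q}) = 2" using 3 by (simp add: card_Diff_subset)
      then obtain r s where rs: "verts G - {p, q} = {r, s}" "r \<noteq> s" unfolding card_2_iff by blast
      then have V: "verts G = {p, q, r, s}" and d: "p \<noteq> r" "p \<noteq> s" "q \<noteq> r" "q \<noteq> s" using pq by auto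
      have V': "verts G = {p, q, s, r}" "verts G = {q, p, r, s}" "verts G = {q, p, s, r}" using V by auto
      have qp: "{q, p} \<notin> edges G" using pq(4) by (simp add: insert_commute)
      note no = four_vertices_nonadjacent[OF G iso conn _ _ _ _ ci]
      \<comment> \<open>By \<open>four_vertices_nonadjacent\<close>, applied in four orders of the
        vertices, both ends of a missing edge are joined to all other vertices. Only the edge
        between \<open>r\<close> and \<open>s\<close> remains open.\<close>
      have e: "{p, r} \<in> edges G" "{p, s} \<in> edges G" "{q, r} \<in> edges G" "{q, s} \<in> edges G"
        using no[OF V _ pq(4)] no[OF V'(1) _ pq(4)] no[OF V'(2) _ qp] no[OF V'(3) _ qp] d pq(3) rs(2) by auto
      show ?thesis
      proof (cases "{r, s} \<in> edges G")
        case True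
        have "edges G = {{p, r}, {p, s}, {q, r}, {q, s}, {r, s}}"
          using pq(4) e True V by (intro edges_eqI[OF G]) (auto simp: insert_commute)
        moreover have "distinct [p, q, r, s]" using d pq(3) rs(2) by simp
        ultimately have ?K4e using V by blast
        then show ?thesis by blast
      next
        case False
        have "edges G = {{p, r}, {r, q}, {q, s}, {p, s}}"
          using pq(4) e False V by (intro edges_eqI[OF G]) (auto simp: insert_commute)
        moreover have "distinct [p, r, q, s]" using d pq(3) rs(2) by auto
        moreover have "verts G = {p, r, q, s}" using V by auto
        ultimately have ?C4 by blast
        then show ?thesis by blast
      qed
    next
      case False
      obtain p q r s where V: "verts G = {p, q, r, s}" and d: "distinct [p, q, r, s]"
      proof -
        obtain ls where ls: "set ls = verts G" "distinct ls" using finite_distinct_list[OF fin] by (elim exE conjE)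
        have "length ls = 4" using distinct_card[OF ls(2)] unfolding ls(1) 3 by (rule sym)
        then obtain p q r s where "ls = [p, q, r, s]" by (auto simp: numeral_eq_Suc length_Suc_conv)
        with ls that[of p q r s] show thesis by simp
      qed
      have "edges G = {{p, q}, {p, r}, {p, s}, {q, r}, {q, s}, {r, s}}"
      proof (rule edges_eqI[OF G])
        show "{{p, q}, {p, r}, {p, s}, {q, r}, {q, s}, {r, s}} \<subseteq> edges G" using False d by (simp add: V)
        fix u v assume "u \<noteq> v" "u \<in> verts G" "v \<in> verts G"
        then show "{u, v} \<in> {{p, q}, {p, r}, {p, s}, {q, r}, {q, s}, {r, s}}"
          unfolding V by (elim insertE emptyE) (simp_all add: doubleton_eq_iff)
      qed
      with V d have ?K4 by blast
      then show ?thesis by blast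
    qed
  qed
qed

subsection \<open>The listed graphs\<close>

definition splits :: "'v \<times> 'v \<Rightarrow> 'v set \<Rightarrow> nat" where
  "splits e A = of_bool ((fst e \<in> A) \<noteq> (snd e \<in> A))"

text \<open>Exactly one of the two parts omits \<open>z\<close>, which turns unordered partitions
  into subsets.\<close>

lemma partitions_eq:
  assumes "z \<in> verts G"
  shows "partitions G = part G ` Pow (verts G - {z})"
proof (intro equalityI subsetI)
  fix P assume "P \<in> partitions G"
  then obtain A where A: "A \<subseteq> verts G" "P = part G A" by (rule partitionsE)
  show "P \<in> part G ` Pow (verts G - {z})"
  proof (cases "z \<in> A")
    case True
    have "P = part G (verts G - A)" using A by (simp add: double_diff insert_commute)
    then show ?thesis using True by (intro image_eqI) auto
  next
    case False
    then show ?thesis using A by auto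
  qed
next
  fix P assume "P \<in> part G ` Pow (verts G - {z})"
  then show "P \<in> partitions G" using part_in_partitions[of _ G] by blast
qed

lemma part_inj:
  assumes "z \<in> verts G" shows "inj_on (part G) (Pow (verts G - {z}))"
  using assms by (intro inj_onI) (auto simp: doubleton_eq_iff)

lemma count_filter_sum:
  assumes "finite X" "set_mset F \<subseteq> X"
  shows "size {#C \<in># image_mset f F. p C#} = (\<Sum>x\<in>X. count F x * of_bool (p (f x)))"
  using assms(2)
proof (induction F)
  case (add y F)
  have "(\<Sum>x\<in>X. count (add_mset y F) x * of_bool (p (f x)))
      = (\<Sum>x\<in>X. count F x * of_bool (p (f x)) + (if x = y then of_bool (p (f y)) else 0))"
    by (rule sum.cong) auto
  also have "\<dots> = (\<Sum>x\<in>X. count F x * of_bool (p (f x))) + of_bool (p (f y))"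
    using add.prems assms(1) by (simp add: sum.distrib)
  finally show ?case using add by simp
qed simp

lemma mset_distinct_subseteq:
  assumes "distinct xs" shows "mset xs \<subseteq># F \<longleftrightarrow> set xs \<subseteq> set_mset F"
proof -
  have "count (mset xs) a = (if a \<in> set xs then 1 else 0)" for a
    using assms distinct_count_atmost_1 by metis
  then show ?thesis by (auto simp: subseteq_mset_def Suc_le_eq count_greater_zero_iff)
qed

lemma mp_homogeneous_binomial:
  assumes "size U = size W"
  shows "mp_homogeneous (single (mon U) (1 :: 'k::comm_ring_1) - single (mon W) 1)"
proof -
  have "(\<Sum>x\<in>keys m. lookup m x) = size U"
    if m: "m \<in> keys (single (mon U) (1 :: 'k) - single (mon W) 1)" for m
  proof -
    have "m = mon U \<or> m = mon W"
      using m keys_diff[of "single (mon U) (1 :: 'k)" "single (mon W) 1"] by (auto split: if_splits)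
    then show ?thesis using assms by (auto simp: keys_mon size_multiset_overloaded_eq)
  qed
  then show ?thesis unfolding mp_homogeneous_def by blast
qed

text \<open>A partition is represented by its part without \<open>z\<close>; a pair \<open>(As, Bs)\<close> stands for the
  binomial \<open>\<Prod>\<^sub>A q\<^sub>A - \<Prod>\<^sub>B q\<^sub>B\<close>, and \<open>n\<close>, \<open>n'\<close> are exponent vectors of monomials.\<close>
lemma cut_complete_intersectionI:
  fixes G :: "'v ugraph" and qs :: "('v set list \<times> 'v set list) list"
  assumes G: "simple_graph G" and V: "verts G = insert z B" "z \<notin> B"
    and es: "edges G = (\<lambda>(i, j). {i, j}) ` set es" "es \<noteq> []"
    and qs_ball: "\<forall>(As, Bs)\<in>set qs. As \<noteq> [] \<and> distinct As \<and> length As = length Bs \<and>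
      set As \<subseteq> Pow B \<and> set Bs \<subseteq> Pow B \<and> set As \<inter> set Bs = {}"
    and bal_ball: "\<forall>(As, Bs)\<in>set qs. \<forall>e\<in>set es. sum_list (map (splits e) As) = sum_list (map (splits e) Bs)"
    and sorted: "sorted_wrt (\<lambda>(As, Bs) (As', Bs'). set As \<inter> (set As' \<union> set Bs') = {}) qs"
    and inj_ball: "\<And>n n'. \<forall>(As, Bs)\<in>set qs. (\<exists>A\<in>set As. n A = 0) \<and> (\<exists>A\<in>set As. n' A = 0) \<Longrightarrow>
      (\<Sum>A\<in>Pow B. n A) = (\<Sum>A\<in>Pow B. n' A) \<Longrightarrow>
      \<forall>e\<in>set es. (\<Sum>A\<in>Pow B. n A * splits e A) = (\<Sum>A\<in>Pow B. n' A * splits e A) \<Longrightarrow>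
      \<forall>A\<in>Pow B. n A = (n' A :: nat)"
  shows "complete_intersection (partitions G) (cut_ideal G :: (_, 'k::field) mpolynomial set)"
proof -
  have z: "z \<in> verts G" and B: "verts G - {z} = B" using V by auto
  let ?D = "Pow B"
  have qs: "As \<noteq> [] \<and> distinct As \<and> length As = length Bs \<and> set As \<subseteq> ?D \<and> set Bs \<subseteq> ?D \<and> set As \<inter> set Bs = {}"
    if "(As, Bs) \<in> set qs" for As Bs
    using bspec[OF qs_ball that] unfolding prod.case .
  have bal: "sum_list (map (splits e) As) = sum_list (map (splits e) Bs)"
    if "(As, Bs) \<in> set qs" "e \<in> set es" for As Bs e
    using bspec[OF bspec[OF bal_ball that(1), unfolded prod.case] that(2)] .
  let ?m = "\<lambda>As. mset (map (part G) As)"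
  define bs where "bs = map (\<lambda>(As, Bs). (mon (?m As), mon (?m Bs))) qs"
  have ne: "edges G \<noteq> {}" using es by simp
  have finD: "finite ?D" using G V(1) by (simp add: simple_graph_def)
  note X = partitions_eq[OF z, unfolded B] and pinj = part_inj[OF z, unfolded B]
  have im_disj: "part G ` S \<inter> part G ` T = {}" if "S \<subseteq> ?D" "T \<subseteq> ?D" "S \<inter> T = {}" for S T
    using inj_on_image_Int[OF pinj that(1,2)] that(3) by simp
  have mem_Cut: "{i, j} \<in> Cut G (part G A) \<longleftrightarrow> (i \<in> A) \<noteq> (j \<in> A)" if "(i, j) \<in> set es" "A \<in> ?D" for i j A
  proof -
    have E: "{i, j} \<in> edges G" using that(1) es by auto
    have "A \<subseteq> verts G" using that(2) V(1) by blast
    then show ?thesis using Cut_part[OF G] mem_delta[OF edge_ends(1)[OF G E]] E by simp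
  qed
  have cnt: "size {#C \<in># image_mset (Cut G) F. {i, j} \<in> C#} = (\<Sum>A\<in>?D. count F (part G A) * splits (i, j) A)"
    if "set_mset F \<subseteq> partitions G" "(i, j) \<in> set es" for F i j
  proof -
    have "size {#C \<in># image_mset (Cut G) F. {i, j} \<in> C#}
        = (\<Sum>P\<in>part G ` ?D. count F P * of_bool ({i, j} \<in> Cut G P))"
      using that(1) finD unfolding X by (intro count_filter_sum) auto
    also have "\<dots> = (\<Sum>A\<in>?D. count F (part G A) * of_bool ({i, j} \<in> Cut G (part G A)))"
      by (simp add: sum.reindex[OF pinj])
    also have "\<dots> = (\<Sum>A\<in>?D. count F (part G A) * splits (i, j) A)"
      using that(2) by (intro sum.cong) (simp_all add: mem_Cut splits_def)
    finally show ?thesis .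
  qed
  have sz: "size F = (\<Sum>A\<in>?D. count F (part G A))" if "set_mset F \<subseteq> partitions G" for F
  proof -
    have "size F = (\<Sum>P\<in>part G ` ?D. count F P)"
      using count_filter_sum[of "part G ` ?D" F "\<lambda>_. True" "\<lambda>x. x"] that finD unfolding X by simp
    then show ?thesis by (simp add: sum.reindex[OF pinj])
  qed
  show ?thesis
  proof (rule triangular_complete_intersection[where bs = bs and \<mu> = "cut_weight G"])
    show "cut_ideal G = {p \<in> carrier (mp_ring (partitions G)). lin (cut_weight G) p = (0 :: (_, 'k) mpolynomial)}"
      by (rule cut_ideal_eq)
    show "cut_weight G (a + b) = cut_weight G a + cut_weight G b" for a b by (rule cut_weight_add)
    show "triangular (partitions G) bs"
      unfolding triangular_def
    proof (intro conjI ballI)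
      fix b assume "b \<in> set bs"
      then obtain As Bs where q: "(As, Bs) \<in> set qs" "b = (mon (?m As), mon (?m Bs))" by (auto simp: bs_def)
      note q' = qs[OF q(1)]
      have "mon (?m As) \<noteq> 0"
      proof
        assume "mon (?m As) = 0"
        then have "ms (mon (?m As)) = {#}" by (simp only: ms_zero)
        then show False using q' by simp
      qed
      moreover have "keys (mon (?m As)) = part G ` set As" "keys (mon (?m Bs)) = part G ` set Bs"
        by (simp_all add: keys_mon)
      ultimately show "case b of (u, v) \<Rightarrow> u \<noteq> 0 \<and> keys u \<subseteq> partitions G \<and> keys v \<subseteq> partitions G \<and> keys u \<inter> keys v = {}"
        using q' im_disj[of "set As" "set Bs"] unfolding q(2) X by (simp add: image_mono)
    next
      show "sorted_wrt (\<lambda>(u, v) (u', v'). keys u \<inter> (keys u' \<union> keys v') = {}) bs"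
        unfolding bs_def sorted_wrt_map
      proof (rule sorted_wrt_mono_rel[OF _ sorted])
        fix x y assume xy: "x \<in> set qs" "y \<in> set qs" "(\<lambda>(As, Bs) (As', Bs'). set As \<inter> (set As' \<union> set Bs') = {}) x y"
        obtain As Bs As' Bs' where s: "x = (As, Bs)" "y = (As', Bs')" by (metis surj_pair)
        have "part G ` set As \<inter> part G ` (set As' \<union> set Bs') = {}"
          using xy qs[of As Bs] qs[of As' Bs'] unfolding s by (intro im_disj) auto
        then show "(\<lambda>(u, v) (u', v'). keys u \<inter> (keys u' \<union> keys v') = {})
          ((\<lambda>(As, Bs). (mon (?m As), mon (?m Bs))) x) ((\<lambda>(As, Bs). (mon (?m As), mon (?m Bs))) y)"
          by (simp add: s keys_mon image_Un)
      qed
    qed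
    show "mp_homogeneous (single u (1 :: 'k) - single v 1)" if uv: "(u, v) \<in> set bs" for u v
    proof -
      obtain As Bs where q: "(As, Bs) \<in> set qs" "u = mon (?m As)" "v = mon (?m Bs)"
        using uv by (auto simp: bs_def)
      have "size (?m As) = size (?m Bs)" using qs[OF q(1)] by simp
      then show ?thesis unfolding q(2,3) by (rule mp_homogeneous_binomial)
    qed
    show "cut_weight G u = cut_weight G v" if uv: "(u, v) \<in> set bs" for u v
    proof -
      obtain As Bs where q: "(As, Bs) \<in> set qs" "u = mon (?m As)" "v = mon (?m Bs)"
        using uv by (auto simp: bs_def)
      note q' = qs[OF q(1)]
      have list: "size {#C \<in># image_mset (Cut G) (?m As). {i, j} \<in> C#} = sum_list (map (splits (i, j)) As)"
        if "(i, j) \<in> set es" "set As \<subseteq> ?D" for i j As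
        using that(2) by (induction As) (auto simp: mem_Cut[OF that(1)] splits_def)
      have "size {#C \<in># image_mset (Cut G) (?m As). e \<in> C#} = size {#C \<in># image_mset (Cut G) (?m Bs). e \<in> C#}"
        if e: "e \<in> edges G" for e
      proof -
        obtain i j where ij: "(i, j) \<in> set es" "e = {i, j}" using e es by auto
        have "set As \<subseteq> ?D" "set Bs \<subseteq> ?D" using q' by blast+
        then show ?thesis using list[OF ij(1)] bal[OF q(1) ij(1)] unfolding ij(2) by simp
      qed
      moreover have "size (?m As) = size (?m Bs)" using q' by simp
      ultimately show ?thesis
        unfolding cut_weight_eq_iff[OF G ne] similar_def q(2,3) ms_mon size_image_mset by blast
    qed
    show "m = m'"
      if k: "keys m \<subseteq> partitions G" "keys m' \<subseteq> partitions G"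
        and n: "\<And>u v. (u, v) \<in> set bs \<Longrightarrow> \<not> mon_dvd u m" "\<And>u v. (u, v) \<in> set bs \<Longrightarrow> \<not> mon_dvd u m'"
        and w: "cut_weight G m = cut_weight G m'" for m m'
    proof -
      have s: "similar (edges G) (image_mset (Cut G) (ms m)) (image_mset (Cut G) (ms m'))"
        using w cut_weight_eq_iff[OF G ne] by blast
      \<comment> \<open>A product of distinct variables divides a monomial iff all of them occur in
        it, so irreducibility means that one of the exponents is zero.\<close>
      have zero: "\<exists>A\<in>set As. count (ms m) (part G A) = 0"
        if q: "(As, Bs) \<in> set qs" and nd: "\<not> mon_dvd (mon (?m As)) m" for As Bs m
      proof (rule ccontr)
        assume "\<not> (\<exists>A\<in>set As. count (ms m) (part G A) = 0)"
        then have "set (map (part G) As) \<subseteq> set_mset (ms m)" by (auto simp: in_keys_iff)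
        moreover have "distinct (map (part G) As)"
          using qs[OF q] pinj by (auto simp: distinct_map intro: inj_on_subset)
        ultimately have "?m As \<subseteq># ms m" using mset_distinct_subseteq by blast
        then have "mon_dvd (mon (?m As)) m" by (simp add: subseteq_mset_def mon_dvd_def)
        with nd show False ..
      qed
      have "\<forall>A\<in>?D. count (ms m) (part G A) = count (ms m') (part G A)"
      proof (rule inj_ball)
        have "(\<exists>A\<in>set As. count (ms m) (part G A) = 0) \<and> (\<exists>A\<in>set As. count (ms m') (part G A) = 0)"
          if q: "(As, Bs) \<in> set qs" for As Bs
        proof -
          have "(mon (?m As), mon (?m Bs)) \<in> set bs" using q by (force simp: bs_def)
          then show ?thesis using zero[OF q] n by blast
        qed
        then show "\<forall>(As, Bs)\<in>set qs. (\<exists>A\<in>set As. count (ms m) (part G A) = 0) \<and>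
          (\<exists>A\<in>set As. count (ms m') (part G A) = 0)" by (intro ballI case_prodI2) simp
        have "size (ms m) = size (ms m')" using s by (simp add: similar_def)
        then show "(\<Sum>A\<in>?D. count (ms m) (part G A)) = (\<Sum>A\<in>?D. count (ms m') (part G A))"
          using sz[of "ms m"] sz[of "ms m'"] k by simp
        show "\<forall>e\<in>set es. (\<Sum>A\<in>?D. count (ms m) (part G A) * splits e A) = (\<Sum>A\<in>?D. count (ms m') (part G A) * splits e A)"
        proof
          fix e assume es_mem: "e \<in> set es"
          obtain i j where e: "e = (i, j)" by force
          have "{i, j} \<in> edges G" using es_mem es unfolding e by auto
          then have "size {#C \<in># image_mset (Cut G) (ms m). {i, j} \<in> C#} = size {#C \<in># image_mset (Cut G) (ms m'). {i, j} \<in> C#}"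
            using s unfolding similar_def by blast
          then show "(\<Sum>A\<in>?D. count (ms m) (part G A) * splits e A) = (\<Sum>A\<in>?D. count (ms m') (part G A) * splits e A)"
            using cnt[of "ms m" i j] cnt[of "ms m'" i j] k es_mem unfolding e by simp
        qed
      qed
      then have "lookup m P = lookup m' P" if "P \<in> partitions G" for P
        using that unfolding X by auto
      moreover have "lookup m P = lookup m' P" if "P \<notin> partitions G" for P
        using that k by (metis in_keys_iff subsetD)
      ultimately show "m = m'" by (metis poly_mapping_eqI)
    qed
  qed
qed

lemma sum_Pow_insert:
  assumes "finite S" "a \<notin> S"
  shows "(\<Sum>A\<in>Pow (insert a S). f A) = (\<Sum>A\<in>Pow S. f A) + (\<Sum>A\<in>Pow S. f (insert a A) :: nat)"
proof -
  have "inj_on (insert a) (Pow S)" using assms(2) by (intro inj_onI) (metis Diff_insert_absorb PowD subsetD)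
  moreover have "Pow S \<inter> insert a ` Pow S = {}" using assms(2) by blast
  ultimately show ?thesis
    using assms(1) by (simp add: Pow_insert sum.union_disjoint sum.reindex)
qed

text \<open>The difference of the two exponents is fixed, and the smaller one is zero.\<close>

lemma zero_pair:
  fixes x y :: nat
  assumes "(x = 0 \<or> y = 0) \<and> (x' = 0 \<or> y' = 0)" "x + y' = x' + y"
  shows "x = x' \<and> y = y'"
  using assms by auto

text \<open>All differences are fixed, and the minimum of the four exponents is zero.\<close>

lemma zero_quad:
  fixes x y z w :: nat
  assumes "(x = 0 \<or> y = 0 \<or> z = 0 \<or> w = 0) \<and> (x' = 0 \<or> y' = 0 \<or> z' = 0 \<or> w' = 0)"
    "x + y' = x' + y" "x + z' = x' + z" "x + w' = x' + w"
  shows "x = x'"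
  using assms by (elim conjE disjE) linarith+

section \<open>Explicit binomials for the seven graphs\<close>

lemma distinct_subsets1: "distinct [{}, {a}]"
  by simp

lemma distinct_subsets2: "a \<noteq> b \<Longrightarrow> distinct [{}, {a}, {b}, {a, b}]"
  by auto

lemma distinct_subsets3:
  assumes "a \<noteq> b" "a \<noteq> c" "b \<noteq> c"
  shows "distinct [{}, {a}, {b}, {c}, {a, b}, {a, c}, {b, c}, {a, b, c}]"
  using assms by auto

text \<open>For this graph and for \<open>K_3\<close> the exponent equations have only one solution,
  so the cut ideal is zero and the cut algebra is a polynomial ring.\<close>

lemma complete_intersection_K2:
  assumes G: "simple_graph G" and dist: "distinct [a, b]" and V: "verts G = {a, b}"
    and E: "edges G = {{a, b}}"
  shows "complete_intersection (partitions G) (cut_ideal G :: (_, 'k::field) mpolynomial set)"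
proof (rule cut_complete_intersectionI[OF G, where z = b and B = "{a}" and es = "[(a, b)]"
      and qs = "[]"])
  have d: "a \<noteq> b" using dist by auto
  have ne: "distinct [{}, {a}]" by (rule distinct_subsets1; use d in simp)
  then have ne': "distinct (rev [{}, {a}])" by (simp only: distinct_rev)
  let ?es = "[(a, b)]" and ?qs = "[]"
  show "verts G = insert b {a}" "b \<notin> {a}" using V d by auto
  show "sorted_wrt (\<lambda>(As, Bs) (As', Bs'). set As \<inter> (set As' \<union> set Bs') = {}) ?qs"
    using ne ne' by simp
  show "\<forall>(As, Bs)\<in>set ?qs. As \<noteq> [] \<and> distinct As \<and> length As = length Bs \<and>
      set As \<subseteq> Pow {a} \<and> set Bs \<subseteq> Pow {a} \<and> set As \<inter> set Bs = {}"
    using ne ne' by simp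
  show "\<forall>(As, Bs)\<in>set ?qs. \<forall>e\<in>set ?es. sum_list (map (splits e) As) = sum_list (map (splits e) Bs)"
    using d by (simp add: splits_def)
  fix n n' :: "_ \<Rightarrow> nat"
  assume z: "\<forall>(As, Bs)\<in>set ?qs. (\<exists>A\<in>set As. n A = 0) \<and> (\<exists>A\<in>set As. n' A = 0)"
    and s: "(\<Sum>A\<in>Pow {a}. n A) = (\<Sum>A\<in>Pow {a}. n' A)"
    and e: "\<forall>e\<in>set ?es. (\<Sum>A\<in>Pow {a}. n A * splits e A) = (\<Sum>A\<in>Pow {a}. n' A * splits e A)"
  have eqs: "n {} + n {a}
      = n' {} + n' {a}"
    "n {a} = n' {a}"
    using s e d by (simp_all add: sum_Pow_insert) (simp_all add: splits_def)
  have "n {} = n' {} \<and> n {a} = n' {a}"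
    using eqs by arith
  then show "\<forall>A\<in>Pow {a}. n A = n' A" by (simp add: Pow_insert)
qed (simp_all add: E)

lemma complete_intersection_K3:
  assumes G: "simple_graph G" and dist: "distinct [a, b, c]" and V: "verts G = {a, b, c}"
    and E: "edges G = {{a, b}, {a, c}, {b, c}}"
  shows "complete_intersection (partitions G) (cut_ideal G :: (_, 'k::field) mpolynomial set)"
proof (rule cut_complete_intersectionI[OF G, where z = c and B = "{a, b}" and es = "[(a, b), (a, c), (b, c)]"
      and qs = "[]"])
  have d: "a \<noteq> b" "a \<noteq> c" "b \<noteq> c" using dist by auto
  have ne: "distinct [{}, {a}, {b}, {a, b}]" by (rule distinct_subsets2; use d in simp)
  then have ne': "distinct (rev [{}, {a}, {b}, {a, b}])" by (simp only: distinct_rev)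
  let ?es = "[(a, b), (a, c), (b, c)]" and ?qs = "[]"
  show "verts G = insert c {a, b}" "c \<notin> {a, b}" using V d by auto
  show "sorted_wrt (\<lambda>(As, Bs) (As', Bs'). set As \<inter> (set As' \<union> set Bs') = {}) ?qs"
    using ne ne' by simp
  show "\<forall>(As, Bs)\<in>set ?qs. As \<noteq> [] \<and> distinct As \<and> length As = length Bs \<and>
      set As \<subseteq> Pow {a, b} \<and> set Bs \<subseteq> Pow {a, b} \<and> set As \<inter> set Bs = {}"
    using ne ne' by simp
  show "\<forall>(As, Bs)\<in>set ?qs. \<forall>e\<in>set ?es. sum_list (map (splits e) As) = sum_list (map (splits e) Bs)"
    using d by (simp add: splits_def)
  fix n n' :: "_ \<Rightarrow> nat"
  assume z: "\<forall>(As, Bs)\<in>set ?qs. (\<exists>A\<in>set As. n A = 0) \<and> (\<exists>A\<in>set As. n' A = 0)"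
    and s: "(\<Sum>A\<in>Pow {a, b}. n A) = (\<Sum>A\<in>Pow {a, b}. n' A)"
    and e: "\<forall>e\<in>set ?es. (\<Sum>A\<in>Pow {a, b}. n A * splits e A) = (\<Sum>A\<in>Pow {a, b}. n' A * splits e A)"
  have eqs: "n {} + n {a} + n {b} + n {a, b}
      = n' {} + n' {a} + n' {b} + n' {a, b}"
    "n {a} + n {b} = n' {a} + n' {b}"
    "n {a} + n {a, b} = n' {a} + n' {a, b}"
    "n {b} + n {a, b} = n' {b} + n' {a, b}"
    using s e d by (simp_all add: sum_Pow_insert) (simp_all add: splits_def)
  have "n {} = n' {} \<and> n {a} = n' {a} \<and> n {b} = n' {b} \<and> n {a, b} = n' {a, b}"
    using eqs by arith
  then show "\<forall>A\<in>Pow {a, b}. n A = n' A" by (simp add: Pow_insert)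
qed (simp_all add: E)

text \<open>With the middle vertex \<open>c\<close> fixed, the sides of \<open>a\<close> and
  \<open>b\<close> are independent: this is the quadric of a product of two projective
  lines.\<close>

lemma complete_intersection_P3:
  assumes G: "simple_graph G" and dist: "distinct [a, b, c]" and V: "verts G = {a, b, c}"
    and E: "edges G = {{a, c}, {b, c}}"
  shows "complete_intersection (partitions G) (cut_ideal G :: (_, 'k::field) mpolynomial set)"
proof (rule cut_complete_intersectionI[OF G, where z = c and B = "{a, b}" and es = "[(a, c), (b, c)]"
      and qs = "[([{}, {a, b}], [{a}, {b}])]"])
  have d: "a \<noteq> b" "a \<noteq> c" "b \<noteq> c" using dist by auto
  have ne: "distinct [{}, {a}, {b}, {a, b}]" by (rule distinct_subsets2; use d in simp)
  then have ne': "distinct (rev [{}, {a}, {b}, {a, b}])" by (simp only: distinct_rev)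
  let ?es = "[(a, c), (b, c)]" and ?qs = "[([{}, {a, b}], [{a}, {b}])]"
  show "verts G = insert c {a, b}" "c \<notin> {a, b}" using V d by auto
  show "sorted_wrt (\<lambda>(As, Bs) (As', Bs'). set As \<inter> (set As' \<union> set Bs') = {}) ?qs"
    using ne ne' by simp
  show "\<forall>(As, Bs)\<in>set ?qs. As \<noteq> [] \<and> distinct As \<and> length As = length Bs \<and>
      set As \<subseteq> Pow {a, b} \<and> set Bs \<subseteq> Pow {a, b} \<and> set As \<inter> set Bs = {}"
    using ne ne' by simp
  show "\<forall>(As, Bs)\<in>set ?qs. \<forall>e\<in>set ?es. sum_list (map (splits e) As) = sum_list (map (splits e) Bs)"
    using d by (simp add: splits_def)
  fix n n' :: "_ \<Rightarrow> nat"
  assume z: "\<forall>(As, Bs)\<in>set ?qs. (\<exists>A\<in>set As. n A = 0) \<and> (\<exists>A\<in>set As. n' A = 0)"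
    and s: "(\<Sum>A\<in>Pow {a, b}. n A) = (\<Sum>A\<in>Pow {a, b}. n' A)"
    and e: "\<forall>e\<in>set ?es. (\<Sum>A\<in>Pow {a, b}. n A * splits e A) = (\<Sum>A\<in>Pow {a, b}. n' A * splits e A)"
  have eqs: "n {} + n {a} + n {b} + n {a, b}
      = n' {} + n' {a} + n' {b} + n' {a, b}"
    "n {a} + n {a, b} = n' {a} + n' {a, b}"
    "n {b} + n {a, b} = n' {b} + n' {a, b}"
    using s e d by (simp_all add: sum_Pow_insert) (simp_all add: splits_def)
  have zs: "(n {} = 0 \<or> n {a, b} = 0) \<and> (n' {} = 0 \<or> n' {a, b} = 0)"
    using z by simp_all
  have p0: "n {} = n' {} \<and> n {a, b} = n' {a, b}"
    by (rule zero_pair[OF zs(1)]) (use eqs  in linarith)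
  have "n {} = n' {} \<and> n {a} = n' {a} \<and> n {b} = n' {b} \<and> n {a, b} = n' {a, b}"
    by (intro conjI; use eqs p0 in linarith)
  then show "\<forall>A\<in>Pow {a, b}. n A = n' A" by (simp add: Pow_insert)
qed (simp_all add: E)

text \<open>Moving \<open>a\<close> and \<open>b\<close> to the other side at once preserves the
  cut, which gives four linear binomials. The four remaining variables satisfy the quadric of a
  product of two projective lines.\<close>

lemma complete_intersection_2K2:
  assumes G: "simple_graph G" and dist: "distinct [a, b, c, d]" and V: "verts G = {a, b, c, d}"
    and E: "edges G = {{a, b}, {c, d}}"
  shows "complete_intersection (partitions G) (cut_ideal G :: (_, 'k::field) mpolynomial set)"
proof (rule cut_complete_intersectionI[OF G, where z = d and B = "{a, b, c}" and es = "[(a, b), (c, d)]"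
      and qs = "[([{a, b}], [{}]), ([{b}], [{a}]), ([{a, b, c}], [{c}]), ([{b, c}], [{a, c}]), ([{}, {a, c}], [{a}, {c}])]"])
  have d: "a \<noteq> b" "a \<noteq> c" "a \<noteq> d" "b \<noteq> c" "b \<noteq> d" "c \<noteq> d" using dist by auto
  have ne: "distinct [{}, {a}, {b}, {c}, {a, b}, {a, c}, {b, c}, {a, b, c}]" by (rule distinct_subsets3; use d in simp)
  then have ne': "distinct (rev [{}, {a}, {b}, {c}, {a, b}, {a, c}, {b, c}, {a, b, c}])" by (simp only: distinct_rev)
  let ?es = "[(a, b), (c, d)]" and ?qs = "[([{a, b}], [{}]), ([{b}], [{a}]), ([{a, b, c}], [{c}]), ([{b, c}], [{a, c}]), ([{}, {a, c}], [{a}, {c}])]"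
  show "verts G = insert d {a, b, c}" "d \<notin> {a, b, c}" using V d by auto
  show "sorted_wrt (\<lambda>(As, Bs) (As', Bs'). set As \<inter> (set As' \<union> set Bs') = {}) ?qs"
    using ne ne' by simp
  show "\<forall>(As, Bs)\<in>set ?qs. As \<noteq> [] \<and> distinct As \<and> length As = length Bs \<and>
      set As \<subseteq> Pow {a, b, c} \<and> set Bs \<subseteq> Pow {a, b, c} \<and> set As \<inter> set Bs = {}"
    using ne ne' by simp
  show "\<forall>(As, Bs)\<in>set ?qs. \<forall>e\<in>set ?es. sum_list (map (splits e) As) = sum_list (map (splits e) Bs)"
    using d by (simp add: splits_def)
  fix n n' :: "_ \<Rightarrow> nat"
  assume z: "\<forall>(As, Bs)\<in>set ?qs. (\<exists>A\<in>set As. n A = 0) \<and> (\<exists>A\<in>set As. n' A = 0)"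
    and s: "(\<Sum>A\<in>Pow {a, b, c}. n A) = (\<Sum>A\<in>Pow {a, b, c}. n' A)"
    and e: "\<forall>e\<in>set ?es. (\<Sum>A\<in>Pow {a, b, c}. n A * splits e A) = (\<Sum>A\<in>Pow {a, b, c}. n' A * splits e A)"
  have eqs: "n {} + n {a} + n {b} + n {c} + n {a, b} + n {a, c} + n {b, c} + n {a, b, c}
      = n' {} + n' {a} + n' {b} + n' {c} + n' {a, b} + n' {a, c} + n' {b, c} + n' {a, b, c}"
    "n {a} + n {b} + n {a, c} + n {b, c} = n' {a} + n' {b} + n' {a, c} + n' {b, c}"
    "n {c} + n {a, c} + n {b, c} + n {a, b, c} = n' {c} + n' {a, c} + n' {b, c} + n' {a, b, c}"
    using s e d by (simp_all add: sum_Pow_insert) (simp_all add: splits_def)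
  have zs: "n {a, b} = 0 \<and> n' {a, b} = 0" "n {b} = 0 \<and> n' {b} = 0" "n {a, b, c} = 0 \<and> n' {a, b, c} = 0" "n {b, c} = 0 \<and> n' {b, c} = 0" "(n {} = 0 \<or> n {a, c} = 0) \<and> (n' {} = 0 \<or> n' {a, c} = 0)"
    using z by simp_all
  have p4: "n {} = n' {} \<and> n {a, c} = n' {a, c}"
    by (rule zero_pair[OF zs(5)]) (use eqs zs(1) zs(2) zs(3) zs(4) in linarith)
  have "n {} = n' {} \<and> n {a} = n' {a} \<and> n {b} = n' {b} \<and> n {c} = n' {c} \<and> n {a, b} = n' {a, b} \<and> n {a, c} = n' {a, c} \<and> n {b, c} = n' {b, c} \<and> n {a, b, c} = n' {a, b, c}"
    by (intro conjI; use eqs zs(1) zs(2) zs(3) zs(4) p4 in linarith)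
  then show "\<forall>A\<in>Pow {a, b, c}. n A = n' A" by (simp add: Pow_insert)
qed (simp_all add: E)

text \<open>The cuts of a four-cycle are its edge sets of even size. They form four complementary
  pairs, each covering every edge once; three of these are rewritten to the fourth, the empty and
  the full cut.\<close>

lemma complete_intersection_C4:
  assumes G: "simple_graph G" and dist: "distinct [a, b, c, d]" and V: "verts G = {a, b, c, d}"
    and E: "edges G = {{a, b}, {b, c}, {c, d}, {a, d}}"
  shows "complete_intersection (partitions G) (cut_ideal G :: (_, 'k::field) mpolynomial set)"
proof (rule cut_complete_intersectionI[OF G, where z = d and B = "{a, b, c}" and es = "[(a, b), (b, c), (c, d), (a, d)]"
      and qs = "[([{a}, {c}], [{}, {a, c}]), ([{b}, {a, b, c}], [{}, {a, c}]), ([{a, b}, {b, c}], [{}, {a, c}])]"])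
  have d: "a \<noteq> b" "a \<noteq> c" "a \<noteq> d" "b \<noteq> c" "b \<noteq> d" "c \<noteq> d" using dist by auto
  have ne: "distinct [{}, {a}, {b}, {c}, {a, b}, {a, c}, {b, c}, {a, b, c}]" by (rule distinct_subsets3; use d in simp)
  then have ne': "distinct (rev [{}, {a}, {b}, {c}, {a, b}, {a, c}, {b, c}, {a, b, c}])" by (simp only: distinct_rev)
  let ?es = "[(a, b), (b, c), (c, d), (a, d)]" and ?qs = "[([{a}, {c}], [{}, {a, c}]), ([{b}, {a, b, c}], [{}, {a, c}]), ([{a, b}, {b, c}], [{}, {a, c}])]"
  show "verts G = insert d {a, b, c}" "d \<notin> {a, b, c}" using V d by auto
  show "sorted_wrt (\<lambda>(As, Bs) (As', Bs'). set As \<inter> (set As' \<union> set Bs') = {}) ?qs"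
    using ne ne' by simp
  show "\<forall>(As, Bs)\<in>set ?qs. As \<noteq> [] \<and> distinct As \<and> length As = length Bs \<and>
      set As \<subseteq> Pow {a, b, c} \<and> set Bs \<subseteq> Pow {a, b, c} \<and> set As \<inter> set Bs = {}"
    using ne ne' by simp
  show "\<forall>(As, Bs)\<in>set ?qs. \<forall>e\<in>set ?es. sum_list (map (splits e) As) = sum_list (map (splits e) Bs)"
    using d by (simp add: splits_def)
  fix n n' :: "_ \<Rightarrow> nat"
  assume z: "\<forall>(As, Bs)\<in>set ?qs. (\<exists>A\<in>set As. n A = 0) \<and> (\<exists>A\<in>set As. n' A = 0)"
    and s: "(\<Sum>A\<in>Pow {a, b, c}. n A) = (\<Sum>A\<in>Pow {a, b, c}. n' A)"
    and e: "\<forall>e\<in>set ?es. (\<Sum>A\<in>Pow {a, b, c}. n A * splits e A) = (\<Sum>A\<in>Pow {a, b, c}. n' A * splits e A)"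
  have eqs: "n {} + n {a} + n {b} + n {c} + n {a, b} + n {a, c} + n {b, c} + n {a, b, c}
      = n' {} + n' {a} + n' {b} + n' {c} + n' {a, b} + n' {a, c} + n' {b, c} + n' {a, b, c}"
    "n {a} + n {b} + n {a, c} + n {b, c} = n' {a} + n' {b} + n' {a, c} + n' {b, c}"
    "n {b} + n {c} + n {a, b} + n {a, c} = n' {b} + n' {c} + n' {a, b} + n' {a, c}"
    "n {c} + n {a, c} + n {b, c} + n {a, b, c} = n' {c} + n' {a, c} + n' {b, c} + n' {a, b, c}"
    "n {a} + n {a, b} + n {a, c} + n {a, b, c} = n' {a} + n' {a, b} + n' {a, c} + n' {a, b, c}"
    using s e d by (simp_all add: sum_Pow_insert) (simp_all add: splits_def)
  have zs: "(n {a} = 0 \<or> n {c} = 0) \<and> (n' {a} = 0 \<or> n' {c} = 0)" "(n {b} = 0 \<or> n {a, b, c} = 0) \<and> (n' {b} = 0 \<or> n' {a, b, c} = 0)" "(n {a, b} = 0 \<or> n {b, c} = 0) \<and> (n' {a, b} = 0 \<or> n' {b, c} = 0)"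
    using z by simp_all
  have p0: "n {a} = n' {a} \<and> n {c} = n' {c}"
    by (rule zero_pair[OF zs(1)]) (use eqs  in linarith)
  have p1: "n {b} = n' {b} \<and> n {a, b, c} = n' {a, b, c}"
    by (rule zero_pair[OF zs(2)]) (use eqs p0 in linarith)
  have p2: "n {a, b} = n' {a, b} \<and> n {b, c} = n' {b, c}"
    by (rule zero_pair[OF zs(3)]) (use eqs p0 p1 in linarith)
  have "n {} = n' {} \<and> n {a} = n' {a} \<and> n {b} = n' {b} \<and> n {c} = n' {c} \<and> n {a, b} = n' {a, b} \<and> n {a, c} = n' {a, c} \<and> n {b, c} = n' {b, c} \<and> n {a, b, c} = n' {a, b, c}"
    by (intro conjI; use eqs p0 p1 p2 in linarith)
  then show "\<forall>A\<in>Pow {a, b, c}. n A = n' A" by (simp add: Pow_insert)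
qed (simp_all add: E)

text \<open>Once the position of the adjacent vertices \<open>c\<close> and \<open>d\<close> is
  fixed, the sides of \<open>a\<close> and \<open>b\<close> are independent. This gives one quadric
  with \<open>c\<close> and \<open>d\<close> together and one with them apart.\<close>

lemma complete_intersection_K4_minus_edge:
  assumes G: "simple_graph G" and dist: "distinct [a, b, c, d]" and V: "verts G = {a, b, c, d}"
    and E: "edges G = {{a, c}, {a, d}, {b, c}, {b, d}, {c, d}}"
  shows "complete_intersection (partitions G) (cut_ideal G :: (_, 'k::field) mpolynomial set)"
proof (rule cut_complete_intersectionI[OF G, where z = d and B = "{a, b, c}" and es = "[(a, c), (a, d), (b, c), (b, d), (c, d)]"
      and qs = "[([{}, {a, b}], [{a}, {b}]), ([{c}, {a, b, c}], [{a, c}, {b, c}])]"])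
  have d: "a \<noteq> b" "a \<noteq> c" "a \<noteq> d" "b \<noteq> c" "b \<noteq> d" "c \<noteq> d" using dist by auto
  have ne: "distinct [{}, {a}, {b}, {c}, {a, b}, {a, c}, {b, c}, {a, b, c}]" by (rule distinct_subsets3; use d in simp)
  then have ne': "distinct (rev [{}, {a}, {b}, {c}, {a, b}, {a, c}, {b, c}, {a, b, c}])" by (simp only: distinct_rev)
  let ?es = "[(a, c), (a, d), (b, c), (b, d), (c, d)]" and ?qs = "[([{}, {a, b}], [{a}, {b}]), ([{c}, {a, b, c}], [{a, c}, {b, c}])]"
  show "verts G = insert d {a, b, c}" "d \<notin> {a, b, c}" using V d by auto
  show "sorted_wrt (\<lambda>(As, Bs) (As', Bs'). set As \<inter> (set As' \<union> set Bs') = {}) ?qs"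
    using ne ne' by simp
  show "\<forall>(As, Bs)\<in>set ?qs. As \<noteq> [] \<and> distinct As \<and> length As = length Bs \<and>
      set As \<subseteq> Pow {a, b, c} \<and> set Bs \<subseteq> Pow {a, b, c} \<and> set As \<inter> set Bs = {}"
    using ne ne' by simp
  show "\<forall>(As, Bs)\<in>set ?qs. \<forall>e\<in>set ?es. sum_list (map (splits e) As) = sum_list (map (splits e) Bs)"
    using d by (simp add: splits_def)
  fix n n' :: "_ \<Rightarrow> nat"
  assume z: "\<forall>(As, Bs)\<in>set ?qs. (\<exists>A\<in>set As. n A = 0) \<and> (\<exists>A\<in>set As. n' A = 0)"
    and s: "(\<Sum>A\<in>Pow {a, b, c}. n A) = (\<Sum>A\<in>Pow {a, b, c}. n' A)"
    and e: "\<forall>e\<in>set ?es. (\<Sum>A\<in>Pow {a, b, c}. n A * splits e A) = (\<Sum>A\<in>Pow {a, b, c}. n' A * splits e A)"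
  have eqs: "n {} + n {a} + n {b} + n {c} + n {a, b} + n {a, c} + n {b, c} + n {a, b, c}
      = n' {} + n' {a} + n' {b} + n' {c} + n' {a, b} + n' {a, c} + n' {b, c} + n' {a, b, c}"
    "n {a} + n {c} + n {a, b} + n {b, c} = n' {a} + n' {c} + n' {a, b} + n' {b, c}"
    "n {a} + n {a, b} + n {a, c} + n {a, b, c} = n' {a} + n' {a, b} + n' {a, c} + n' {a, b, c}"
    "n {b} + n {c} + n {a, b} + n {a, c} = n' {b} + n' {c} + n' {a, b} + n' {a, c}"
    "n {b} + n {a, b} + n {b, c} + n {a, b, c} = n' {b} + n' {a, b} + n' {b, c} + n' {a, b, c}"
    "n {c} + n {a, c} + n {b, c} + n {a, b, c} = n' {c} + n' {a, c} + n' {b, c} + n' {a, b, c}"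
    using s e d by (simp_all add: sum_Pow_insert) (simp_all add: splits_def)
  have zs: "(n {} = 0 \<or> n {a, b} = 0) \<and> (n' {} = 0 \<or> n' {a, b} = 0)" "(n {c} = 0 \<or> n {a, b, c} = 0) \<and> (n' {c} = 0 \<or> n' {a, b, c} = 0)"
    using z by simp_all
  have p0: "n {} = n' {} \<and> n {a, b} = n' {a, b}"
    by (rule zero_pair[OF zs(1)]) (use eqs  in linarith)
  have p1: "n {c} = n' {c} \<and> n {a, b, c} = n' {a, b, c}"
    by (rule zero_pair[OF zs(2)]) (use eqs p0 in linarith)
  have "n {} = n' {} \<and> n {a} = n' {a} \<and> n {b} = n' {b} \<and> n {c} = n' {c} \<and> n {a, b} = n' {a, b} \<and> n {a, c} = n' {a, c} \<and> n {b, c} = n' {b, c} \<and> n {a, b, c} = n' {a, b, c}"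
    by (intro conjI; use eqs p0 p1 in linarith)
  then show "\<forall>A\<in>Pow {a, b, c}. n A = n' A" by (simp add: Pow_insert)
qed (simp_all add: E)

text \<open>The quartic compares the subsets of \<open>{a, b, c}\<close> of even size with those of
  odd size; it is the relation behind \<open>cut_shape_K4\<close>.\<close>

lemma complete_intersection_K4:
  assumes G: "simple_graph G" and dist: "distinct [a, b, c, d]" and V: "verts G = {a, b, c, d}"
    and E: "edges G = {{a, b}, {a, c}, {a, d}, {b, c}, {b, d}, {c, d}}"
  shows "complete_intersection (partitions G) (cut_ideal G :: (_, 'k::field) mpolynomial set)"
proof (rule cut_complete_intersectionI[OF G, where z = d and B = "{a, b, c}" and es = "[(a, b), (a, c), (a, d), (b, c), (b, d), (c, d)]"
      and qs = "[([{}, {a, b}, {a, c}, {b, c}], [{a}, {b}, {c}, {a, b, c}])]"])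
  have d: "a \<noteq> b" "a \<noteq> c" "a \<noteq> d" "b \<noteq> c" "b \<noteq> d" "c \<noteq> d" using dist by auto
  have ne: "distinct [{}, {a}, {b}, {c}, {a, b}, {a, c}, {b, c}, {a, b, c}]" by (rule distinct_subsets3; use d in simp)
  then have ne': "distinct (rev [{}, {a}, {b}, {c}, {a, b}, {a, c}, {b, c}, {a, b, c}])" by (simp only: distinct_rev)
  let ?es = "[(a, b), (a, c), (a, d), (b, c), (b, d), (c, d)]" and ?qs = "[([{}, {a, b}, {a, c}, {b, c}], [{a}, {b}, {c}, {a, b, c}])]"
  show "verts G = insert d {a, b, c}" "d \<notin> {a, b, c}" using V d by auto
  show "sorted_wrt (\<lambda>(As, Bs) (As', Bs'). set As \<inter> (set As' \<union> set Bs') = {}) ?qs"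
    using ne ne' by simp
  show "\<forall>(As, Bs)\<in>set ?qs. As \<noteq> [] \<and> distinct As \<and> length As = length Bs \<and>
      set As \<subseteq> Pow {a, b, c} \<and> set Bs \<subseteq> Pow {a, b, c} \<and> set As \<inter> set Bs = {}"
    using ne ne' by simp
  show "\<forall>(As, Bs)\<in>set ?qs. \<forall>e\<in>set ?es. sum_list (map (splits e) As) = sum_list (map (splits e) Bs)"
    using d by (simp add: splits_def)
  fix n n' :: "_ \<Rightarrow> nat"
  assume z: "\<forall>(As, Bs)\<in>set ?qs. (\<exists>A\<in>set As. n A = 0) \<and> (\<exists>A\<in>set As. n' A = 0)"
    and s: "(\<Sum>A\<in>Pow {a, b, c}. n A) = (\<Sum>A\<in>Pow {a, b, c}. n' A)"
    and e: "\<forall>e\<in>set ?es. (\<Sum>A\<in>Pow {a, b, c}. n A * splits e A) = (\<Sum>A\<in>Pow {a, b, c}. n' A * splits e A)"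
  have eqs: "n {} + n {a} + n {b} + n {c} + n {a, b} + n {a, c} + n {b, c} + n {a, b, c}
      = n' {} + n' {a} + n' {b} + n' {c} + n' {a, b} + n' {a, c} + n' {b, c} + n' {a, b, c}"
    "n {a} + n {b} + n {a, c} + n {b, c} = n' {a} + n' {b} + n' {a, c} + n' {b, c}"
    "n {a} + n {c} + n {a, b} + n {b, c} = n' {a} + n' {c} + n' {a, b} + n' {b, c}"
    "n {a} + n {a, b} + n {a, c} + n {a, b, c} = n' {a} + n' {a, b} + n' {a, c} + n' {a, b, c}"
    "n {b} + n {c} + n {a, b} + n {a, c} = n' {b} + n' {c} + n' {a, b} + n' {a, c}"
    "n {b} + n {a, b} + n {b, c} + n {a, b, c} = n' {b} + n' {a, b} + n' {b, c} + n' {a, b, c}"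
    "n {c} + n {a, c} + n {b, c} + n {a, b, c} = n' {c} + n' {a, c} + n' {b, c} + n' {a, b, c}"
    using s e d by (simp_all add: sum_Pow_insert) (simp_all add: splits_def)
  have zs: "(n {} = 0 \<or> n {a, b} = 0 \<or> n {a, c} = 0 \<or> n {b, c} = 0) \<and> (n' {} = 0 \<or> n' {a, b} = 0 \<or> n' {a, c} = 0 \<or> n' {b, c} = 0)"
    using z by simp_all
  have p0: "n {} = n' {}"
    by (rule zero_quad[OF zs(1)]) (use eqs in linarith)+
  have "n {} = n' {} \<and> n {a} = n' {a} \<and> n {b} = n' {b} \<and> n {c} = n' {c} \<and> n {a, b} = n' {a, b} \<and> n {a, c} = n' {a, c} \<and> n {b, c} = n' {b, c} \<and> n {a, b, c} = n' {a, b, c}"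
    by (intro conjI; use eqs p0 in linarith)
  then show "\<forall>A\<in>Pow {a, b, c}. n A = n' A" by (simp add: Pow_insert)
qed (simp_all add: E)

subsection \<open>Isomorphism with the listed graphs\<close>

text \<open>An isomorphism to a graph with enumerated vertices amounts to a list of the vertices of
  \<open>G\<close> in the corresponding order, which turns each listed graph into an explicit edge
  set.\<close>

lemma graph_iso_list:
  fixes G :: "'v ugraph" and H :: "'w ugraph"
  assumes G: "simple_graph G" and vs: "verts H = set vs" "distinct vs"
    and es: "edges H = (\<lambda>(i, j). {vs ! i, vs ! j}) ` set es" "\<forall>(i, j)\<in>set es. i < length vs \<and> j < length vs"
    and n: "length vs = n"
  shows "graph_iso G H \<longleftrightarrow> (\<exists>xs. distinct xs \<and> length xs = n \<and> verts G = set xs \<and>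
    edges G = (\<lambda>(i, j). {xs ! i, xs ! j}) ` set es)"
proof -
  let ?n = "length vs"
  have pair: "{ys ! k, ys ! l} \<in> (\<lambda>(i, j). {ys ! i, ys ! j}) ` set es \<longleftrightarrow> (k, l) \<in> set es \<or> (l, k) \<in> set es"
    if "distinct ys" "length ys = ?n" "k < ?n" "l < ?n" for ys :: "'z list" and k l
  proof
    assume "{ys ! k, ys ! l} \<in> (\<lambda>(i, j). {ys ! i, ys ! j}) ` set es"
    then obtain i j where ij: "(i, j) \<in> set es" "{ys ! k, ys ! l} = {ys ! i, ys ! j}" by auto
    then have "i < ?n" "j < ?n" using es(2) by auto
    with ij that show "(k, l) \<in> set es \<or> (l, k) \<in> set es"
      by (auto simp: doubleton_eq_iff nth_eq_iff_index_eq)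
  qed (auto simp: insert_commute intro: rev_image_eqI)
  show ?thesis
    unfolding n[symmetric]
  proof
    assume "graph_iso G H"
    then obtain f where f: "bij_betw f (verts G) (verts H)"
      and fe: "\<forall>i\<in>verts G. \<forall>j\<in>verts G. {i, j} \<in> edges G \<longleftrightarrow> {f i, f j} \<in> edges H"
      unfolding graph_iso_def by blast
    define g where "g = inv_into (verts G) f"
    let ?xs = "map g vs"
    have g: "bij_betw g (verts H) (verts G)" unfolding g_def by (rule bij_betw_inv_into[OF f])
    have fg: "f (g y) = y" if "y \<in> verts H" for y
      using f that by (simp add: g_def bij_betw_def f_inv_into_f)
    have V: "verts G = set ?xs" using g vs(1) by (simp add: bij_betw_def)
    have dist: "distinct ?xs" using g vs by (simp add: distinct_map bij_betw_def)
    have adj: "{?xs ! k, ?xs ! l} \<in> edges G \<longleftrightarrow> (k, l) \<in> set es \<or> (l, k) \<in> set es" if "k < ?n" "l < ?n" for k l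
    proof -
      have m: "?xs ! k \<in> verts G" "?xs ! l \<in> verts G" unfolding V using that by simp_all
      have "{?xs ! k, ?xs ! l} \<in> edges G \<longleftrightarrow> {f (?xs ! k), f (?xs ! l)} \<in> edges H" using fe m by blast
      also have "\<dots> \<longleftrightarrow> {vs ! k, vs ! l} \<in> edges H" using that fg vs(1) by simp
      also have "\<dots> \<longleftrightarrow> (k, l) \<in> set es \<or> (l, k) \<in> set es" unfolding es(1) by (rule pair[OF vs(2) refl that])
      finally show ?thesis .
    qed
    have "edges G = (\<lambda>(i, j). {?xs ! i, ?xs ! j}) ` set es"
    proof (rule edges_eqI[OF G])
      show "(\<lambda>(i, j). {?xs ! i, ?xs ! j}) ` set es \<subseteq> edges G"
      proof
        fix e assume "e \<in> (\<lambda>(i, j). {?xs ! i, ?xs ! j}) ` set es"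
        then obtain p where p: "p \<in> set es" "e = (\<lambda>(i, j). {?xs ! i, ?xs ! j}) p" unfolding image_iff by (elim bexE)
        obtain i j where "p = (i, j)" by (cases p)
        with p have ij: "(i, j) \<in> set es" "e = {?xs ! i, ?xs ! j}" by simp_all
        then have lt: "i < ?n" "j < ?n" using es(2) by auto
        show "e \<in> edges G" unfolding ij(2) adj[OF lt] using ij(1) by blast
      qed
      fix u v assume uv: "u \<in> verts G" "v \<in> verts G" "{u, v} \<in> edges G"
      obtain k where k: "k < ?n" "u = ?xs ! k" using uv(1) unfolding V by (metis in_set_conv_nth length_map)
      obtain l where l: "l < ?n" "v = ?xs ! l" using uv(2) unfolding V by (metis in_set_conv_nth length_map)
      have "(k, l) \<in> set es \<or> (l, k) \<in> set es" using adj[OF k(1) l(1)] uv(3) k(2) l(2) by simp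
      then show "{u, v} \<in> (\<lambda>(i, j). {?xs ! i, ?xs ! j}) ` set es"
        unfolding k(2) l(2) using pair[OF dist length_map k(1) l(1)] by blast
    qed
    with V dist show "\<exists>xs. distinct xs \<and> length xs = ?n \<and> verts G = set xs \<and> edges G = (\<lambda>(i, j). {xs ! i, xs ! j}) ` set es"
      by (intro exI[of _ ?xs]) simp
  next
    assume "\<exists>xs. distinct xs \<and> length xs = ?n \<and> verts G = set xs \<and> edges G = (\<lambda>(i, j). {xs ! i, xs ! j}) ` set es"
    then obtain xs where xs: "distinct xs" "length xs = ?n" "verts G = set xs"
      "edges G = (\<lambda>(i, j). {xs ! i, xs ! j}) ` set es" by (elim exE conjE)
    have bx: "bij_betw ((!) xs) {..<?n} (verts G)" using xs by (intro bij_betw_nth) simp_all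
    have bv: "bij_betw ((!) vs) {..<?n} (verts H)" using vs by (intro bij_betw_nth) simp_all
    let ?f = "(!) vs \<circ> the_inv_into {..<?n} ((!) xs)"
    have f: "bij_betw ?f (verts G) (verts H)"
      by (rule bij_betw_trans[OF bij_betw_the_inv_into[OF bx] bv])
    have fx: "?f (xs ! k) = vs ! k" if "k < ?n" for k
      using the_inv_into_f_f[of "(!) xs" "{..<?n}" k] bx that by (simp add: bij_betw_def)
    have "{i, j} \<in> edges G \<longleftrightarrow> {?f i, ?f j} \<in> edges H" if ij: "i \<in> verts G" "j \<in> verts G" for i j
    proof -
      obtain k where k: "k < ?n" "i = xs ! k" using ij(1) xs(2,3) by (metis in_set_conv_nth)
      obtain l where l: "l < ?n" "j = xs ! l" using ij(2) xs(2,3) by (metis in_set_conv_nth)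
      show ?thesis
        unfolding k(2) l(2) fx[OF k(1)] fx[OF l(1)] xs(4) es(1)
        using pair[OF xs(1,2) k(1) l(1)] pair[OF vs(2) refl k(1) l(1)] by blast
    qed
    with f show "graph_iso G H" unfolding graph_iso_def by blast
  qed
qed

lemma ex_list_explicit:
  "(\<exists>xs. distinct xs \<and> length xs = 2 \<and> P xs) \<longleftrightarrow> (\<exists>a b. distinct [a, b] \<and> P [a, b])"
  "(\<exists>xs. distinct xs \<and> length xs = 3 \<and> P xs) \<longleftrightarrow> (\<exists>a b c. distinct [a, b, c] \<and> P [a, b, c])"
  "(\<exists>xs. distinct xs \<and> length xs = 4 \<and> P xs) \<longleftrightarrow> (\<exists>a b c d. distinct [a, b, c, d] \<and> P [a, b, c, d])"
proof -
  have "length xs = 2 \<longleftrightarrow> (\<exists>a b. xs = [a, b])" "length xs = 3 \<longleftrightarrow> (\<exists>a b c. xs = [a, b, c])"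
    "length xs = 4 \<longleftrightarrow> (\<exists>a b c d. xs = [a, b, c, d])" for xs :: "'a list"
    by (auto simp: numeral_eq_Suc length_Suc_conv)
  then show "(\<exists>xs. distinct xs \<and> length xs = 2 \<and> P xs) \<longleftrightarrow> (\<exists>a b. distinct [a, b] \<and> P [a, b])"
    "(\<exists>xs. distinct xs \<and> length xs = 3 \<and> P xs) \<longleftrightarrow> (\<exists>a b c. distinct [a, b, c] \<and> P [a, b, c])"
    "(\<exists>xs. distinct xs \<and> length xs = 4 \<and> P xs) \<longleftrightarrow> (\<exists>a b c d. distinct [a, b, c, d] \<and> P [a, b, c, d])"
    by (simp_all only:) blast+
qed

lemma edges_complete_graph:
  "edges (complete_graph 2) = {{0, 1}}"
  "edges (complete_graph 3) = {{0, 1}, {0, 2}, {1, 2}}"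
  "edges (complete_graph 4) = {{0, 1}, {0, 2}, {0, 3}, {1, 2}, {1, 3}, {2, 3}}"
proof -
  have e: "edges (complete_graph n) = (\<Union>i\<in>{..<n}. (\<lambda>j. {i, j}) ` ({..<n} - {i}))" for n
    by (fastforce simp: complete_graph_def)
  have lt: "{..<2} = {0, 1 :: nat}" "{..<3} = {0, 1, 2 :: nat}" "{..<4} = {0, 1, 2, 3 :: nat}" by auto
  show "edges (complete_graph 2) = {{0, 1}}"
    "edges (complete_graph 3) = {{0, 1}, {0, 2}, {1, 2}}"
    "edges (complete_graph 4) = {{0, 1}, {0, 2}, {0, 3}, {1, 2}, {1, 3}, {2, 3}}"
    unfolding e lt by (simp_all add: insert_Diff_if insert_commute)
qed

lemma graph_iso_listed:
  assumes G: "simple_graph G"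
  shows "graph_iso G (complete_graph 2) \<longleftrightarrow>
      (\<exists>a b. distinct [a, b] \<and> verts G = {a, b} \<and> edges G = {{a, b}})"
    and "graph_iso G (complete_graph 3) \<longleftrightarrow>
      (\<exists>a b c. distinct [a, b, c] \<and> verts G = {a, b, c} \<and> edges G = {{a, b}, {a, c}, {b, c}})"
    and "graph_iso G (path_graph 3) \<longleftrightarrow>
      (\<exists>a b c. distinct [a, b, c] \<and> verts G = {a, b, c} \<and> edges G = {{a, c}, {b, c}})"
    and "graph_iso G (disjoint_union_graph (complete_graph 2) (complete_graph 2)) \<longleftrightarrow>
      (\<exists>a b c d. distinct [a, b, c, d] \<and> verts G = {a, b, c, d} \<and> edges G = {{a, b}, {c, d}})"
    and "graph_iso G (cycle_graph 4) \<longleftrightarrow>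
      (\<exists>a b c d. distinct [a, b, c, d] \<and> verts G = {a, b, c, d} \<and> edges G = {{a, b}, {b, c}, {c, d}, {a, d}})"
    and "graph_iso G (delete_edge (complete_graph 4) {0, 1}) \<longleftrightarrow>
      (\<exists>a b c d. distinct [a, b, c, d] \<and> verts G = {a, b, c, d} \<and>
         edges G = {{a, c}, {a, d}, {b, c}, {b, d}, {c, d}})"
    and "graph_iso G (complete_graph 4) \<longleftrightarrow>
      (\<exists>a b c d. distinct [a, b, c, d] \<and> verts G = {a, b, c, d} \<and>
         edges G = {{a, b}, {a, c}, {a, d}, {b, c}, {b, d}, {c, d}})"
proof -
  have lt: "{..<2} = {0, 1 :: nat}" "{..<3} = {0, 1, 2 :: nat}" "{..<4} = {0, 1, 2, 3 :: nat}" by auto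
  have path: "edges (path_graph 3) = {{0, 1}, {1, 2}}"
    unfolding path_graph_def by (auto simp: less_Suc_eq numeral_eq_Suc)
  have cycle: "edges (cycle_graph 4) = {{0, 1}, {1, 2}, {2, 3}, {0, 3}}"
  proof -
    have "edges (cycle_graph 4) = (\<lambda>i. {i, Suc i mod 4}) ` {..<4}" unfolding cycle_graph_def by auto
    then show ?thesis unfolding lt by (simp add: insert_commute numeral_2_eq_2[symmetric])
  qed
  have minus: "edges (delete_edge (complete_graph 4) {0, 1}) = {{0, 2}, {0, 3}, {1, 2}, {1, 3}, {2, 3}}"
    by (simp add: delete_edge_def edges_complete_graph insert_Diff_if doubleton_eq_iff)
  have union: "edges (disjoint_union_graph (complete_graph 2) (complete_graph 2)) = {{Inl 0, Inl 1}, {Inr 0, Inr 1}}"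
    by (simp add: disjoint_union_graph_def edges_complete_graph insert_commute)
  note edges = edges_complete_graph path cycle minus minus[unfolded One_nat_def] union
  have verts: "verts (complete_graph n) = {..<n}" "verts (path_graph n) = {..<n}" "verts (cycle_graph n) = {..<n}"
    "verts (delete_edge H e) = verts H" "verts (disjoint_union_graph H H') = verts H <+> verts H'"
    for n e and H H' :: "nat ugraph"
    by (simp_all add: complete_graph_def path_graph_def cycle_graph_def delete_edge_def disjoint_union_graph_def)
  have i0: "graph_iso G (complete_graph 2) \<longleftrightarrow> (\<exists>xs. distinct xs \<and> length xs = 2 \<and> verts G = set xs \<and>
      edges G = (\<lambda>(i, j). {xs ! i, xs ! j}) ` set [(0, 1)])"
    by (rule graph_iso_list[OF G, where vs = "[0, 1]"]) (simp_all add: verts edges lt Plus_def insert_commute)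
  show "graph_iso G (complete_graph 2) \<longleftrightarrow>
      (\<exists>a b. distinct [a, b] \<and> verts G = {a, b} \<and> edges G = {{a, b}})"
    unfolding i0 ex_list_explicit by simp
  have i1: "graph_iso G (complete_graph 3) \<longleftrightarrow> (\<exists>xs. distinct xs \<and> length xs = 3 \<and> verts G = set xs \<and>
      edges G = (\<lambda>(i, j). {xs ! i, xs ! j}) ` set [(0, 1), (0, 2), (1, 2)])"
    by (rule graph_iso_list[OF G, where vs = "[0, 1, 2]"]) (simp_all add: verts edges lt Plus_def insert_commute)
  show "graph_iso G (complete_graph 3) \<longleftrightarrow>
      (\<exists>a b c. distinct [a, b, c] \<and> verts G = {a, b, c} \<and> edges G = {{a, b}, {a, c}, {b, c}})"
    unfolding i1 ex_list_explicit by simp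
  \<comment> \<open>The middle vertex \<open>1\<close> is listed last, because the explicit form of
    the path has its centre there.\<close>
  have i2: "graph_iso G (path_graph 3) \<longleftrightarrow> (\<exists>xs. distinct xs \<and> length xs = 3 \<and> verts G = set xs \<and>
      edges G = (\<lambda>(i, j). {xs ! i, xs ! j}) ` set [(0, 2), (1, 2)])"
    by (rule graph_iso_list[OF G, where vs = "[0, 2, 1]"]) (simp_all add: verts edges lt Plus_def insert_commute)
  show "graph_iso G (path_graph 3) \<longleftrightarrow>
      (\<exists>a b c. distinct [a, b, c] \<and> verts G = {a, b, c} \<and> edges G = {{a, c}, {b, c}})"
    unfolding i2 ex_list_explicit by simp
  have i3: "graph_iso G (disjoint_union_graph (complete_graph 2) (complete_graph 2)) \<longleftrightarrow> (\<exists>xs. distinct xs \<and> length xs = 4 \<and> verts G = set xs \<and>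
      edges G = (\<lambda>(i, j). {xs ! i, xs ! j}) ` set [(0, 1), (2, 3)])"
    by (rule graph_iso_list[OF G, where vs = "[Inl 0, Inl 1, Inr 0, Inr 1]"]) (simp_all add: verts edges lt Plus_def insert_commute)
  show "graph_iso G (disjoint_union_graph (complete_graph 2) (complete_graph 2)) \<longleftrightarrow>
      (\<exists>a b c d. distinct [a, b, c, d] \<and> verts G = {a, b, c, d} \<and> edges G = {{a, b}, {c, d}})"
    unfolding i3 ex_list_explicit by simp
  have i4: "graph_iso G (cycle_graph 4) \<longleftrightarrow> (\<exists>xs. distinct xs \<and> length xs = 4 \<and> verts G = set xs \<and>
      edges G = (\<lambda>(i, j). {xs ! i, xs ! j}) ` set [(0, 1), (1, 2), (2, 3), (0, 3)])"
    by (rule graph_iso_list[OF G, where vs = "[0, 1, 2, 3]"]) (simp_all add: verts edges lt Plus_def insert_commute)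
  show "graph_iso G (cycle_graph 4) \<longleftrightarrow>
      (\<exists>a b c d. distinct [a, b, c, d] \<and> verts G = {a, b, c, d} \<and> edges G = {{a, b}, {b, c}, {c, d}, {a, d}})"
    unfolding i4 ex_list_explicit by simp
  have i5: "graph_iso G (delete_edge (complete_graph 4) {0, 1}) \<longleftrightarrow> (\<exists>xs. distinct xs \<and> length xs = 4 \<and> verts G = set xs \<and>
      edges G = (\<lambda>(i, j). {xs ! i, xs ! j}) ` set [(0, 2), (0, 3), (1, 2), (1, 3), (2, 3)])"
    by (rule graph_iso_list[OF G, where vs = "[0, 1, 2, 3]"]) (simp_all add: verts edges lt Plus_def insert_commute)
  show "graph_iso G (delete_edge (complete_graph 4) {0, 1}) \<longleftrightarrow>
      (\<exists>a b c d. distinct [a, b, c, d] \<and> verts G = {a, b, c, d} \<and>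
         edges G = {{a, c}, {a, d}, {b, c}, {b, d}, {c, d}})"
    unfolding i5 ex_list_explicit by simp
  have i6: "graph_iso G (complete_graph 4) \<longleftrightarrow> (\<exists>xs. distinct xs \<and> length xs = 4 \<and> verts G = set xs \<and>
      edges G = (\<lambda>(i, j). {xs ! i, xs ! j}) ` set [(0, 1), (0, 2), (0, 3), (1, 2), (1, 3), (2, 3)])"
    by (rule graph_iso_list[OF G, where vs = "[0, 1, 2, 3]"]) (simp_all add: verts edges lt Plus_def insert_commute)
  show "graph_iso G (complete_graph 4) \<longleftrightarrow>
      (\<exists>a b c d. distinct [a, b, c, d] \<and> verts G = {a, b, c, d} \<and>
         edges G = {{a, b}, {a, c}, {a, d}, {b, c}, {b, d}, {c, d}})"
    unfolding i6 ex_list_explicit by simp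
qed

theorem theorem6p9:
  fixes G :: "'v ugraph"
  assumes "simple_graph G"
    and "card (edges G) \<ge> 1"
    and "\<not> (\<exists>v. isolated_vertex G v)"
  shows "complete_intersection (partitions G)
           (cut_ideal G :: ('v set set, 'k::field) mpolynomial set)
     \<longleftrightarrow>
       graph_iso G (complete_graph 2) \<or>
       graph_iso G (complete_graph 3) \<or>
       graph_iso G (path_graph 3) \<or>
       graph_iso G (disjoint_union_graph (complete_graph 2) (complete_graph 2)) \<or>
       graph_iso G (cycle_graph 4) \<or>
       graph_iso G (delete_edge (complete_graph 4) {0, 1}) \<or>
       graph_iso G (complete_graph 4)"
proof -
  have "no_isolated G"
    unfolding no_isolated_def
  proof
    fix v assume v: "v \<in> verts G"
    then obtain e where e: "e \<in> edges G" "v \<in> e" using assms(3) unfolding isolated_vertex_def by blast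
    then obtain i j where "e = {i, j}" using edgeE[OF assms(1)] by metis
    with e show "\<exists>x. {v, x} \<in> edges G" by (auto simp: insert_commute)
  qed
  note listed = complete_intersection_imp_listed[OF assms(1) this, where 'k = 'k]
  note ci = complete_intersection_K2[OF assms(1)] complete_intersection_K3[OF assms(1)]
    complete_intersection_P3[OF assms(1)] complete_intersection_2K2[OF assms(1)]
    complete_intersection_C4[OF assms(1)] complete_intersection_K4_minus_edge[OF assms(1)]
    complete_intersection_K4[OF assms(1)]
  show ?thesis
    unfolding graph_iso_listed[OF assms(1)]
    by (rule iffI, rule listed, assumption, elim disjE exE conjE) (rule ci, assumption+)+
qed

end
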